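(* Let $L>0$, $\Omega=(-L,L)$, and let $\beta$ be an integrable kernel function whose Fourier transform satisfies, for some constant $C_0>0$ and some real $r\ge 2$, $$0\le\widehat{\beta}(k)\le C_0(1+k^2)^{-r/2}\quad\text{for all }k\in\mathbb{R}.$$ Let $s\ge r/2$, $g\in C^2(\mathbb{R})$, and let the initial data satisfy $\phi,\psi\in H^s_p(\Omega)$. Let $u(x,t)$ be the solution of the periodic initial value problem $$u_{tt}=\beta\ast(u+g(u))_{xx},\qquad u(x,0)=\phi(x),\quad u_t(x,0)=\psi(x),$$ satisfying $u\in C^1([0,T];H^s_p(\Omega))$ for any $T>0$, and let $u^N(x,t)$, a function from $[0,T]$ to $S_N$, be the solution of the semi-discrete scheme $$\mathcal{H}^{-1}u^N_{tt}=u^N_{xx}+P_N\big(g(u^N)\big)_{xx},\qquad u^N(x,0)=P_N\phi(x),\quad u^N_t(x,0)=P_N\psi(x).$$ Then there exists a constant $C(T)$, independent of $N$, such that $$\|u-u^N\|_{X_{r/2}}\le C(T)\,N^{r/2-s}\,\|u\|_{X_s}.$$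
   Context: The Fourier transform on $\mathbb{R}$ is $\hat v(k)=\int_{-\infty}^{\infty}v(x)e^{-ikx}\,dx$, with inverse $\mathcal{F}^{-1}$; $\ast$ denotes convolution in the space variable $x$. For a $2L$-periodic function $v$ the Fourier coefficients are $\hat v_k=\frac{1}{2L}\int_\Omega v(x)e^{-ik\pi x/L}\,dx$, $k\in\mathbb{Z}$. $H^s_p(\Omega)$ is the periodic Sobolev space with norm $\|v\|_s^2=\sum_{k=-\infty}^{\infty}(1+k^2)^s|\hat v_k|^2$. The Banach space $X_s=C^1([0,T];H^s_p(\Omega))$ has norm $\|u\|_{X_s}^2=\max_{t\in[0,T]}\big(\|u(t)\|_s^2+\|u_t(t)\|_s^2\big)$. $\mathcal{H}$ is the convolution operator $\mathcal{H}v(x)=\int_\Omega\beta(x-y)v(y)\,dy$, so that the equation is written $u_{tt}=\mathcal{H}[u+g(u)]_{xx}$, equivalently $\mathcal{H}^{-1}u_{tt}=[u+g(u)]_{xx}$, where $\mathcal{H}^{-1}$ is defined by $\mathcal{H}^{-1}v=\mathcal{F}^{-1}\big(\hat v(k)/\widehat{\beta}(k)\big)$, $k$ being the frequency variable. For a positive even integer $N$, $S_N=\mathrm{span}\{e^{ik\pi x/L}: -N/2\le k\le N/2-1\}$, and $P_N:L^2(\Omega)\to S_N$ is the $L^2$-orthogonal projection $P_Nv(x)=\sum_{k=-N/2}^{N/2-1}\hat v_k\,e^{ik\pi x/L}$. *)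

theory Defs
  imports "HOL-Analysis.Analysis"
begin

text \<open>Functions on the circle of length \<open>2 * L\<close> are represented by \<open>2 * L\<close>-periodic functions on the
  real line.  Elements of \<open>L\<^sup>2\<close> and of the Sobolev spaces are arbitrary measurable representatives, so
  equality of such elements is equality almost everywhere.\<close>

definition fourier_transform :: "(real \<Rightarrow> real) \<Rightarrow> real \<Rightarrow> complex" where
  "fourier_transform \<beta> k = (LINT x|lborel. of_real (\<beta> x) * exp (- \<i> * of_real (k * x)))"

definition mode :: "real \<Rightarrow> int \<Rightarrow> real \<Rightarrow> complex" where
  "mode L k x = exp (\<i> * of_real (of_int k * pi * x / L))"

definition fourier_coeff :: "real \<Rightarrow> (real \<Rightarrow> complex) \<Rightarrow> int \<Rightarrow> complex" where
  "fourier_coeff L v k =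
     of_real (1 / (2 * L)) * (LINT x:{-L<..<L}|lborel. v x * exp (- \<i> * of_real (of_int k * pi * x / L)))"

definition Hp_norm :: "real \<Rightarrow> real \<Rightarrow> (real \<Rightarrow> complex) \<Rightarrow> real" where
  "Hp_norm L s v =
     sqrt (\<Sum>\<^sub>\<infinity>k::int. (1 + (of_int k)\<^sup>2) powr s * (cmod (fourier_coeff L v k))\<^sup>2)"

text \<open>The space is only used for exponents \<open>s \<ge> 0\<close>, where its elements are square-integrable functions.\<close>

definition Hp :: "real \<Rightarrow> real \<Rightarrow> (real \<Rightarrow> complex) set" where
  "Hp L s = {v. (\<forall>x. v (x + 2 * L) = v x) \<and> v \<in> borel_measurable borel \<and>
     set_integrable lborel {-L<..<L} (\<lambda>x. (cmod (v x))\<^sup>2) \<and>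
     (\<lambda>k::int. (1 + (of_int k)\<^sup>2) powr s * (cmod (fourier_coeff L v k))\<^sup>2) summable_on UNIV}"

text \<open>Norm derivative in \<open>Hp L s\<close> of a curve on \<open>[0,T]\<close>, one-sided at the end points.\<close>

definition has_Hp_derivative ::
  "real \<Rightarrow> real \<Rightarrow> real \<Rightarrow> (real \<Rightarrow> real \<Rightarrow> complex) \<Rightarrow> (real \<Rightarrow> complex) \<Rightarrow> real \<Rightarrow> bool" where
  "has_Hp_derivative L s T u D t \<longleftrightarrow> D \<in> Hp L s \<and>
     ((\<lambda>\<tau>. Hp_norm L s (\<lambda>x. (1 / (\<tau> - t)) *\<^sub>R (u \<tau> x - u t x) - D x)) \<longlongrightarrow> 0) (at t within {0..T})"

text \<open>The derivative is determined up to a null set; the choice of representative affects neither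
  Fourier coefficients nor norms.\<close>

definition Hp_deriv ::
  "real \<Rightarrow> real \<Rightarrow> real \<Rightarrow> (real \<Rightarrow> real \<Rightarrow> complex) \<Rightarrow> real \<Rightarrow> real \<Rightarrow> complex" where
  "Hp_deriv L s T u t = (SOME D. has_Hp_derivative L s T u D t)"

definition X_space :: "real \<Rightarrow> real \<Rightarrow> real \<Rightarrow> (real \<Rightarrow> real \<Rightarrow> complex) set" where
  "X_space L s T = {u. \<forall>t\<in>{0..T}. u t \<in> Hp L s \<and>
     (\<exists>D. has_Hp_derivative L s T u D t) \<and>
     ((\<lambda>\<tau>. Hp_norm L s (\<lambda>x. Hp_deriv L s T u \<tau> x - Hp_deriv L s T u t x)) \<longlongrightarrow> 0)
       (at t within {0..T})}"

text \<open>For \<open>u\<close> in \<open>X_space L s T\<close> the supremum is over a continuous function on \<open>[0,T]\<close>, hence a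
  maximum.\<close>

definition X_norm :: "real \<Rightarrow> real \<Rightarrow> real \<Rightarrow> (real \<Rightarrow> real \<Rightarrow> complex) \<Rightarrow> real" where
  "X_norm L s T u =
     sqrt (SUP t\<in>{0..T}. (Hp_norm L s (u t))\<^sup>2 + (Hp_norm L s (Hp_deriv L s T u t))\<^sup>2)"

definition has_second_derivative :: "(real \<Rightarrow> 'a::real_normed_vector) \<Rightarrow> (real \<Rightarrow> 'a) \<Rightarrow> bool" where
  "has_second_derivative f f2 \<longleftrightarrow> (\<exists>f1. \<forall>x.
     (f has_vector_derivative f1 x) (at x) \<and> (f1 has_vector_derivative f2 x) (at x))"

definition C2_real :: "(real \<Rightarrow> real) \<Rightarrow> bool" where
  "C2_real g \<longleftrightarrow> (\<exists>g2. has_second_derivative g g2 \<and> continuous_on UNIV g2)"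

definition convolution :: "(real \<Rightarrow> real) \<Rightarrow> (real \<Rightarrow> real) \<Rightarrow> real \<Rightarrow> real" where
  "convolution \<beta> v x = (LINT y|lborel. \<beta> (x - y) * v y)"

text \<open>For \<open>s \<ge> 1\<close> the function \<open>u + g(u)\<close> is in general only in \<open>H\<^sup>1\<close>, so the second space derivative is
  placed on the convolution, which is of class \<open>C\<^sup>2\<close> because the transform of \<open>\<beta>\<close> decays with an
  exponent \<open>r \<ge> 2\<close>.  The time derivative \<open>u\<^sub>t\<^sub>t\<close> is taken in \<open>L\<^sup>2\<close>, that is, in \<open>Hp L 0\<close>.\<close>

definition ivp_solution ::
  "real \<Rightarrow> (real \<Rightarrow> real) \<Rightarrow> (real \<Rightarrow> real) \<Rightarrow> (real \<Rightarrow> real) \<Rightarrow> (real \<Rightarrow> real) \<Rightarrow>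
   real \<Rightarrow> real \<Rightarrow> (real \<Rightarrow> real \<Rightarrow> real) \<Rightarrow> bool" where
  "ivp_solution L \<beta> g \<phi> \<psi> s T u \<longleftrightarrow>
     (let U = (\<lambda>t x. complex_of_real (u t x)) in
      U \<in> X_space L s T \<and>
      (AE x in lborel. u 0 x = \<phi> x) \<and>
      (AE x in lborel. Hp_deriv L s T U 0 x = complex_of_real (\<psi> x)) \<and>
      (\<forall>t\<in>{0..T}. \<exists>w. has_second_derivative (convolution \<beta> (\<lambda>x. u t x + g (u t x))) w \<and>
         has_Hp_derivative L 0 T (Hp_deriv L s T U) (\<lambda>x. complex_of_real (w x)) t))"

definition freq_range :: "nat \<Rightarrow> int set" where
  "freq_range N = {- (int N div 2) .. int N div 2 - 1}"

definition S_space :: "real \<Rightarrow> nat \<Rightarrow> (real \<Rightarrow> complex) set" where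
  "S_space L N = {v. \<exists>c. v = (\<lambda>x. \<Sum>k\<in>freq_range N. c k * mode L k x)}"

definition P_proj :: "real \<Rightarrow> nat \<Rightarrow> (real \<Rightarrow> complex) \<Rightarrow> real \<Rightarrow> complex" where
  "P_proj L N v x = (\<Sum>k\<in>freq_range N. fourier_coeff L v k * mode L k x)"

text \<open>\<open>is_H_inverse L \<beta> v w\<close> says that \<open>w\<close> is \<open>\<H>\<^sup>-\<^sup>1 v\<close>.  The transform of a \<open>2 * L\<close>-periodic function is
  carried by the frequencies \<open>k * pi / L\<close>, so dividing it by the transform of \<open>\<beta>\<close> divides the
  \<open>k\<close>-th coefficient by the value at \<open>k * pi / L\<close>.  That value is allowed to vanish; then \<open>\<H>\<^sup>-\<^sup>1 v\<close> only
  makes sense if the \<open>k\<close>-th coefficient of \<open>v\<close> vanishes too, and the quotient \<open>0/0\<close> is left undetermined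
  (so that \<open>\<H>\<^sup>-\<^sup>1 v = w\<close> remains equivalent to \<open>v = \<H> w\<close>) instead of having the value \<open>0\<close> of HOL
  division.\<close>

definition is_H_inverse ::
  "real \<Rightarrow> (real \<Rightarrow> real) \<Rightarrow> (real \<Rightarrow> complex) \<Rightarrow> (real \<Rightarrow> complex) \<Rightarrow> bool" where
  "is_H_inverse L \<beta> v w \<longleftrightarrow> w \<in> Hp L 0 \<and>
     (\<forall>k::int. let b = fourier_transform \<beta> (of_int k * pi / L) in
        if b = 0 then fourier_coeff L v k = 0
        else fourier_coeff L w k = fourier_coeff L v k / b)"

text \<open>The index set of \<open>S_space L N\<close> is not symmetric, so its elements, and solutions of the scheme, need
  not be real-valued, whereas \<open>g\<close> is a function of a real variable: it is applied to the real part.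
  For real-valued \<open>v\<close> this is just \<open>g(v)\<close>.\<close>

definition scheme_solution ::
  "real \<Rightarrow> (real \<Rightarrow> real) \<Rightarrow> (real \<Rightarrow> real) \<Rightarrow> (real \<Rightarrow> real) \<Rightarrow> (real \<Rightarrow> real) \<Rightarrow>
   real \<Rightarrow> nat \<Rightarrow> (real \<Rightarrow> real \<Rightarrow> complex) \<Rightarrow> bool" where
  "scheme_solution L \<beta> g \<phi> \<psi> T N v \<longleftrightarrow> (\<exists>vt vtt.
     (\<forall>t\<in>{0..T}. v t \<in> S_space L N \<and>
        (\<forall>x. ((\<lambda>\<tau>. v \<tau> x) has_vector_derivative vt t x) (at t within {0..T})) \<and>
        (\<forall>x. ((\<lambda>\<tau>. vt \<tau> x) has_vector_derivative vtt t x) (at t within {0..T})) \<and>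
        (\<exists>vxx gxx. has_second_derivative (v t) vxx \<and>
           has_second_derivative (P_proj L N (\<lambda>x. complex_of_real (g (Re (v t x))))) gxx \<and>
           is_H_inverse L \<beta> (vtt t) (\<lambda>x. vxx x + gxx x))) \<and>
     v 0 = P_proj L N (\<lambda>x. complex_of_real (\<phi> x)) \<and>
     vt 0 = P_proj L N (\<lambda>x. complex_of_real (\<psi> x)))"

end

theory Submission
  imports Defs
begin

text \<open>Both equations diagonalise in Fourier space: each coefficient \<open>c\<close> satisfies
  \<open>c'' = - \<lambda> (c + G)\<close>, where \<open>G\<close> is the coefficient of the nonlinear term and
  \<open>\<lambda> = \<xi>\<^sup>2 \<beta>\<^sup>\<and>(\<xi>)\<close> with \<open>\<xi> = k \<pi> / L\<close>.  Because \<open>r \<ge> 2\<close> these \<open>\<lambda>\<close> are bounded by \<open>C0\<close>, so the error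
  can be estimated in \<open>L\<^sup>2\<close>, where the nonlinearity is Lipschitz as soon as its arguments are bounded.
  Gronwall's inequality bounds the coefficients of \<open>P\<^sub>N u - u\<^sup>N\<close> and of its time derivative in \<open>L\<^sup>2\<close> by the
  tail of \<open>u\<close>, that is, by \<open>N powr (- s)\<close>; the inverse inequality on \<open>S\<^sub>N\<close> then costs a factor
  \<open>N powr (r / 2)\<close> for the norm of order \<open>r / 2\<close> but only \<open>N powr (1 / 2)\<close> for the maximum norm.  As \<open>s \<ge> 1\<close>, the latter
  keeps \<open>u\<^sup>N\<close> bounded by continuation in time once \<open>N\<close> is large (or if \<open>u = 0\<close>).  For the finitely many remaining
  \<open>N\<close> the scheme has at most one solution, so its error is absorbed in the constant.\<close>

section \<open>Fourier coefficients\<close>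

text \<open>The nonlinear term is compared without any projection error: inside the band
  \<open>freq_range N\<close> the coefficients of \<open>P\<^sub>N g(u\<^sup>N)\<close> are those of
  \<open>g(u\<^sup>N)\<close>, and they are set against those of \<open>g(u)\<close> itself. The
  initial errors in the band vanish, so the only inhomogeneity is the part of \<open>u\<close>
  outside the band, which enters through the L2 norm of \<open>u - u\<^sup>N\<close>. Hence no
  Sobolev estimate of \<open>g(u)\<close> occurs, only a Lipschitz bound is drawn from
  \<open>g\<close>, and the right-hand side is homogeneous in the norm of \<open>u\<close> even if
  \<open>g 0\<close> is nonzero. The Lipschitz constant presupposes bounds in the maximum norm,
  which L2 does not give. For \<open>u\<close> they come from absolutely summable coefficients; as
  \<open>u\<close> is only a measurable representative, its Fourier series first has to be
  identified with it almost everywhere, and this is what the uniqueness theorem is for. Through the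
  Lipschitz constant the final constant depends on the norm of \<open>u\<close> as well as on
  \<open>T\<close>; only independence of \<open>N\<close> is claimed.\<close>

abbreviation period_measure :: "real \<Rightarrow> real measure" where
  "period_measure L \<equiv> restrict_space lborel {-L<..<L}"

lemma set_integrable_period: "set_integrable lborel {-L<..<L} f \<longleftrightarrow> integrable (period_measure L) f"
  for f :: "real \<Rightarrow> 'a::{banach, second_countable_topology}"
  by (simp add: set_integrable_def integrable_restrict_space)

lemma set_integral_period: "(LINT x:{-L<..<L}|lborel. f x) = (\<integral>x. f x \<partial>period_measure L)"
  for f :: "real \<Rightarrow> 'a::{banach, second_countable_topology}"
  by (simp add: set_lebesgue_integral_def integral_restrict_space)

lemma finite_measure_period: "finite_measure (period_measure L)"
  by (rule finite_measureI) (cases "0 \<le> L"; simp add: emeasure_restrict_space space_restrict_space)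

lemma measure_period: "L > 0 \<Longrightarrow> measure (period_measure L) {-L<..<L} = 2 * L"
  by (subst measure_restrict_space) auto

lemma measurable_period: "f \<in> borel_measurable borel \<Longrightarrow> f \<in> borel_measurable (period_measure L)"
  by (rule measurable_restrict_space1) simp

lemma integrable_period_bounded:
  fixes f :: "real \<Rightarrow> 'a::{banach, second_countable_topology}"
  assumes "f \<in> borel_measurable borel" "AE x in period_measure L. norm (f x) \<le> B"
  shows "integrable (period_measure L) f"
proof -
  interpret finite_measure "period_measure L" by (rule finite_measure_period)
  show ?thesis
    by (rule integrable_const_bound[OF assms(2)]) (rule measurable_period[OF assms(1)])
qed

lemma mode_0 [simp]: "mode L 0 x = 1"
  by (simp add: mode_def)

lemma mode_add: "mode L (k + l) x = mode L k x * mode L l x"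
  by (simp add: mode_def exp_add[symmetric] algebra_simps add_divide_distrib)

lemma mode_cis: "mode L k x = cis (of_int k * pi * x / L)"
  by (simp add: mode_def cis_conv_exp mult.commute)

lemma norm_mode [simp]: "cmod (mode L k x) = 1"
  by (simp add: mode_cis)

lemma cnj_mode: "cnj (mode L k x) = mode L (- k) x"
  by (simp add: mode_cis cis_cnj)

lemma mode_shift: "mode L k (x + y) = mode L k x * mode L k y"
  by (simp add: mode_cis cis_mult algebra_simps add_divide_distrib)

lemma mode_periodic:
  assumes "L > 0"
  shows "mode L k (x + 2 * L) = mode L k x"
proof -
  have "of_int k * pi * (2 * L) / L = 2 * pi * of_int k" using assms by simp
  then show ?thesis using cis_multiple_2pi[of "of_int k"] unfolding mode_shift by (simp add: mode_cis)
qed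

lemma mode_has_vector_derivative:
  "(mode L k has_vector_derivative \<i> * of_real (of_int k * pi / L) * mode L k x) (at x within A)"
proof -
  define c where "c = \<i> * of_real (of_int k * pi / L)"
  have "((\<lambda>x. exp (c * of_real x)) has_vector_derivative exp (c * of_real x) * c) (at x within A)"
    by (rule has_vector_derivative_real_field) (auto intro!: derivative_eq_intros)
  then show ?thesis by (simp add: mode_def[abs_def] c_def mult_ac)
qed

lemma continuous_mode: "continuous_on A (mode L k)"
  unfolding mode_cis[abs_def] divide_inverse by (intro continuous_intros)

lemma mode_measurable [measurable]: "mode L k \<in> borel_measurable borel"
  by (intro borel_measurable_continuous_onI continuous_mode)

lemma fourier_coeff_eq: "fourier_coeff L v k = of_real (1 / (2 * L)) * (\<integral>x. v x * mode L (- k) x \<partial>period_measure L)"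
  by (simp add: fourier_coeff_def set_integral_period mode_def)

lemma integrable_mult_mode:
  assumes "integrable (period_measure L) f"
  shows "integrable (period_measure L) (\<lambda>x. f x * mode L k x)"
proof (rule Bochner_Integration.integrable_bound[OF assms])
  show "(\<lambda>x. f x * mode L k x) \<in> borel_measurable (period_measure L)"
    by (intro borel_measurable_times borel_measurable_integrable assms measurable_period mode_measurable)
qed (simp add: norm_mult)

lemma integral_mode:
  assumes "L > 0"
  shows "(\<integral>x. mode L k x \<partial>period_measure L) = (if k = 0 then of_real (2 * L) else 0)"
proof (cases "k = 0")
  case True
  then show ?thesis using measure_period[OF assms] assms by (simp add: scaleR_conv_of_real)
next
  case False
  define c where "c = \<i> * of_real (of_int k * pi / L)"
  have c: "c \<noteq> 0" using False assms by (simp add: c_def)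
  have "(mode L k has_vector_derivative c * mode L k x) (at x within A)" for x A
    unfolding c_def by (rule mode_has_vector_derivative)
  then have "((\<lambda>x. mode L k x / c) has_vector_derivative mode L k x) (at x within A)" for x A
    using has_vector_derivative_mult_left[of "mode L k" "c * mode L k x" "at x within A" "1 / c"] c by simp
  then have "(mode L k has_integral mode L k L / c - mode L k (-L) / c) {-L..L}"
    using assms by (intro fundamental_theorem_of_calculus) auto
  moreover have "mode L k L = mode L k (-L)"
    using mode_periodic[OF assms, of k "-L"] by simp
  ultimately have "integral {-L..L} (mode L k) = 0" by (simp add: integral_unique)
  moreover have "set_integrable lborel {-L<..<L} (mode L k)"
    unfolding set_integrable_period by (rule integrable_period_bounded[where B = 1]) auto
  ultimately show ?thesis
    using False by (simp add: set_integral_period[symmetric] set_borel_integral_eq_integral(2) integral_open_interval_real)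
qed

lemma fourier_coeff_mode:
  assumes "L > 0"
  shows "fourier_coeff L (mode L k) l = (if k = l then 1 else 0)"
  using assms by (simp add: fourier_coeff_eq mode_add[symmetric] integral_mode)

lemma fourier_coeff_add:
  assumes "integrable (period_measure L) f" "integrable (period_measure L) g"
  shows "fourier_coeff L (\<lambda>x. f x + g x) k = fourier_coeff L f k + fourier_coeff L g k"
  by (simp add: fourier_coeff_eq distrib_right distrib_left
    Bochner_Integration.integral_add[OF integrable_mult_mode[OF assms(1)] integrable_mult_mode[OF assms(2)]])

lemma fourier_coeff_cmult: "fourier_coeff L (\<lambda>x. c * f x) k = c * fourier_coeff L f k"
  by (simp add: fourier_coeff_eq mult.assoc mult.left_commute)

lemma fourier_coeff_diff:
  assumes "integrable (period_measure L) f" "integrable (period_measure L) g"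
  shows "fourier_coeff L (\<lambda>x. f x - g x) k = fourier_coeff L f k - fourier_coeff L g k"
  by (simp add: fourier_coeff_eq left_diff_distrib right_diff_distrib
    Bochner_Integration.integral_diff[OF integrable_mult_mode[OF assms(1)] integrable_mult_mode[OF assms(2)]])

lemma fourier_coeff_cong_AE:
  assumes "AE x in period_measure L. f x = g x"
    "f \<in> borel_measurable (period_measure L)" "g \<in> borel_measurable (period_measure L)"
  shows "fourier_coeff L f k = fourier_coeff L g k"
proof -
  have "(\<integral>x. f x * mode L (- k) x \<partial>period_measure L) = (\<integral>x. g x * mode L (- k) x \<partial>period_measure L)"
    using assms by (intro integral_cong_AE borel_measurable_times measurable_period[OF mode_measurable]) auto
  then show ?thesis by (simp add: fourier_coeff_eq)
qed

lemma integrable_trig_sum: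
  "integrable (period_measure L) (\<lambda>x. \<Sum>k\<in>K. c k * mode L k x)"
proof -
  have "integrable (period_measure L) (mode L k)" for k
    by (rule integrable_period_bounded[where B = 1]) auto
  then show ?thesis by (intro Bochner_Integration.integrable_sum integrable_mult_right)
qed

lemma fourier_coeff_trig_sum:
  assumes "L > 0" "finite K"
  shows "fourier_coeff L (\<lambda>x. \<Sum>k\<in>K. c k * mode L k x) l = (if l \<in> K then c l else 0)"
  using assms(2)
proof (induction K)
  case empty
  show ?case by (simp add: fourier_coeff_eq)
next
  case (insert k K)
  have "integrable (period_measure L) (\<lambda>x. c k * mode L k x)"
    using integrable_trig_sum[of L c "{k}"] by simp
  then show ?case using insert
    by (auto simp: fourier_coeff_add integrable_trig_sum fourier_coeff_cmult fourier_coeff_mode[OF assms(1)])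
qed

section \<open>Uniqueness of Fourier coefficients\<close>

text \<open>Generated by modes, sums and scalar multiples instead of given as a finite sum: closure
  under products and the vanishing of integrals become inductions over the generators.\<close>

inductive trig_poly :: "real \<Rightarrow> (real \<Rightarrow> complex) \<Rightarrow> bool" for L where
  trig_poly_mode: "trig_poly L (mode L k)"
| trig_poly_add: "trig_poly L p \<Longrightarrow> trig_poly L q \<Longrightarrow> trig_poly L (\<lambda>x. p x + q x)"
| trig_poly_cmult: "trig_poly L p \<Longrightarrow> trig_poly L (\<lambda>x. c * p x)"

lemma trig_poly_const: "trig_poly L (\<lambda>x. c)"
  using trig_poly_cmult[OF trig_poly_mode[of L 0], of c] by simp

lemma trig_poly_mult:
  assumes "trig_poly L p" "trig_poly L q"
  shows "trig_poly L (\<lambda>x. p x * q x)"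
  using assms(1)
proof induction
  case (trig_poly_mode k)
  show ?case using assms(2)
  proof induction
    case (trig_poly_mode l)
    then show ?case using trig_poly.trig_poly_mode[of L "k + l"] by (simp add: mode_add[abs_def])
  next
    case (trig_poly_add p q)
    then show ?case by (simp add: distrib_left trig_poly.trig_poly_add)
  next
    case (trig_poly_cmult p c)
    from trig_poly.trig_poly_cmult[OF this(2), of c] show ?case by (simp add: mult.left_commute)
  qed
next
  case (trig_poly_add p q)
  then show ?case by (simp add: distrib_right trig_poly.trig_poly_add)
next
  case (trig_poly_cmult p c)
  from trig_poly.trig_poly_cmult[OF this(2), of c] show ?case by (simp add: mult.assoc)
qed

text \<open>On the unit circle the conjugate of \<open>mode L 1 x\<close> is
  \<open>mode L (-1) x\<close>, so real and imaginary part are combinations of two modes; sums and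
  products are covered by the closure properties of \<open>trig_poly\<close>.\<close>

lemma trig_poly_real_polynomial:
  assumes "real_polynomial_function p"
  shows "trig_poly L (\<lambda>x. complex_of_real (p (mode L 1 x)))"
  using assms
proof induction
  case (linear p)
  have cs: "complex_of_real (Re z) = 1 / 2 * z + 1 / 2 * cnj z"
       "complex_of_real (Im z) = (- \<i> / 2) * z + (\<i> / 2) * cnj z" for z
    by (simp_all add: complex_eq_iff)
  \<comment> \<open>A real-linear functional on the plane is determined by its values at 1 and at
    the imaginary unit.\<close>
  have pz: "p z = Re z * p 1 + Im z * p \<i>" for z
  proof -
    have "z = Re z *\<^sub>R 1 + Im z *\<^sub>R \<i>" by (simp add: complex_eq_iff)
    then have "p z = p (Re z *\<^sub>R 1 + Im z *\<^sub>R \<i>)" by simp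
    also have "\<dots> = Re z * p 1 + Im z * p \<i>"
      using linear by (simp add: linear_simps)
    finally show ?thesis .
  qed
  have "complex_of_real (p (mode L 1 x)) = of_real (p 1) * (1 / 2 * mode L 1 x + 1 / 2 * mode L (-1) x)
      + of_real (p \<i>) * ((- \<i> / 2) * mode L 1 x + (\<i> / 2) * mode L (-1) x)" for x
    by (subst pz) (simp only: of_real_add of_real_mult cs cnj_mode ac_simps)
  then show ?case
    by (simp only:) (intro trig_poly.intros)
next
  case (const c)
  show ?case by (rule trig_poly_const)
next
  case (add p q)
  then show ?case by (simp add: trig_poly_add)
next
  case (mult p q)
  then show ?case by (simp add: trig_poly_mult)
qed

lemma integral_mult_trig_poly_zero:
  assumes "L > 0" "integrable (period_measure L) f" "\<And>k. fourier_coeff L f k = 0" "trig_poly L p"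
  shows "integrable (period_measure L) (\<lambda>x. f x * p x) \<and> (\<integral>x. f x * p x \<partial>period_measure L) = 0"
  using assms(4)
proof induction
  case (trig_poly_mode k)
  show ?case using integrable_mult_mode[OF assms(2)] assms(3)[of "- k"] assms(1) by (simp add: fourier_coeff_eq)
next
  case (trig_poly_add p q)
  then show ?case by (simp add: distrib_left)
next
  case (trig_poly_cmult p c)
  then show ?case by (simp add: mult.left_commute)
qed

text \<open>Stone-Weierstrass on the circle. Periodic continuous functions are handled as continuous
  functions \<open>h\<close> of the point \<open>mode L 1 x\<close>, so that the polynomial version
  in the plane applies; a uniform error \<open>e\<close> costs at most \<open>e\<close> times the L1
  norm of \<open>f\<close>.\<close>

lemma integral_mult_circle_zero:
  assumes "L > 0" "integrable (period_measure L) f" "\<And>k. fourier_coeff L f k = 0"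
    and h: "continuous_on UNIV h"
  shows "(\<integral>x. f x * complex_of_real (h (mode L 1 x)) \<partial>period_measure L) = 0"
proof -
  define I where "I = (\<integral>x. f x * complex_of_real (h (mode L 1 x)) \<partial>period_measure L)"
  define J where "J = (\<integral>x. cmod (f x) \<partial>period_measure L)"
  have J: "J \<ge> 0" by (simp add: J_def)
  obtain B where B: "\<And>z. z \<in> sphere 0 1 \<Longrightarrow> \<bar>h z\<bar> \<le> B"
  proof -
    have "compact (h ` sphere 0 1)"
      by (intro compact_continuous_image continuous_on_subset[OF h]) auto
    then obtain B where "\<forall>y\<in>h ` sphere 0 1. norm y \<le> B"
      using compact_imp_bounded bounded_iff by blast
    then show ?thesis using that[of B] by auto
  qed
  have meas: "(\<lambda>x. complex_of_real (h (mode L 1 x))) \<in> borel_measurable (period_measure L)"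
    by (intro measurable_period borel_measurable_continuous_onI continuous_intros
        continuous_on_compose2[OF h continuous_mode]) auto
  have inth: "integrable (period_measure L) (\<lambda>x. f x * complex_of_real (h (mode L 1 x)))"
  proof (rule Bochner_Integration.integrable_bound)
    show "integrable (period_measure L) (\<lambda>x. of_real B * f x)" using assms(2) by simp
    have "\<bar>h (mode L 1 x)\<bar> \<le> \<bar>B\<bar>" for x using B[of "mode L 1 x"] by simp
    then have "\<bar>h (mode L 1 x)\<bar> * cmod (f x) \<le> \<bar>B\<bar> * cmod (f x)" for x
      by (intro mult_right_mono) auto
    then show "AE x in period_measure L. norm (f x * complex_of_real (h (mode L 1 x))) \<le> norm (of_real B * f x)"
      by (intro AE_I2) (simp add: norm_mult mult.commute)
  qed (rule borel_measurable_times[OF borel_measurable_integrable[OF assms(2)] meas])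
  have "cmod I \<le> e * J" if e: "e > 0" for e
  proof -
    obtain p where p: "real_polynomial_function p" "\<And>z. z \<in> sphere 0 1 \<Longrightarrow> \<bar>h z - p z\<bar> < e"
      using Stone_Weierstrass_real_polynomial_function[OF compact_sphere continuous_on_subset[OF h subset_UNIV] e]
      by blast
    note tp = integral_mult_trig_poly_zero[OF assms(1-3) trig_poly_real_polynomial[OF p(1)]]
    have "I = (\<integral>x. f x * complex_of_real (h (mode L 1 x)) - f x * complex_of_real (p (mode L 1 x)) \<partial>period_measure L)"
      using tp inth by (simp add: I_def)
    also have "cmod \<dots> \<le> (\<integral>x. e * cmod (f x) \<partial>period_measure L)"
    proof (rule order_trans[OF integral_norm_bound integral_mono])
      show "integrable (period_measure L) (\<lambda>x. cmod (f x * complex_of_real (h (mode L 1 x)) - f x * complex_of_real (p (mode L 1 x))))"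
        using tp inth by simp
      show "integrable (period_measure L) (\<lambda>x. e * cmod (f x))" using assms(2) by simp
      fix x
      have "\<bar>h (mode L 1 x) - p (mode L 1 x)\<bar> \<le> e" using p(2)[of "mode L 1 x"] by simp
      then show "cmod (f x * complex_of_real (h (mode L 1 x)) - f x * complex_of_real (p (mode L 1 x))) \<le> e * cmod (f x)"
        using mult_right_mono[of "\<bar>h (mode L 1 x) - p (mode L 1 x)\<bar>" e "cmod (f x)"]
        by (simp add: right_diff_distrib[symmetric] of_real_diff[symmetric] norm_mult mult.commute[of "cmod (f x)"] del: of_real_diff)
    qed
    finally show ?thesis by (simp add: J_def)
  qed
  note * = this
  have "cmod I \<le> 0 + d" if "d > 0" for d
  proof -
    \<comment> \<open>\<open>J\<close> may be 0, hence the division by \<open>J + 1\<close>.\<close>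
    have "cmod I \<le> d / (J + 1) * J" using J that by (intro *) auto
    also have "\<dots> \<le> d" using J that by (simp add: field_simps)
    finally show ?thesis by simp
  qed
  then have "cmod I \<le> 0" by (rule field_le_epsilon)
  then show ?thesis by (simp add: I_def)
qed

text \<open>A set \<open>A \<subseteq> [-L,L]\<close> is recovered on \<open>(-L,L)\<close> from its image on the unit circle, because the missing
  point \<open>-1\<close> is only hit by \<open>L\<close> and \<open>-L\<close>.\<close>

lemma mode_1_mem_image_iff:
  assumes "L > 0" "x \<in> {-L<..<L}"
  shows "mode L 1 x \<in> mode L 1 ` (A \<inter> {-L..L}) \<longleftrightarrow> x \<in> A"
proof
  assume "mode L 1 x \<in> mode L 1 ` (A \<inter> {-L..L})"
  then obtain y where y: "y \<in> A" "y \<in> {-L..L}" "mode L 1 x = mode L 1 y" by auto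
  have Arg: "Arg (mode L 1 z) = pi * z / L" if "z \<in> {-L<..L}" for z
  proof -
    have "pi * (-L) < pi * z" "pi * z \<le> pi * L"
      using that mult_strict_left_mono[of "-L" z pi] mult_left_mono[of z L pi] by auto
    then show ?thesis using assms(1) unfolding mode_cis by (subst Arg_cis) (auto simp: field_simps)
  qed
  have "Arg (mode L 1 x) = pi * x / L" using assms by (intro Arg) auto
  moreover have "Arg (mode L 1 y) = pi * y / L" if "y > -L" using that y by (intro Arg) auto
  moreover have "Arg (mode L 1 y) = pi" if "y = -L"
  proof -
    have "mode L 1 y = - 1" using assms(1) that by (simp add: mode_cis complex_eq_iff)
    then show ?thesis by (simp add: Arg_eq_pi)
  qed
  ultimately have "x = y" using assms y by (cases "y = -L") (auto simp: field_simps)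
  then show "x \<in> A" using y by simp
qed (use assms in auto)

text \<open>The indicator of a closed set is a bounded pointwise limit of continuous functions on
  the circle, so dominated convergence with majorant \<open>cmod (f x)\<close> carries the case of
  continuous functions over to it.\<close>

lemma integral_closed_zero:
  assumes "L > 0" "integrable (period_measure L) f" "\<And>k. fourier_coeff L f k = 0" "closed A"
  shows "(\<integral>x. f x * indicator A x \<partial>period_measure L) = 0"
proof (cases "A \<inter> {-L..L} = {}")
  case True
  then have "(\<integral>x. f x * indicator A x \<partial>period_measure L) = (\<integral>x. 0 \<partial>period_measure L)"
    by (intro Bochner_Integration.integral_cong) (auto simp: indicator_def space_restrict_space)
  then show ?thesis by simp
next
  case False
  define K where "K = mode L 1 ` (A \<inter> {-L..L})"
  have "compact K"
    unfolding K_def using assms(4) by (intro compact_continuous_image continuous_mode) (auto intro: closed_Int_compact)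
  then have K: "closed K" "K \<noteq> {}" using False by (auto simp: K_def compact_imp_closed)
  \<comment> \<open>The base is 1 on \<open>K\<close> and below 1 off \<open>K\<close>, so the
    powers tend to the indicator of \<open>K\<close>. This requires \<open>K\<close> to be nonempty:
    \<open>infdist\<close> to the empty set is 0 by convention.\<close>
  define h where "h n z = (1 / (1 + infdist z K)) ^ n" for n :: nat and z
  have h: "continuous_on UNIV (h n)" for n
    unfolding h_def
    by (intro continuous_intros) (metis add_pos_nonneg infdist_nonneg less_irrefl zero_less_one)
  have hb: "0 \<le> h n z \<and> h n z \<le> 1" for n z
    using infdist_nonneg[of z K] by (auto simp: h_def power_le_one)
  have "(\<lambda>n. \<integral>x. f x * complex_of_real (h n (mode L 1 x)) \<partial>period_measure L)
      \<longlonglongrightarrow> (\<integral>x. f x * indicator A x \<partial>period_measure L)"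
  proof (rule integral_dominated_convergence[where w = "\<lambda>x. cmod (f x)"])
    show "(\<lambda>x. f x * indicator A x) \<in> borel_measurable (period_measure L)"
      using assms(4) by (intro borel_measurable_times borel_measurable_integrable[OF assms(2)]
        measurable_period[OF borel_measurable_indicator]) auto
    show "(\<lambda>x. f x * complex_of_real (h n (mode L 1 x))) \<in> borel_measurable (period_measure L)" for n
      by (intro borel_measurable_times borel_measurable_integrable assms(2) measurable_period
          borel_measurable_continuous_onI continuous_intros continuous_on_compose2[OF h continuous_mode]) auto
    show "integrable (period_measure L) (\<lambda>x. cmod (f x))" using assms(2) by simp
    show "AE x in period_measure L. cmod (f x * complex_of_real (h n (mode L 1 x))) \<le> cmod (f x)" for n
      using hb by (auto simp: norm_mult mult_left_le)
    show "AE x in period_measure L. (\<lambda>n. f x * complex_of_real (h n (mode L 1 x))) \<longlonglongrightarrow> f x * indicator A x"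
    proof (rule AE_I2)
      fix x assume "x \<in> space (period_measure L)"
      then have x: "x \<in> {-L<..<L}" by (simp add: space_restrict_space)
      have "(\<lambda>n. h n (mode L 1 x)) \<longlonglongrightarrow> indicator A x"
      proof (cases "x \<in> A")
        case True
        then have "infdist (mode L 1 x) K = 0"
          using mode_1_mem_image_iff[OF assms(1) x, of A] by (simp add: K_def)
        then show ?thesis using True by (simp add: h_def)
      next
        case False
        then have "mode L 1 x \<notin> K"
          using mode_1_mem_image_iff[OF assms(1) x, of A] by (simp add: K_def)
        then have "infdist (mode L 1 x) K > 0"
          using K infdist_nonneg[of "mode L 1 x" K] in_closed_iff_infdist_zero[OF K, of "mode L 1 x"] by linarith
        then show ?thesis using False by (auto simp: h_def intro!: LIMSEQ_realpow_zero)
      qed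
      then have "(\<lambda>n. complex_of_real (h n (mode L 1 x))) \<longlonglongrightarrow> of_real (indicator A x)"
        by (rule tendsto_of_real)
      then show "(\<lambda>n. f x * complex_of_real (h n (mode L 1 x))) \<longlonglongrightarrow> f x * indicator A x"
        by (intro tendsto_mult tendsto_const) (simp add: of_real_indicator)
    qed
  qed
  then show ?thesis
    using integral_mult_circle_zero[OF assms(1-3) h] by (simp add: LIMSEQ_const_iff)
qed

text \<open>The closed sets form an intersection-stable generator of the Borel sets, so by Dynkin's
  argument the integral of \<open>F\<close> over every Borel set vanishes, and such a function is 0
  almost everywhere. The whole argument stays in L1.\<close>

theorem fourier_coeff_zero_imp_AE_zero:
  assumes "L > 0" "integrable (period_measure L) f" "\<And>k. fourier_coeff L f k = 0"
  shows "AE x in period_measure L. f x = 0"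
proof -
  define F where "F x = indicator {-L<..<L} x *\<^sub>R f x" for x
  have F: "integrable lborel F"
    using assms(2) unfolding F_def by (simp add: integrable_restrict_space)
  have closed: "set_lebesgue_integral lborel A F = 0" if "closed A" for A
  proof -
    have "set_lebesgue_integral lborel A F = (\<integral>x. indicator {-L<..<L} x *\<^sub>R (f x * indicator A x) \<partial>lborel)"
      unfolding set_lebesgue_integral_def F_def
      by (intro Bochner_Integration.integral_cong) (auto simp: indicator_def)
    also have "\<dots> = (\<integral>x. f x * indicator A x \<partial>period_measure L)"
      by (simp add: integral_restrict_space)
    finally show ?thesis using integral_closed_zero[OF assms that] by simp
  qed
  have int: "set_integrable lborel A F" if "A \<in> sets borel" for A
    using that F unfolding set_integrable_def by (intro integrable_mult_indicator) auto
  have "set_lebesgue_integral lborel A F = 0" if "A \<in> sets lborel" for A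
  proof -
    have gen: "A \<in> sigma_sets UNIV (Collect closed)"
      using that borel_eq_closed by (metis Pow_UNIV sets_lborel sets_measure_of top_greatest)
    have "Int_stable (Collect (closed :: real set \<Rightarrow> bool))"
      by (auto simp: Int_stable_def)
    moreover have "Collect closed \<subseteq> Pow (UNIV :: real set)" by simp
    ultimately show ?thesis using gen
    proof (induction rule: sigma_sets_induct_disjoint)
      case (basic A)
      then show ?case using closed by simp
    next
      case empty
      show ?case by (simp add: set_lebesgue_integral_def)
    next
      case (compl A)
      have A: "A \<in> sets borel" using compl(1) borel_eq_closed by (metis Pow_UNIV sets_measure_of top_greatest)
      have "set_lebesgue_integral lborel UNIV F = set_lebesgue_integral lborel (A \<union> (UNIV - A)) F" by simp
      also have "\<dots> = set_lebesgue_integral lborel A F + set_lebesgue_integral lborel (UNIV - A) F"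
        using A by (intro set_integral_Un int) auto
      \<comment> \<open>The whole line is itself closed, so the total integral is 0.\<close>
      finally show ?case using compl closed[of UNIV] by simp
    next
      case (union A)
      have A: "A i \<in> sets borel" for i using union(2) borel_eq_closed
        by (metis Pow_UNIV sets_measure_of top_greatest range_subsetD)
      have "set_lebesgue_integral lborel (\<Union>i. A i) F = (\<Sum>i. set_lebesgue_integral lborel (A i) F)"
        using A union(1) by (intro lebesgue_integral_countable_add int)
          (auto simp: disjoint_family_on_def)
      then show ?case using union(3) by simp
    qed
  qed
  from sigma_finite_measure.density_zero[OF sigma_finite_lborel F this] have "AE x in lborel. F x = 0" by simp
  then show ?thesis by (auto simp: AE_restrict_space_iff F_def indicator_def elim: eventually_mono split: if_splits)
qed

section \<open>Bessel and Parseval inequalities\<close>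

lemma integrable_cmod_power2:
  assumes "f \<in> borel_measurable borel" "integrable (period_measure L) (\<lambda>x. (cmod (f x))\<^sup>2)"
  shows "integrable (period_measure L) f"
proof (rule Bochner_Integration.integrable_bound)
  interpret finite_measure "period_measure L" by (rule finite_measure_period)
  show "integrable (period_measure L) (\<lambda>x. 1 + (cmod (f x))\<^sup>2)" using assms by simp
  show "AE x in period_measure L. norm (f x) \<le> norm (1 + (cmod (f x))\<^sup>2)"
  proof (rule AE_I2)
    fix x show "norm (f x) \<le> norm (1 + (cmod (f x))\<^sup>2)"
      using sum_squares_bound[of 1 "cmod (f x)"] norm_ge_zero[of "f x"] by (simp del: norm_ge_zero)
  qed
qed (rule measurable_period[OF assms(1)])

text \<open>Expands the nonnegative squared L2 distance from \<open>f\<close> to its partial sum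
  \<open>p\<close>: the mixed term and the norm of \<open>p\<close> both equal \<open>2 * L\<close>
  times the sum of the squared coefficients.\<close>

lemma bessel_inequality:
  assumes "L > 0" "finite K" "f \<in> borel_measurable borel" "integrable (period_measure L) (\<lambda>x. (cmod (f x))\<^sup>2)"
  shows "2 * L * (\<Sum>k\<in>K. (cmod (fourier_coeff L f k))\<^sup>2) \<le> (\<integral>x. (cmod (f x))\<^sup>2 \<partial>period_measure L)"
proof -
  note f = integrable_cmod_power2[OF assms(3,4)]
  define c where "c = fourier_coeff L f"
  define p where "p x = (\<Sum>k\<in>K. c k * mode L k x)" for x
  have ip: "integrable (period_measure L) p" unfolding p_def[abs_def] by (rule integrable_trig_sum)
  have cnjp: "cnj (p x) = (\<Sum>k\<in>K. cnj (c k) * mode L (- k) x)" for x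
    by (simp add: p_def cnj_mode)
  have e1: "integrable (period_measure L) (\<lambda>x. f x * cnj (p x))"
    "(\<integral>x. f x * cnj (p x) \<partial>period_measure L) = of_real (2 * L * (\<Sum>k\<in>K. (cmod (c k))\<^sup>2))"
  proof -
    have *: "f x * cnj (p x) = (\<Sum>k\<in>K. cnj (c k) * (f x * mode L (- k) x))" for x
      by (simp add: cnjp sum_distrib_left mult_ac)
    show "integrable (period_measure L) (\<lambda>x. f x * cnj (p x))"
      unfolding * by (intro Bochner_Integration.integrable_sum integrable_mult_right integrable_mult_mode f)
    have "(\<integral>x. f x * cnj (p x) \<partial>period_measure L) = (\<Sum>k\<in>K. cnj (c k) * (\<integral>x. f x * mode L (- k) x \<partial>period_measure L))"
      unfolding * by (subst Bochner_Integration.integral_sum) (auto intro!: integrable_mult_right integrable_mult_mode f)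
    also have "\<dots> = (\<Sum>k\<in>K. cnj (c k) * (of_real (2 * L) * c k))"
      using assms(1) by (intro sum.cong) (auto simp: c_def fourier_coeff_eq)
    also have "\<dots> = of_real (2 * L * (\<Sum>k\<in>K. (cmod (c k))\<^sup>2))"
      by (simp add: sum_distrib_left complex_norm_square mult_ac del: of_real_power)
    finally show "(\<integral>x. f x * cnj (p x) \<partial>period_measure L) = of_real (2 * L * (\<Sum>k\<in>K. (cmod (c k))\<^sup>2))" .
  qed
  have e2: "integrable (period_measure L) (\<lambda>x. p x * cnj (p x))"
    "(\<integral>x. p x * cnj (p x) \<partial>period_measure L) = of_real (2 * L * (\<Sum>k\<in>K. (cmod (c k))\<^sup>2))"
  proof -
    have *: "p x * cnj (p x) = (\<Sum>k\<in>K. cnj (c k) * (p x * mode L (- k) x))" for x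
      by (simp add: cnjp sum_distrib_left mult_ac)
    show "integrable (period_measure L) (\<lambda>x. p x * cnj (p x))"
      unfolding * by (intro Bochner_Integration.integrable_sum integrable_mult_right integrable_mult_mode ip)
    have "(\<integral>x. p x * cnj (p x) \<partial>period_measure L) = (\<Sum>k\<in>K. cnj (c k) * (\<integral>x. p x * mode L (- k) x \<partial>period_measure L))"
      unfolding * by (subst Bochner_Integration.integral_sum) (auto intro!: integrable_mult_right integrable_mult_mode ip)
    also have "\<dots> = (\<Sum>k\<in>K. cnj (c k) * (of_real (2 * L) * fourier_coeff L p k))"
      using assms(1) by (intro sum.cong) (auto simp: fourier_coeff_eq)
    also have "\<dots> = (\<Sum>k\<in>K. cnj (c k) * (of_real (2 * L) * c k))"
      unfolding p_def[abs_def] by (simp add: fourier_coeff_trig_sum[OF assms(1,2)])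
    also have "\<dots> = of_real (2 * L * (\<Sum>k\<in>K. (cmod (c k))\<^sup>2))"
      by (simp add: sum_distrib_left complex_norm_square mult_ac del: of_real_power)
    finally show "(\<integral>x. p x * cnj (p x) \<partial>period_measure L) = of_real (2 * L * (\<Sum>k\<in>K. (cmod (c k))\<^sup>2))" .
  qed
  have sq: "(cmod (f x - p x))\<^sup>2 = (cmod (f x))\<^sup>2 - 2 * Re (f x * cnj (p x)) + Re (p x * cnj (p x))" for x
    unfolding cmod_power2 by (simp add: power2_eq_square algebra_simps)
  have "0 \<le> (\<integral>x. (cmod (f x - p x))\<^sup>2 \<partial>period_measure L)" by simp
  also have "\<dots> = (\<integral>x. (cmod (f x))\<^sup>2 \<partial>period_measure L) - 2 * (\<integral>x. Re (f x * cnj (p x)) \<partial>period_measure L)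
      + (\<integral>x. Re (p x * cnj (p x)) \<partial>period_measure L)"
    unfolding sq using assms(4) integrable_Re[OF e1(1)] integrable_Re[OF e2(1)]
    by (simp add: Bochner_Integration.integral_add Bochner_Integration.integral_diff del: times_complex.simps)
  also have "\<dots> = (\<integral>x. (cmod (f x))\<^sup>2 \<partial>period_measure L) - 2 * L * (\<Sum>k\<in>K. (cmod (c k))\<^sup>2)"
    unfolding integral_Re[OF e1(1)] integral_Re[OF e2(1)] e1(2) e2(2) by simp
  finally show ?thesis by (simp add: c_def)
qed

text \<open>Links infinite sums, which are limits over finite sets of integers, to symmetric partial
  sums, which form a sequence as dominated convergence requires.\<close>

lemma int_exhaustion: "filterlim (\<lambda>n. {- int n..int n}) (finite_subsets_at_top UNIV) sequentially"
  unfolding filterlim_finite_subsets_at_top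
proof safe
  fix X :: "int set" assume "finite X"
  then obtain B where B: "\<And>x. x \<in> X \<Longrightarrow> \<bar>x\<bar> \<le> B"
    using finite_imageI[of X abs] by (meson Max_ge finite_imageI imageI)
  show "\<forall>\<^sub>F n in sequentially. finite {- int n..int n} \<and> X \<subseteq> {- int n..int n} \<and> {- int n..int n} \<subseteq> UNIV"
    using eventually_ge_at_top[of "nat B"]
  proof eventually_elim
    case (elim n)
    have "x \<in> {- int n..int n}" if "x \<in> X" for x using B[OF that] elim by auto
    then show ?case by auto
  qed
qed

text \<open>Both consequences of absolutely convergent Fourier coefficients come from the same fact: the symmetric
  partial sums converge uniformly to a function with the same coefficients, hence to \<open>f\<close> almost everywhere.\<close>

lemma abs_summable_fourier:
  assumes "L > 0" "integrable (period_measure L) f" "(\<lambda>k. cmod (fourier_coeff L f k)) summable_on UNIV"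
  defines "M \<equiv> (\<Sum>\<^sub>\<infinity>k. cmod (fourier_coeff L f k))"
  shows "AE x in period_measure L. (\<lambda>n. \<Sum>k\<in>{- int n..int n}. fourier_coeff L f k * mode L k x) \<longlonglongrightarrow> f x"
    and "\<And>n x. cmod (\<Sum>k\<in>{- int n..int n}. fourier_coeff L f k * mode L k x) \<le> M"
    and "AE x in period_measure L. cmod (f x) \<le> M"
proof -
  interpret finite_measure "period_measure L" by (rule finite_measure_period)
  define S where "S n x = (\<Sum>k\<in>{- int n..int n}. fourier_coeff L f k * mode L k x)" for n x
  define h where "h x = (\<Sum>\<^sub>\<infinity>k. fourier_coeff L f k * mode L k x)" for x
  show bd: "cmod (\<Sum>k\<in>{- int n..int n}. fourier_coeff L f k * mode L k x) \<le> M" for n x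
  proof -
    have "cmod (\<Sum>k\<in>{- int n..int n}. fourier_coeff L f k * mode L k x)
        \<le> (\<Sum>k\<in>{- int n..int n}. cmod (fourier_coeff L f k))"
      by (rule order_trans[OF norm_sum]) (simp add: norm_mult)
    also have "\<dots> \<le> M" unfolding M_def by (rule finite_sum_le_infsum[OF assms(3)]) auto
    finally show ?thesis .
  qed
  have lim: "(\<lambda>n. S n x) \<longlonglongrightarrow> h x" for x
  proof -
    have "(\<lambda>k. fourier_coeff L f k * mode L k x) summable_on UNIV"
      by (rule abs_summable_summable) (simp add: norm_mult assms(3))
    then have "((\<lambda>k. fourier_coeff L f k * mode L k x) has_sum h x) UNIV"
      unfolding h_def by (rule has_sum_infsum)
    then have "(sum (\<lambda>k. fourier_coeff L f k * mode L k x) \<longlongrightarrow> h x) (finite_subsets_at_top UNIV)"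
      by (simp add: has_sum_def)
    from filterlim_compose[OF this int_exhaustion] show ?thesis by (simp add: S_def)
  qed
  have Smeas: "S n \<in> borel_measurable borel" for n unfolding S_def[abs_def] by measurable
  have hmeas: "h \<in> borel_measurable borel"
    by (rule borel_measurable_LIMSEQ_metric[OF Smeas lim])
  have hM: "cmod (h x) \<le> M" for x
    using bd[where x = x] by (intro Lim_bounded[OF tendsto_norm[OF lim[of x]]]) (auto simp: S_def)
  have hint: "integrable (period_measure L) h"
    by (rule integrable_period_bounded[OF hmeas AE_I2[OF hM]])
  have "fourier_coeff L h l = fourier_coeff L f l" for l
  proof -
    have "(\<lambda>n. \<integral>x. S n x * mode L (- l) x \<partial>period_measure L) \<longlonglongrightarrow> (\<integral>x. h x * mode L (- l) x \<partial>period_measure L)"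
    proof (rule integral_dominated_convergence[where w = "\<lambda>x. M"])
      show "AE x in period_measure L. (\<lambda>n. S n x * mode L (- l) x) \<longlonglongrightarrow> h x * mode L (- l) x"
        by (intro AE_I2 tendsto_mult lim tendsto_const)
      show "AE x in period_measure L. cmod (S n x * mode L (- l) x) \<le> M" for n
        using bd by (intro AE_I2) (simp add: norm_mult S_def)
    qed (auto intro!: measurable_period borel_measurable_times Smeas hmeas)
    then have "(\<lambda>n. fourier_coeff L (S n) l) \<longlonglongrightarrow> fourier_coeff L h l"
      unfolding fourier_coeff_eq by (intro tendsto_mult tendsto_const)
    moreover have "(\<lambda>n. fourier_coeff L (S n) l) \<longlonglongrightarrow> fourier_coeff L f l"
    proof (rule tendsto_eventually)
      show "\<forall>\<^sub>F n in sequentially. fourier_coeff L (S n) l = fourier_coeff L f l"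
        using eventually_ge_at_top[of "nat \<bar>l\<bar>"]
        by eventually_elim (auto simp: S_def[abs_def] fourier_coeff_trig_sum[OF assms(1)])
    qed
    ultimately show ?thesis by (rule LIMSEQ_unique)
  qed
  then have "AE x in period_measure L. f x - h x = 0"
    using assms(2) hint by (intro fourier_coeff_zero_imp_AE_zero[OF assms(1)]) (auto simp: fourier_coeff_diff)
  then have eq: "AE x in period_measure L. f x = h x" by simp
  from eq show "AE x in period_measure L. (\<lambda>n. \<Sum>k\<in>{- int n..int n}. fourier_coeff L f k * mode L k x) \<longlonglongrightarrow> f x"
    by eventually_elim (use lim in \<open>simp add: S_def\<close>)
  from eq show "AE x in period_measure L. cmod (f x) \<le> M"
    by eventually_elim (simp add: hM)
qed

text \<open>Absolute summability bounds \<open>f\<close> and all its partial sums by one constant,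
  so the integral of \<open>f\<close> times the conjugate partial sum passes to the limit. The bound
  \<open>B\<close> is asked of finite sums, the form in which the tail estimates supply it.\<close>

lemma parseval_le:
  assumes "L > 0" "f \<in> borel_measurable borel" "integrable (period_measure L) f"
    "(\<lambda>k. cmod (fourier_coeff L f k)) summable_on UNIV"
    and B: "\<And>K. finite K \<Longrightarrow> (\<Sum>k\<in>K. (cmod (fourier_coeff L f k))\<^sup>2) \<le> B"
  shows "(\<integral>x. (cmod (f x))\<^sup>2 \<partial>period_measure L) \<le> 2 * L * B"
proof -
  interpret finite_measure "period_measure L" by (rule finite_measure_period)
  note F = abs_summable_fourier[OF assms(1,3,4)]
  define M where "M = (\<Sum>\<^sub>\<infinity>k. cmod (fourier_coeff L f k))"
  define S where "S n x = (\<Sum>k\<in>{- int n..int n}. fourier_coeff L f k * mode L k x)" for n x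
  have Smeas: "S n \<in> borel_measurable borel" for n unfolding S_def[abs_def] by measurable
  have cnjS: "(\<lambda>x. cnj (S n x)) \<in> borel_measurable borel" for n
    by (rule borel_measurable_continuous_on[OF _ Smeas]) (intro continuous_intros)
  have cnjf: "(\<lambda>x. cnj (f x)) \<in> borel_measurable borel"
    by (rule borel_measurable_continuous_on[OF _ assms(2)]) (intro continuous_intros)
  have lim: "(\<lambda>n. \<integral>x. f x * cnj (S n x) \<partial>period_measure L) \<longlonglongrightarrow> (\<integral>x. f x * cnj (f x) \<partial>period_measure L)"
  proof (rule integral_dominated_convergence[where w = "\<lambda>x. M * M"])
    show "AE x in period_measure L. (\<lambda>n. f x * cnj (S n x)) \<longlonglongrightarrow> f x * cnj (f x)"
      using F(1)
    proof eventually_elim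
      case (elim x)
      from tendsto_mult[OF tendsto_const tendsto_cnj[OF elim]] show ?case unfolding S_def .
    qed
    show "AE x in period_measure L. cmod (f x * cnj (S n x)) \<le> M * M" for n
      using F(3)
    proof eventually_elim
      case (elim x)
      have "cmod (S n x) \<le> M" "cmod (f x) \<le> M" using F(2) elim by (auto simp: S_def M_def)
      moreover from this have "0 \<le> M" using norm_ge_zero order_trans by blast
      ultimately show ?case unfolding norm_mult complex_mod_cnj by (intro mult_mono) auto
    qed
    show "(\<lambda>x. f x * cnj (S n x)) \<in> borel_measurable (period_measure L)" for n
      by (rule measurable_period[OF borel_measurable_times[OF assms(2) cnjS]])
    show "(\<lambda>x. f x * cnj (f x)) \<in> borel_measurable (period_measure L)"
      by (rule measurable_period[OF borel_measurable_times[OF assms(2) cnjf]])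
  qed simp
  have part: "(\<integral>x. f x * cnj (S n x) \<partial>period_measure L) = of_real (2 * L * (\<Sum>k\<in>{- int n..int n}. (cmod (fourier_coeff L f k))\<^sup>2))" for n
  proof -
    have *: "f x * cnj (S n x) = (\<Sum>k\<in>{- int n..int n}. cnj (fourier_coeff L f k) * (f x * mode L (- k) x))" for x
      by (simp add: S_def cnj_mode sum_distrib_left mult_ac)
    have "(\<integral>x. f x * cnj (S n x) \<partial>period_measure L) = (\<Sum>k\<in>{- int n..int n}. cnj (fourier_coeff L f k) * (\<integral>x. f x * mode L (- k) x \<partial>period_measure L))"
      unfolding * by (subst Bochner_Integration.integral_sum) (auto intro!: integrable_mult_right integrable_mult_mode assms(3))
    also have "\<dots> = (\<Sum>k\<in>{- int n..int n}. cnj (fourier_coeff L f k) * (of_real (2 * L) * fourier_coeff L f k))"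
      using assms(1) by (intro sum.cong) (auto simp: fourier_coeff_eq)
    also have "\<dots> = of_real (2 * L * (\<Sum>k\<in>{- int n..int n}. (cmod (fourier_coeff L f k))\<^sup>2))"
      by (simp add: sum_distrib_left complex_norm_square mult_ac del: of_real_power)
    finally show ?thesis .
  qed
  have fcnj: "f x * cnj (f x) = of_real ((cmod (f x))\<^sup>2)" for x
    by (simp only: complex_norm_square)
  have "(\<lambda>n. Re (\<integral>x. f x * cnj (S n x) \<partial>period_measure L)) \<longlonglongrightarrow> Re (\<integral>x. f x * cnj (f x) \<partial>period_measure L)"
    by (rule tendsto_Re[OF lim])
  then have "(\<lambda>n. 2 * L * (\<Sum>k\<in>{- int n..int n}. (cmod (fourier_coeff L f k))\<^sup>2)) \<longlonglongrightarrow> (\<integral>x. (cmod (f x))\<^sup>2 \<partial>period_measure L)"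
    unfolding part fcnj integral_complex_of_real Re_complex_of_real .
  then show ?thesis
    using B assms(1) by (intro Lim_bounded) (auto intro!: mult_left_mono)
qed

section \<open>Convolution and second derivatives\<close>

lemma periodic_shift_reduce:
  fixes h :: "real \<Rightarrow> 'a"
  assumes "P > 0" "\<And>x. h (x + P) = h x"
  obtains z' where "0 \<le> z'" "z' < P" "\<And>x. h (x + z) = h (x + z')"
proof -
  interpret periodic_fun_simple h P by unfold_locales (rule assms(2))
  define n where "n = \<lfloor>z / P\<rfloor>"
  have n: "of_int n * P \<le> z" "z < of_int n * P + P"
    using floor_divide_lower[OF assms(1), of z] floor_divide_upper[OF assms(1), of z]
    by (simp_all add: n_def algebra_simps)
  show thesis
  proof (rule that[of "z - of_int n * P"])
    fix x show "h (x + z) = h (x + (z - of_int n * P))"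
      using plus_of_int[of "x + (z - of_int n * P)" n] by (simp add: algebra_simps)
  qed (use n in auto)
qed

text \<open>With \<open>z\<close> reduced to \<open>0 \<le> z' < 2 * L\<close>, the period is cut at
  \<open>-L + z'\<close>. The right piece moves left by \<open>z'\<close>, the left piece moves
  right by \<open>2 * L - z'\<close>, and together they fill the period again up to one
  point.\<close>

lemma periodic_integral_shift:
  fixes h :: "real \<Rightarrow> 'a::euclidean_space"
  assumes L: "L > 0" and per: "\<And>x. h (x + 2 * L) = h x"
    and [measurable]: "h \<in> borel_measurable borel" and int: "integrable (period_measure L) h"
  shows "integrable (period_measure L) (\<lambda>x. h (x + z))"
    and "(\<integral>x. h (x + z) \<partial>period_measure L) = (\<integral>x. h x \<partial>period_measure L)"
proof -
  obtain z' where z': "0 \<le> z'" "z' < 2 * L" "\<And>x. h (x + z) = h (x + z')"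
    using periodic_shift_reduce[of "2 * L" h z] L per by auto
  define A where "A y = indicator {-L + z'<..<L} y *\<^sub>R h y" for y
  define B where "B y = indicator {-L<..<-L + z'} y *\<^sub>R h y" for y
  define H where "H y = indicator {-L<..<L} y *\<^sub>R h y" for y
  have meas[measurable]: "A \<in> borel_measurable borel" "B \<in> borel_measurable borel" "H \<in> borel_measurable borel"
    unfolding A_def[abs_def] B_def[abs_def] H_def[abs_def] by measurable
  have H: "integrable lborel H"
    using int by (simp add: H_def[abs_def] integrable_restrict_space)
  have A: "integrable lborel A" and B: "integrable lborel B"
    using z'(1,2) L by (intro Bochner_Integration.integrable_bound[OF H] AE_I2; simp add: A_def B_def H_def indicator_def)+
  have AB: "AE y in lborel. H y = A y + B y"
    using AE_lborel_singleton[of "-L + z'"]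
  proof eventually_elim
    case (elim y)
    then show ?case using z'(1,2) by (auto simp: A_def B_def H_def indicator_def)
  qed
  define F where "F x = A (x + z') + B (x + z' - 2 * L)" for x
  have iA: "integrable lborel (\<lambda>x. A (x + z'))" "(\<integral>x. A (x + z') \<partial>lborel) = integral\<^sup>L lborel A"
    using lborel_integrable_real_affine[OF A, of 1 z'] lborel_integral_real_affine[of 1 A z']
    by (simp_all add: add.commute)
  have iB: "integrable lborel (\<lambda>x. B (x + z' - 2 * L))" "(\<integral>x. B (x + z' - 2 * L) \<partial>lborel) = integral\<^sup>L lborel B"
    using lborel_integrable_real_affine[OF B, of 1 "z' - 2 * L"] lborel_integral_real_affine[of 1 B "z' - 2 * L"]
    by (simp_all add: algebra_simps)
  have F: "AE x in lborel. indicator {-L<..<L} x *\<^sub>R h (x + z') = F x"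
    using AE_lborel_singleton[of "L - z'"]
  proof eventually_elim
    case (elim x)
    have "h (x + z' - 2 * L) = h (x + z')" using per[of "x + z' - 2 * L"] by simp
    then show ?case using elim z'(1,2) L by (auto simp: F_def A_def B_def indicator_def)
  qed
  have Fint: "integrable lborel F" unfolding F_def[abs_def] using iA iB by simp
  have "integrable lborel (\<lambda>x. indicator {-L<..<L} x *\<^sub>R h (x + z'))"
    by (rule integrable_cong_AE_imp[OF Fint]) (use F in \<open>auto elim: eventually_mono\<close>)
  then show "integrable (period_measure L) (\<lambda>x. h (x + z))"
    by (simp add: integrable_restrict_space z'(3))
  have "(\<integral>x. indicator {-L<..<L} x *\<^sub>R h (x + z') \<partial>lborel) = integral\<^sup>L lborel F"
    by (rule integral_cong_AE[OF _ _ F]) (auto simp: F_def[abs_def])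
  also have "\<dots> = integral\<^sup>L lborel A + integral\<^sup>L lborel B"
    unfolding F_def[abs_def] using iA iB by simp
  also have "\<dots> = integral\<^sup>L lborel H"
    using A B integral_cong_AE[OF _ _ AB] by simp
  finally show "(\<integral>x. h (x + z) \<partial>period_measure L) = (\<integral>x. h x \<partial>period_measure L)"
    by (simp add: integral_restrict_space z'(3) H_def[abs_def])
qed

lemma convolution_eq: "convolution \<beta> f x = (\<integral>z. \<beta> z * f (x - z) \<partial>lborel)"
  using lborel_integral_real_affine[of "-1" "\<lambda>y. \<beta> (x - y) * f y" x] by (simp add: convolution_def)

lemma convolution_periodic:
  assumes "\<And>x. f (x + P) = f x"
  shows "convolution \<beta> f (x + P) = convolution \<beta> f x"
proof -
  have "f (x + P - z) = f (x - z)" for z using assms[of "x - z"] by (simp add: algebra_simps)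
  then show ?thesis by (simp add: convolution_eq)
qed

text \<open>Fubini on the line times one period. By translation invariance the inner integral of the
  norm is \<open>\<bar>\<beta> z\<bar>\<close> times a constant, which gives integrability; the
  phase \<open>mode L (- k) z\<close> left over by the shift turns the integral over
  \<open>z\<close> into the transform of \<open>\<beta>\<close> at
  \<open>k * pi / L\<close>.\<close>

lemma fourier_coeff_convolution:
  assumes L: "L > 0" and \<beta>: "integrable lborel \<beta>" and per: "\<And>x. f (x + 2 * L) = f x"
    and [measurable]: "f \<in> borel_measurable borel" and int: "integrable (period_measure L) f"
  shows "fourier_coeff L (\<lambda>x. complex_of_real (convolution \<beta> f x)) k
    = fourier_transform \<beta> (of_int k * pi / L) * fourier_coeff L (\<lambda>x. complex_of_real (f x)) k"
proof -
  have [measurable]: "\<beta> \<in> borel_measurable borel" using \<beta> by simp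
  define \<Phi> where "\<Phi> z x = of_real (\<beta> z) * (indicator {-L<..<L} x *\<^sub>R (of_real (f (x - z)) * mode L (- k) x))" for z x
  define J where "J = (\<integral>x. \<bar>f x\<bar> \<partial>period_measure L)"
  have int_f: "integrable (period_measure L) (\<lambda>x. of_real (f (x - z)) :: complex)" for z
    using periodic_integral_shift(1)[OF L per _ int, of "- z"] by simp
  have inner_int: "integrable lborel (\<Phi> z)" for z
    using integrable_mult_mode[OF int_f[of z], of "- k"]
    unfolding \<Phi>_def[abs_def] by (intro integrable_mult_right) (simp add: integrable_restrict_space)
  have norm_inner: "(\<integral>x. norm (\<Phi> z x) \<partial>lborel) = \<bar>\<beta> z\<bar> * J" for z
  proof -
    have "(\<integral>x. norm (\<Phi> z x) \<partial>lborel) = (\<integral>x. \<bar>\<beta> z\<bar> * (indicator {-L<..<L} x *\<^sub>R \<bar>f (x - z)\<bar>) \<partial>lborel)"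
      by (intro Bochner_Integration.integral_cong) (auto simp: \<Phi>_def norm_mult)
    also have "\<dots> = \<bar>\<beta> z\<bar> * (\<integral>x. \<bar>f (x + - z)\<bar> \<partial>period_measure L)"
      by (simp add: integral_restrict_space)
    also have "(\<integral>x. \<bar>f (x + - z)\<bar> \<partial>period_measure L) = J"
      unfolding J_def using int by (intro periodic_integral_shift(2)[OF L]) (auto simp: per)
    finally show ?thesis .
  qed
  have \<Phi>: "integrable (lborel \<Otimes>\<^sub>M lborel) (case_prod \<Phi>)"
  proof (rule lborel_pair.Fubini_integrable)
    show "case_prod \<Phi> \<in> borel_measurable (lborel \<Otimes>\<^sub>M lborel)"
      unfolding \<Phi>_def by measurable
    show "integrable lborel (\<lambda>x. \<integral>y. norm (case_prod \<Phi> (x, y)) \<partial>lborel)"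
      using \<beta> by (simp add: norm_inner)
    show "AE x in lborel. integrable lborel (\<lambda>y. case_prod \<Phi> (x, y))"
      by (simp add: inner_int)
  qed
  have inner: "(\<integral>x. \<Phi> z x \<partial>lborel) = of_real (\<beta> z) * mode L (- k) z * (\<integral>x. of_real (f x) * mode L (- k) x \<partial>period_measure L)" for z
  proof -
    have "(\<integral>x. \<Phi> z x \<partial>lborel) = of_real (\<beta> z) * (\<integral>x. of_real (f (x - z)) * mode L (- k) x \<partial>period_measure L)"
      unfolding \<Phi>_def by (subst integral_mult_right_zero) (simp add: integral_restrict_space)
    also have "(\<integral>x. of_real (f (x - z)) * mode L (- k) x \<partial>period_measure L)
        = (\<integral>x. mode L (- k) z * (of_real (f (x + - z)) * mode L (- k) (x + - z)) \<partial>period_measure L)"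
    proof (intro Bochner_Integration.integral_cong refl)
      fix x
      have "mode L (- k) x = mode L (- k) z * mode L (- k) (x + - z)"
        using mode_shift[of L "- k" z "x + - z"] by simp
      then show "of_real (f (x - z)) * mode L (- k) x = mode L (- k) z * (of_real (f (x + - z)) * mode L (- k) (x + - z))"
        by simp
    qed
    also have "\<dots> = mode L (- k) z * (\<integral>x. of_real (f x) * mode L (- k) x \<partial>period_measure L)"
      using int by (subst integral_mult_right_zero, subst periodic_integral_shift(2)[OF L])
        (auto simp: per mode_periodic[OF L] intro!: integrable_mult_mode)
    finally show ?thesis by simp
  qed
  have "(\<integral>x. of_real (convolution \<beta> f x) * mode L (- k) x \<partial>period_measure L) = (\<integral>x. (\<integral>z. \<Phi> z x \<partial>lborel) \<partial>lborel)"
  proof -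
    \<comment> \<open>True at every \<open>x\<close>, also where the integral over \<open>z\<close>
      diverges: both sides are then the default value 0.\<close>
    have "indicator {-L<..<L} x *\<^sub>R (of_real (convolution \<beta> f x) * mode L (- k) x) = (\<integral>z. \<Phi> z x \<partial>lborel)" for x
    proof -
      have "(\<integral>z. \<Phi> z x \<partial>lborel) = (\<integral>z. of_real (\<beta> z * f (x - z)) * (indicator {-L<..<L} x *\<^sub>R mode L (- k) x) \<partial>lborel)"
        unfolding \<Phi>_def by (intro Bochner_Integration.integral_cong) auto
      also have "\<dots> = of_real (convolution \<beta> f x) * (indicator {-L<..<L} x *\<^sub>R mode L (- k) x)"
        by (subst integral_mult_left_zero) (simp only: integral_complex_of_real convolution_eq)
      finally show ?thesis by simp
    qed
    then show ?thesis by (simp add: integral_restrict_space)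
  qed
  also have "\<dots> = (\<integral>z. (\<integral>x. \<Phi> z x \<partial>lborel) \<partial>lborel)"
    by (rule lborel_pair.Fubini_integral[OF \<Phi>])
  also have "\<dots> = fourier_transform \<beta> (of_int k * pi / L) * (\<integral>x. of_real (f x) * mode L (- k) x \<partial>period_measure L)"
    unfolding inner fourier_transform_def by (simp add: mode_def)
  finally show ?thesis by (simp add: fourier_coeff_eq)
qed

text \<open>Two integrations by parts over a period, each without boundary terms by periodicity. As
  \<open>w\<close> is only integrable, they are carried out for the gauge integral, whose
  fundamental theorem admits arbitrary derivatives and which agrees with the Lebesgue integral
  here.\<close>

lemma fourier_coeff_second_derivative:
  assumes L: "L > 0" and p: "has_second_derivative p w" and per: "\<And>x. p (x + 2 * L) = p x"
    and int: "integrable (period_measure L) w"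
  shows "fourier_coeff L w k = - of_real ((of_int k * pi / L)\<^sup>2) * fourier_coeff L p k"
proof -
  obtain q where pq: "\<And>x. (p has_vector_derivative q x) (at x)" and qw: "\<And>x. (q has_vector_derivative w x) (at x)"
    using p unfolding has_second_derivative_def by blast
  define c where "c = \<i> * of_real (of_int (- k) * pi / L)"
  define m where "m = mode L (- k)"
  have m: "(m has_vector_derivative c * m x) (at x within A)" for x A
    unfolding m_def c_def by (rule mode_has_vector_derivative)
  have mper: "m L = m (-L)" using mode_periodic[OF L, of "- k" "-L"] by (simp add: m_def)
  have pper: "p L = p (-L)" using per[of "-L"] by simp
  \<comment> \<open>Periodicity is given for \<open>p\<close> only; that of \<open>q\<close> follows
    because \<open>p\<close> equals its own shift and derivatives are unique.\<close>
  have qper: "q L = q (-L)"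
  proof -
    have "((\<lambda>x. x + 2 * L) has_vector_derivative 1) (at (-L))"
      by (auto intro!: derivative_eq_intros)
    from vector_diff_chain_at[OF this, of p "q L"] pq[of L]
    have "((\<lambda>x. p (x + 2 * L)) has_vector_derivative q L) (at (-L))" by (simp add: o_def)
    then have "(p has_vector_derivative q L) (at (-L))" by (simp add: per)
    then show ?thesis using pq vector_derivative_unique_at by blast
  qed
  have pc: "continuous_on A p" and qc: "continuous_on A q" and mc: "continuous_on A m" for A
    using pq qw m by (auto intro!: continuous_at_imp_continuous_on has_vector_derivative_continuous)
  have *: "((\<lambda>x. h' x * m x + c * (h x * m x)) has_integral 0) {-L..L}"
    if "\<And>x. (h has_vector_derivative h' x) (at x)" "h L = h (-L)" for h h'
  proof -
    have "((\<lambda>x. h x * m x) has_vector_derivative h x * (c * m x) + h' x * m x) (at x within {-L..L})" for x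
      using that(1) m by (intro has_vector_derivative_mult has_vector_derivative_at_within[OF that(1)])
    then have "((\<lambda>x. h x * (c * m x) + h' x * m x) has_integral h L * m L - h (-L) * m (-L)) {-L..L}"
      using L by (intro fundamental_theorem_of_calculus) auto
    then show ?thesis using that(2) mper by (simp add: algebra_simps)
  qed
  have by_parts: "integral {-L..L} (\<lambda>x. h' x * m x) = - c * integral {-L..L} (\<lambda>x. h x * m x)"
    if "\<And>x. (h has_vector_derivative h' x) (at x)" "h L = h (-L)" "continuous_on {-L..L} h" for h h'
  proof -
    have i: "(\<lambda>x. c * (h x * m x)) integrable_on {-L..L}"
      by (intro integrable_continuous_real continuous_intros that mc)
    have "((\<lambda>x. (h' x * m x + c * (h x * m x)) - c * (h x * m x)) has_integral 0 - integral {-L..L} (\<lambda>x. c * (h x * m x))) {-L..L}"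
      by (intro has_integral_diff *[OF that(1,2)] integrable_integral i)
    then show ?thesis by (simp add: integral_unique)
  qed
  have I: "(\<integral>x. h x * m x \<partial>period_measure L) = integral {-L..L} (\<lambda>x. h x * m x)"
    if "integrable (period_measure L) h" for h
    using set_borel_integral_eq_integral(2)[of "{-L<..<L}" "\<lambda>x. h x * m x"] integrable_mult_mode[OF that, of "- k"]
    by (simp add: set_integrable_period set_integral_period m_def integral_open_interval_real)
  have ip: "integrable (period_measure L) p"
    unfolding set_integrable_period[symmetric]
    by (rule set_integrable_subset[OF borel_integrable_atLeastAtMost'[OF pc[of "{-L..L}"]]]) auto
  have "(\<integral>x. w x * m x \<partial>period_measure L) = c * c * (\<integral>x. p x * m x \<partial>period_measure L)"
    unfolding I[OF int] I[OF ip] by_parts[OF qw qper qc] by_parts[OF pq pper pc] by simp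
  moreover have "c * c = - of_real ((of_int k * pi / L)\<^sup>2)"
    by (simp add: c_def power2_eq_square complex_eq_iff)
  ultimately show ?thesis by (simp add: fourier_coeff_eq m_def)
qed

section \<open>Periodic Sobolev spaces\<close>

abbreviation Hp_weight :: "real \<Rightarrow> int \<Rightarrow> real" where
  "Hp_weight s k \<equiv> (1 + (of_int k)\<^sup>2) powr s"

lemma Hp_weight_mono: "s \<le> s' \<Longrightarrow> Hp_weight s k \<le> Hp_weight s' k"
  by (rule powr_mono) auto

lemma Hp_weight_ge_1: "0 \<le> s \<Longrightarrow> 1 \<le> Hp_weight s k"
  by (rule ge_one_powr_ge_zero) auto

lemma HpD:
  assumes "v \<in> Hp L s"
  shows "v (x + 2 * L) = v x" "v \<in> borel_measurable borel"
    "integrable (period_measure L) (\<lambda>x. (cmod (v x))\<^sup>2)"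
    "(\<lambda>k. Hp_weight s k * (cmod (fourier_coeff L v k))\<^sup>2) summable_on UNIV"
    "integrable (period_measure L) v"
proof -
  show 1: "v \<in> borel_measurable borel" "integrable (period_measure L) (\<lambda>x. (cmod (v x))\<^sup>2)"
    using assms by (auto simp: Hp_def set_integrable_period)
  show "integrable (period_measure L) v" by (rule integrable_cmod_power2[OF 1])
qed (use assms in \<open>auto simp: Hp_def\<close>)

lemma cmod_add_power2_le: "(cmod (a + b))\<^sup>2 \<le> 2 * (cmod a)\<^sup>2 + 2 * (cmod b)\<^sup>2"
proof -
  have "(cmod (a + b))\<^sup>2 \<le> (cmod a + cmod b)\<^sup>2" by (intro power_mono norm_triangle_ineq) auto
  also have "\<dots> \<le> 2 * (cmod a)\<^sup>2 + 2 * (cmod b)\<^sup>2"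
    using sum_squares_bound[of "cmod a" "cmod b"] by (simp add: power2_sum)
  finally show ?thesis .
qed

lemma Hp_cmult:
  assumes "v \<in> Hp L s"
  shows "(\<lambda>x. c * v x) \<in> Hp L s"
  using HpD[OF assms]
  by (auto simp: Hp_def set_integrable_period norm_mult power_mult_distrib fourier_coeff_cmult
      mult.left_commute intro: summable_on_cmult_right)

lemma Hp_add:
  assumes "u \<in> Hp L s" "v \<in> Hp L s"
  shows "(\<lambda>x. u x + v x) \<in> Hp L s"
proof -
  note u = HpD[OF assms(1)] and v = HpD[OF assms(2)]
  have "integrable (period_measure L) (\<lambda>x. (cmod (u x + v x))\<^sup>2)"
  proof (rule Bochner_Integration.integrable_bound)
    show "integrable (period_measure L) (\<lambda>x. 2 * (cmod (u x))\<^sup>2 + 2 * (cmod (v x))\<^sup>2)"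
      using u(3) v(3) by simp
    have "(\<lambda>x. (cmod (u x + v x))\<^sup>2) \<in> borel_measurable borel" using u(2) v(2) by measurable
    then show "(\<lambda>x. (cmod (u x + v x))\<^sup>2) \<in> borel_measurable (period_measure L)" by (rule measurable_period)
    show "AE x in period_measure L. norm ((cmod (u x + v x))\<^sup>2) \<le> norm (2 * (cmod (u x))\<^sup>2 + 2 * (cmod (v x))\<^sup>2)"
      using cmod_add_power2_le by (intro AE_I2) auto
  qed
  moreover have "(\<lambda>k. Hp_weight s k * (cmod (fourier_coeff L (\<lambda>x. u x + v x) k))\<^sup>2) summable_on UNIV"
  proof (rule summable_on_comparison_test)
    show "(\<lambda>k. 2 * (Hp_weight s k * (cmod (fourier_coeff L u k))\<^sup>2) + 2 * (Hp_weight s k * (cmod (fourier_coeff L v k))\<^sup>2)) summable_on UNIV"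
      by (intro summable_on_add summable_on_cmult_right u(4) v(4))
    fix k
    show "Hp_weight s k * (cmod (fourier_coeff L (\<lambda>x. u x + v x) k))\<^sup>2
        \<le> 2 * (Hp_weight s k * (cmod (fourier_coeff L u k))\<^sup>2) + 2 * (Hp_weight s k * (cmod (fourier_coeff L v k))\<^sup>2)"
      using mult_left_mono[OF cmod_add_power2_le, of "Hp_weight s k" "fourier_coeff L u k" "fourier_coeff L v k"]
      by (simp add: fourier_coeff_add u(5) v(5) algebra_simps)
  qed simp
  ultimately show ?thesis
    using u v by (auto simp: Hp_def set_integrable_period)
qed

lemma Hp_diff:
  assumes "u \<in> Hp L s" "v \<in> Hp L s"
  shows "(\<lambda>x. u x - v x) \<in> Hp L s"
  using Hp_add[OF assms(1) Hp_cmult[OF assms(2), of "-1"]] by simp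

lemma Hp_scaleR:
  assumes "v \<in> Hp L s"
  shows "(\<lambda>x. (c::real) *\<^sub>R v x) \<in> Hp L s"
  using Hp_cmult[OF assms, of "of_real c"] by (simp add: scaleR_conv_of_real)

lemma Hp_norm_power2: "(Hp_norm L s v)\<^sup>2 = (\<Sum>\<^sub>\<infinity>k. Hp_weight s k * (cmod (fourier_coeff L v k))\<^sup>2)"
  unfolding Hp_norm_def by (rule real_sqrt_pow2) (intro infsum_nonneg; simp)

lemma Hp_norm_nonneg [simp]: "0 \<le> Hp_norm L s v"
  unfolding Hp_norm_def by (intro real_sqrt_ge_zero infsum_nonneg) simp

lemma Hp_norm_cmult_power2: "(Hp_norm L s (\<lambda>x. c * v x))\<^sup>2 = (cmod c)\<^sup>2 * (Hp_norm L s v)\<^sup>2"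
  unfolding Hp_norm_power2 infsum_cmult_right'[symmetric]
  by (intro infsum_cong) (simp add: fourier_coeff_cmult norm_mult power_mult_distrib)

text \<open>Termwise substitute for the triangle inequality. The factor 2 is harmless, since the
  estimate only serves to show that norms stay bounded or tend to 0.\<close>

lemma Hp_norm_add_power2_le:
  assumes "u \<in> Hp L s" "v \<in> Hp L s"
  shows "(Hp_norm L s (\<lambda>x. u x + v x))\<^sup>2 \<le> 2 * (Hp_norm L s u)\<^sup>2 + 2 * (Hp_norm L s v)\<^sup>2"
proof -
  note u = HpD[OF assms(1)] and v = HpD[OF assms(2)] and uv = HpD[OF Hp_add[OF assms]]
  have "(Hp_norm L s (\<lambda>x. u x + v x))\<^sup>2 \<le>
    (\<Sum>\<^sub>\<infinity>k. 2 * (Hp_weight s k * (cmod (fourier_coeff L u k))\<^sup>2) + 2 * (Hp_weight s k * (cmod (fourier_coeff L v k))\<^sup>2))"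
    unfolding Hp_norm_power2
  proof (rule infsum_mono[OF uv(4)])
    show "(\<lambda>k. 2 * (Hp_weight s k * (cmod (fourier_coeff L u k))\<^sup>2) + 2 * (Hp_weight s k * (cmod (fourier_coeff L v k))\<^sup>2)) summable_on UNIV"
      by (intro summable_on_add summable_on_cmult_right u(4) v(4))
    fix k
    show "Hp_weight s k * (cmod (fourier_coeff L (\<lambda>x. u x + v x) k))\<^sup>2
        \<le> 2 * (Hp_weight s k * (cmod (fourier_coeff L u k))\<^sup>2) + 2 * (Hp_weight s k * (cmod (fourier_coeff L v k))\<^sup>2)"
      using mult_left_mono[OF cmod_add_power2_le, of "Hp_weight s k" "fourier_coeff L u k" "fourier_coeff L v k"]
      by (simp add: fourier_coeff_add u(5) v(5) algebra_simps)
  qed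
  also have "\<dots> = 2 * (Hp_norm L s u)\<^sup>2 + 2 * (Hp_norm L s v)\<^sup>2"
    unfolding Hp_norm_power2
    by (subst infsum_add) (auto intro!: summable_on_cmult_right u(4) v(4) simp: infsum_cmult_right')
  finally show ?thesis .
qed

lemma Hp_norm_diff_power2_le:
  assumes "u \<in> Hp L s" "v \<in> Hp L s"
  shows "(Hp_norm L s (\<lambda>x. u x - v x))\<^sup>2 \<le> 2 * (Hp_norm L s u)\<^sup>2 + 2 * (Hp_norm L s v)\<^sup>2"
  using Hp_norm_add_power2_le[OF assms(1) Hp_cmult[OF assms(2), of "-1"]] Hp_norm_cmult_power2[of L s "-1" v]
  by simp

lemma Hp_coeff_le:
  assumes "v \<in> Hp L s"
  shows "Hp_weight s k * (cmod (fourier_coeff L v k))\<^sup>2 \<le> (Hp_norm L s v)\<^sup>2"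
  using finite_sum_le_infsum[OF HpD(4)[OF assms], of "{k}"] by (simp add: Hp_norm_power2)

lemma cmod_fourier_coeff_le_Hp_norm:
  assumes "v \<in> Hp L s" "0 \<le> s"
  shows "cmod (fourier_coeff L v k) \<le> Hp_norm L s v"
proof (rule power2_le_imp_le)
  have "1 * (cmod (fourier_coeff L v k))\<^sup>2 \<le> Hp_weight s k * (cmod (fourier_coeff L v k))\<^sup>2"
    by (intro mult_right_mono Hp_weight_ge_1 assms(2)) auto
  then show "(cmod (fourier_coeff L v k))\<^sup>2 \<le> (Hp_norm L s v)\<^sup>2"
    using Hp_coeff_le[OF assms(1), of k] by linarith
qed simp

lemma Hp_mono:
  assumes "v \<in> Hp L s" "s' \<le> s"
  shows "v \<in> Hp L s'" "Hp_norm L s' v \<le> Hp_norm L s v"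
proof -
  have le: "Hp_weight s' k * (cmod (fourier_coeff L v k))\<^sup>2 \<le> Hp_weight s k * (cmod (fourier_coeff L v k))\<^sup>2" for k
    by (intro mult_right_mono Hp_weight_mono assms(2)) auto
  have "(\<lambda>k. Hp_weight s' k * (cmod (fourier_coeff L v k))\<^sup>2) summable_on UNIV"
    by (rule summable_on_comparison_test[OF HpD(4)[OF assms(1)] le]) simp
  then show v: "v \<in> Hp L s'" using assms(1) by (auto simp: Hp_def)
  show "Hp_norm L s' v \<le> Hp_norm L s v"
    unfolding Hp_norm_def by (intro real_sqrt_le_mono infsum_mono HpD(4)[OF v] HpD(4)[OF assms(1)] le)
qed

section \<open>Derivatives of curves in Sobolev spaces and the norm of
  \<open>X_space\<close>\<close>

lemma fourier_coeff_quotient_diff: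
  assumes "integrable (period_measure L) f" "integrable (period_measure L) g" "integrable (period_measure L) D"
  shows "fourier_coeff L (\<lambda>x. (c::real) *\<^sub>R (f x - g x) - D x) k
    = c *\<^sub>R (fourier_coeff L f k - fourier_coeff L g k) - fourier_coeff L D k"
proof -
  have "fourier_coeff L (\<lambda>x. c *\<^sub>R (f x - g x) - D x) k = fourier_coeff L (\<lambda>x. c *\<^sub>R (f x - g x)) k - fourier_coeff L D k"
    using assms by (intro fourier_coeff_diff) auto
  also have "fourier_coeff L (\<lambda>x. c *\<^sub>R (f x - g x)) k = c *\<^sub>R (fourier_coeff L f k - fourier_coeff L g k)"
    unfolding scaleR_conv_of_real fourier_coeff_cmult by (simp only: fourier_coeff_diff[OF assms(1,2)])
  finally show ?thesis .
qed

text \<open>Puts differentiability into the shape used in \<open>has_Hp_derivative\<close>: a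
  difference quotient minus the derivative tends to 0.\<close>

lemma has_vector_derivative_quotient:
  "(f has_vector_derivative D) (at t within S) \<longleftrightarrow>
    ((\<lambda>\<tau>. (1 / (\<tau> - t)) *\<^sub>R (f \<tau> - f t) - D) \<longlongrightarrow> 0) (at t within S)"
proof -
  have eq: "norm ((1 / norm (\<tau> - t)) *\<^sub>R (f \<tau> - (f t + (\<tau> - t) *\<^sub>R D)))
      = norm ((1 / (\<tau> - t)) *\<^sub>R (f \<tau> - f t) - D)" if "\<tau> \<noteq> t" for \<tau>
  proof -
    have "(1 / (\<tau> - t)) *\<^sub>R (f \<tau> - f t) - D = (1 / (\<tau> - t)) *\<^sub>R (f \<tau> - (f t + (\<tau> - t) *\<^sub>R D))"
      using that by (simp add: scaleR_right_diff_distrib scaleR_add_right)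
    then show ?thesis by simp
  qed
  have "(f has_vector_derivative D) (at t within S) \<longleftrightarrow>
      ((\<lambda>\<tau>. norm ((1 / norm (\<tau> - t)) *\<^sub>R (f \<tau> - (f t + (\<tau> - t) *\<^sub>R D)))) \<longlongrightarrow> 0) (at t within S)"
    unfolding has_vector_derivative_def has_derivative_within tendsto_norm_zero_iff
    by (simp add: bounded_linear_scaleR_left)
  also have "\<dots> \<longleftrightarrow> ((\<lambda>\<tau>. norm ((1 / (\<tau> - t)) *\<^sub>R (f \<tau> - f t) - D)) \<longlongrightarrow> 0) (at t within S)"
    by (rule tendsto_cong, unfold eventually_at_filter, rule always_eventually) (use eq in blast)
  finally show ?thesis by (simp only: tendsto_norm_zero_iff)
qed

text \<open>For \<open>s \<ge> 0\<close> every coefficient is bounded by the norm, so difference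
  quotients that converge in norm converge coefficientwise.\<close>

lemma fourier_coeff_has_vector_derivative:
  assumes "0 \<le> s" "\<And>\<tau>. \<tau> \<in> {0..T} \<Longrightarrow> u \<tau> \<in> Hp L s" "t \<in> {0..T}" and D: "has_Hp_derivative L s T u D t"
  shows "((\<lambda>\<tau>. fourier_coeff L (u \<tau>) k) has_vector_derivative fourier_coeff L D k) (at t within {0..T})"
proof -
  have DHp: "D \<in> Hp L s" and lim: "((\<lambda>\<tau>. Hp_norm L s (\<lambda>x. (1 / (\<tau> - t)) *\<^sub>R (u \<tau> x - u t x) - D x)) \<longlongrightarrow> 0) (at t within {0..T})"
    using D by (auto simp: has_Hp_derivative_def)
  let ?q = "\<lambda>\<tau>. (1 / (\<tau> - t)) *\<^sub>R (fourier_coeff L (u \<tau>) k - fourier_coeff L (u t) k)"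
  have *: "((\<lambda>\<tau>. ?q \<tau> - fourier_coeff L D k) \<longlongrightarrow> 0) (at t within {0..T})"
  proof (rule Lim_null_comparison[OF _ lim])
    show "\<forall>\<^sub>F \<tau> in at t within {0..T}. norm (?q \<tau> - fourier_coeff L D k)
        \<le> Hp_norm L s (\<lambda>x. (1 / (\<tau> - t)) *\<^sub>R (u \<tau> x - u t x) - D x)"
      unfolding eventually_at_filter
    proof (intro always_eventually allI impI)
      fix \<tau> assume "\<tau> \<noteq> t" "\<tau> \<in> {0..T}"
      note m = assms(2)[OF this(2)] assms(2)[OF assms(3)]
      have q: "(\<lambda>x. (1 / (\<tau> - t)) *\<^sub>R (u \<tau> x - u t x)) \<in> Hp L s"
        by (intro Hp_scaleR Hp_diff m)
      have "fourier_coeff L (\<lambda>x. (1 / (\<tau> - t)) *\<^sub>R (u \<tau> x - u t x) - D x) k = ?q \<tau> - fourier_coeff L D k"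
        by (rule fourier_coeff_quotient_diff[OF HpD(5)[OF m(1)] HpD(5)[OF m(2)] HpD(5)[OF DHp]])
      then show "norm (?q \<tau> - fourier_coeff L D k) \<le> Hp_norm L s (\<lambda>x. (1 / (\<tau> - t)) *\<^sub>R (u \<tau> x - u t x) - D x)"
        using cmod_fourier_coeff_le_Hp_norm[OF Hp_diff[OF q DHp] assms(1), of k] by simp
    qed
  qed
  then show ?thesis by (simp only: has_vector_derivative_quotient)
qed

text \<open>A finite subcover. The lemma is meant for squared Sobolev norms along a curve, which are
  known to be bounded near each time.\<close>

lemma locally_bounded_imp_bdd_above:
  fixes f :: "real \<Rightarrow> real"
  assumes "compact S" "\<And>t. t \<in> S \<Longrightarrow> \<exists>B. \<forall>\<^sub>F \<tau> in at t within S. f \<tau> \<le> B"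
  shows "bdd_above (f ` S)"
proof -
  have "\<exists>U B. open U \<and> t \<in> U \<and> (\<forall>\<tau>\<in>U \<inter> S. f \<tau> \<le> B)" if t: "t \<in> S" for t
  proof -
    obtain B where "\<forall>\<^sub>F \<tau> in at t within S. f \<tau> \<le> B" using assms(2)[OF t] by blast
    then obtain U where "open U" "t \<in> U" "\<forall>\<tau>\<in>U. \<tau> \<noteq> t \<longrightarrow> \<tau> \<in> S \<longrightarrow> f \<tau> \<le> B"
      unfolding eventually_at_topological by blast
    \<comment> \<open>\<open>at t within S\<close> leaves out \<open>t\<close> itself, hence
      \<open>max B (f t)\<close>.\<close>
    then show ?thesis by (intro exI[of _ U] exI[of _ "max B (f t)"]) (auto simp: le_max_iff_disj)
  qed
  then obtain U B where U: "\<And>t. t \<in> S \<Longrightarrow> open (U t) \<and> t \<in> U t \<and> (\<forall>\<tau>\<in>U t \<inter> S. f \<tau> \<le> B t)"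
    by metis
  obtain C where C: "C \<subseteq> S" "finite C" "S \<subseteq> (\<Union>c\<in>C. U c)"
    using compactE_image[OF assms(1), of S U] U by blast
  show ?thesis
  proof (rule bdd_aboveI2)
    fix \<tau> assume \<tau>: "\<tau> \<in> S"
    then obtain c where c: "c \<in> C" "\<tau> \<in> U c" using C by blast
    then have "f \<tau> \<le> B c" using U[of c] C(1) \<tau> by blast
    also have "B c \<le> Max (B ` C)" using C c by auto
    finally show "f \<tau> \<le> Max (B ` C)" .
  qed
qed

lemma Hp_deriv_works:
  "has_Hp_derivative L s T u D t \<Longrightarrow> has_Hp_derivative L s T u (Hp_deriv L s T u t) t"
  unfolding Hp_deriv_def by (rule someI[where P = "\<lambda>D. has_Hp_derivative L s T u D t"])

lemma X_spaceD:
  assumes "u \<in> X_space L s T" "t \<in> {0..T}"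
  shows "u t \<in> Hp L s" "has_Hp_derivative L s T u (Hp_deriv L s T u t) t" "Hp_deriv L s T u t \<in> Hp L s"
proof -
  show "u t \<in> Hp L s" using assms by (auto simp: X_space_def)
  show *: "has_Hp_derivative L s T u (Hp_deriv L s T u t) t"
  proof -
    have "\<exists>D. has_Hp_derivative L s T u D t" using assms unfolding X_space_def by blast
    then show ?thesis using Hp_deriv_works by blast
  qed
  then show "Hp_deriv L s T u t \<in> Hp L s" by (simp add: has_Hp_derivative_def)
qed

text \<open>A real \<open>SUP\<close> is an upper bound only for a bounded family, so boundedness on
  \<open>[0,T]\<close> has to be proved: near each \<open>t\<close> the curve is controlled by its
  difference quotient, and the derivative by its continuity in norm.\<close>

lemma X_norm_bound:
  assumes "u \<in> X_space L s T" "t \<in> {0..T}"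
  shows "(Hp_norm L s (u t))\<^sup>2 + (Hp_norm L s (Hp_deriv L s T u t))\<^sup>2 \<le> (X_norm L s T u)\<^sup>2"
proof -
  let ?f = "\<lambda>t. (Hp_norm L s (u t))\<^sup>2" and ?g = "\<lambda>t. (Hp_norm L s (Hp_deriv L s T u t))\<^sup>2"
  note X = X_spaceD[OF assms(1)]
  have "bdd_above (?f ` {0..T})"
  proof (rule locally_bounded_imp_bdd_above)
    fix t assume t: "t \<in> {0..T}"
    let ?D = "Hp_deriv L s T u t"
    have "((\<lambda>\<tau>. Hp_norm L s (\<lambda>x. (1 / (\<tau> - t)) *\<^sub>R (u \<tau> x - u t x) - ?D x)) \<longlongrightarrow> 0) (at t within {0..T})"
      using X(2)[OF t] by (simp add: has_Hp_derivative_def)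
    then have "\<forall>\<^sub>F \<tau> in at t within {0..T}. Hp_norm L s (\<lambda>x. (1 / (\<tau> - t)) *\<^sub>R (u \<tau> x - u t x) - ?D x) < 1"
      by (rule order_tendstoD) simp
    moreover have "\<forall>\<^sub>F \<tau> in at t within {0..T}. \<tau> \<in> {0..T} \<and> \<tau> \<noteq> t"
      by (auto simp: eventually_at_filter)
    ultimately have "\<forall>\<^sub>F \<tau> in at t within {0..T}. ?f \<tau> \<le> 2 * ?f t + 2 * (T\<^sup>2 * (2 * 1 + 2 * ?g t))"
    proof eventually_elim
      case (elim \<tau>)
      define q where "q x = (1 / (\<tau> - t)) *\<^sub>R (u \<tau> x - u t x) - ?D x" for x
      have \<tau>: "\<tau> \<in> {0..T}" using elim by simp
      have q: "q \<in> Hp L s" unfolding q_def[abs_def] by (intro Hp_diff Hp_scaleR X t \<tau>)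
      \<comment> \<open>\<open>q\<close> is the error of the difference quotient; near
        \<open>t\<close> its norm is below 1, which is where the summand \<open>2 * 1\<close> of the
        bound comes from.\<close>
      have eq: "u \<tau> = (\<lambda>x. u t x + of_real (\<tau> - t) * (q x + ?D x))"
        using elim by (auto simp: q_def scaleR_conv_of_real)
      have "?f \<tau> \<le> 2 * ?f t + 2 * (Hp_norm L s (\<lambda>x. of_real (\<tau> - t) * (q x + ?D x)))\<^sup>2"
        by (subst eq) (intro Hp_norm_add_power2_le Hp_cmult Hp_add q X t)
      also have "(Hp_norm L s (\<lambda>x. of_real (\<tau> - t) * (q x + ?D x)))\<^sup>2 = (\<tau> - t)\<^sup>2 * (Hp_norm L s (\<lambda>x. q x + ?D x))\<^sup>2"
        unfolding Hp_norm_cmult_power2 norm_of_real by simp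
      also have "\<dots> \<le> T\<^sup>2 * (2 * 1 + 2 * ?g t)"
      proof (rule mult_mono)
        show "(\<tau> - t)\<^sup>2 \<le> T\<^sup>2" using \<tau> t by (intro power2_le_iff_abs_le[THEN iffD2]) auto
        have "(Hp_norm L s q)\<^sup>2 \<le> 1"
          using elim(1) by (simp add: q_def[abs_def] abs_square_le_1)
        then show "(Hp_norm L s (\<lambda>x. q x + ?D x))\<^sup>2 \<le> 2 * 1 + 2 * ?g t"
          using Hp_norm_add_power2_le[OF q X(3)[OF t]] by linarith
      qed auto
      finally show ?case by simp
    qed
    then show "\<exists>B. \<forall>\<^sub>F \<tau> in at t within {0..T}. ?f \<tau> \<le> B" by blast
  qed simp
  moreover have "bdd_above (?g ` {0..T})"
  proof (rule locally_bounded_imp_bdd_above)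
    fix t assume t: "t \<in> {0..T}"
    let ?d = "\<lambda>\<tau> x. Hp_deriv L s T u \<tau> x - Hp_deriv L s T u t x"
    have "((\<lambda>\<tau>. Hp_norm L s (?d \<tau>)) \<longlongrightarrow> 0) (at t within {0..T})"
      using assms(1) t by (simp add: X_space_def)
    then have "\<forall>\<^sub>F \<tau> in at t within {0..T}. Hp_norm L s (?d \<tau>) < 1"
      by (rule order_tendstoD) simp
    moreover have "\<forall>\<^sub>F \<tau> in at t within {0..T}. \<tau> \<in> {0..T}"
      by (auto simp: eventually_at_filter)
    ultimately have "\<forall>\<^sub>F \<tau> in at t within {0..T}. ?g \<tau> \<le> 2 * 1 + 2 * ?g t"
    proof eventually_elim
      case (elim \<tau>)
      have "(Hp_norm L s (?d \<tau>))\<^sup>2 \<le> 1" using elim(1) by (simp add: abs_square_le_1)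
      then show ?case
        using Hp_norm_add_power2_le[OF Hp_diff[OF X(3)[OF elim(2)] X(3)[OF t]] X(3)[OF t]] by simp
    qed
    then show "\<exists>B. \<forall>\<^sub>F \<tau> in at t within {0..T}. ?g \<tau> \<le> B" by blast
  qed simp
  ultimately obtain B C where BC: "\<And>t. t \<in> {0..T} \<Longrightarrow> ?f t \<le> B" "\<And>t. t \<in> {0..T} \<Longrightarrow> ?g t \<le> C"
    unfolding bdd_above_def by fast
  have "bdd_above ((\<lambda>t. ?f t + ?g t) ` {0..T})"
    by (rule bdd_aboveI2[where M = "B + C"]) (intro add_mono BC)
  then have le: "?f t + ?g t \<le> (SUP t\<in>{0..T}. ?f t + ?g t)"
    by (rule cSUP_upper[OF assms(2)])
  also have "\<dots> = (X_norm L s T u)\<^sup>2"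
    unfolding X_norm_def by (rule real_sqrt_pow2[symmetric]) (rule order_trans[OF _ le], simp)
  finally show ?thesis .
qed

text \<open>Serves to estimate the error curve from bounds at each single time: as
  \<open>[0,T]\<close> is nonempty, the supremum stays below any common bound.\<close>

lemma X_norm_le:
  assumes "0 \<le> T" "0 \<le> B"
    "\<And>t. t \<in> {0..T} \<Longrightarrow> (Hp_norm L s (u t))\<^sup>2 + (Hp_norm L s (Hp_deriv L s T u t))\<^sup>2 \<le> B\<^sup>2"
  shows "X_norm L s T u \<le> B"
proof -
  have "(SUP t\<in>{0..T}. (Hp_norm L s (u t))\<^sup>2 + (Hp_norm L s (Hp_deriv L s T u t))\<^sup>2) \<le> B\<^sup>2"
    using assms(1) by (intro cSUP_least assms(3)) auto
  then show ?thesis unfolding X_norm_def using assms(2) real_le_lsqrt by blast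
qed

lemma X_norm_nonneg:
  assumes "u \<in> X_space L s T" "0 \<le> T"
  shows "0 \<le> X_norm L s T u"
proof -
  have "bdd_above ((\<lambda>t. (Hp_norm L s (u t))\<^sup>2 + (Hp_norm L s (Hp_deriv L s T u t))\<^sup>2) ` {0..T})"
    by (rule bdd_aboveI2) (rule X_norm_bound[OF assms(1)])
  then show ?thesis
    unfolding X_norm_def using assms(2)
    by (intro real_sqrt_ge_zero order_trans[OF _ cSUP_upper[of 0]]) auto
qed

section \<open>Absolutely summable coefficients for exponents at least 1\<close>

lemma summable_on_int_inverse_squares: "(\<lambda>k::int. 1 / (1 + (real_of_int k)\<^sup>2)) summable_on UNIV"
proof -
  have "summable (\<lambda>n. 1 / (1 + (real n)\<^sup>2))"
  proof (rule summable_comparison_test'[OF inverse_power_summable[of 2], of 1])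
    fix n :: nat assume "n \<ge> 1"
    then show "norm (1 / (1 + (real n)\<^sup>2)) \<le> inverse (real n ^ 2)"
      using frac_le[of 1 1 "(real n)\<^sup>2" "1 + (real n)\<^sup>2"] by (simp add: inverse_eq_divide)
  qed simp
  then have nat: "(\<lambda>n. 1 / (1 + (real n)\<^sup>2)) summable_on UNIV"
    by (intro norm_summable_imp_summable_on) simp
  have "(\<lambda>k::int. 1 / (1 + (real_of_int k)\<^sup>2)) summable_on range int"
    using nat by (subst summable_on_reindex) (auto simp: o_def)
  moreover have "(\<lambda>k::int. 1 / (1 + (real_of_int k)\<^sup>2)) summable_on range (\<lambda>n. - int n)"
    using nat by (subst summable_on_reindex) (auto simp: o_def inj_on_def)
  moreover have "k \<in> range int \<union> range (\<lambda>n. - int n)" for k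
    by (cases k rule: int_cases2) auto
  then have "range int \<union> range (\<lambda>n. - int n) = UNIV" by blast
  ultimately show ?thesis
    using summable_on_union[of "\<lambda>k::int. 1 / (1 + (real_of_int k)\<^sup>2)" "range int" "range (\<lambda>n. - int n)"] by simp
qed

definition inverse_square_sum :: real where
  "inverse_square_sum = (\<Sum>\<^sub>\<infinity>k::int. 1 / (1 + (real_of_int k)\<^sup>2))"

text \<open>Expanding \<open>0 \<le> (1 - a * y)\<^sup>2\<close> with
  \<open>a = 1 + k\<^sup>2\<close> gives \<open>y \<le> 1 / a + a * y\<^sup>2\<close>, and both
  terms are summable when \<open>s \<ge> 1\<close>. This takes the place of Cauchy-Schwarz for
  series. The bound is not homogeneous in the norm, but it only fixes the range on which
  \<open>g\<close> has to be Lipschitz.\<close>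

lemma Hp_abs_summable:
  assumes "v \<in> Hp L s" "1 \<le> s"
  shows "(\<lambda>k. cmod (fourier_coeff L v k)) summable_on UNIV"
    and "(\<Sum>\<^sub>\<infinity>k. cmod (fourier_coeff L v k)) \<le> inverse_square_sum + (Hp_norm L s v)\<^sup>2"
proof -
  have le: "cmod (fourier_coeff L v k) \<le> 1 / (1 + (real_of_int k)\<^sup>2) + Hp_weight s k * (cmod (fourier_coeff L v k))\<^sup>2" for k
  proof -
    define a y where "a = 1 + (real_of_int k)\<^sup>2" and "y = cmod (fourier_coeff L v k)"
    have a: "a \<ge> 1" by (simp add: a_def)
    have "0 \<le> (1 - a * y)\<^sup>2" by simp
    then have "2 * (a * y) \<le> 1 + a * y * (a * y)" by (simp add: power2_eq_square algebra_simps)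
    moreover have "(1 / a + a * y\<^sup>2) * a = 1 + a * y * (a * y)"
      using a by (simp add: distrib_right power2_eq_square)
    ultimately have "(2 * y) * a \<le> (1 / a + a * y\<^sup>2) * a" by (simp add: mult.commute mult.left_commute)
    then have "2 * y \<le> 1 / a + a * y\<^sup>2" by (rule mult_right_le_imp_le) (use a in simp)
    moreover have "a * y\<^sup>2 \<le> a powr s * y\<^sup>2"
      using a powr_mono[of 1 s a] assms(2) by (intro mult_right_mono) auto
    moreover have "0 \<le> y" by (simp add: y_def)
    ultimately have "y \<le> 1 / a + a powr s * y\<^sup>2" by linarith
    then show ?thesis by (simp add: a_def y_def)
  qed
  have sm: "(\<lambda>k. 1 / (1 + (real_of_int k)\<^sup>2) + Hp_weight s k * (cmod (fourier_coeff L v k))\<^sup>2) summable_on UNIV"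
    by (intro summable_on_add summable_on_int_inverse_squares HpD(4)[OF assms(1)])
  show *: "(\<lambda>k. cmod (fourier_coeff L v k)) summable_on UNIV"
    by (rule summable_on_comparison_test[OF sm le]) simp
  have "(\<Sum>\<^sub>\<infinity>k. cmod (fourier_coeff L v k))
      \<le> (\<Sum>\<^sub>\<infinity>k. 1 / (1 + (real_of_int k)\<^sup>2) + Hp_weight s k * (cmod (fourier_coeff L v k))\<^sup>2)"
    by (rule infsum_mono[OF * sm le])
  also have "\<dots> = inverse_square_sum + (Hp_norm L s v)\<^sup>2"
    unfolding inverse_square_sum_def Hp_norm_power2
    by (rule infsum_add[OF summable_on_int_inverse_squares HpD(4)[OF assms(1)]])
  finally show "(\<Sum>\<^sub>\<infinity>k. cmod (fourier_coeff L v k)) \<le> inverse_square_sum + (Hp_norm L s v)\<^sup>2" .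
qed

section \<open>Energy estimate for forced oscillators\<close>

text \<open>Continuity argument: the differential inequality is available only while
  \<open>F \<le> m\<close>, but the bound it yields is strictly below \<open>m\<close>. At a first
  time where \<open>F\<close> reaches \<open>m\<close> these two facts contradict each
  other.\<close>

lemma gronwall_bootstrap:
  fixes F F' :: "real \<Rightarrow> real"
  assumes cont: "continuous_on {0..T} F"
    and der: "\<And>t. 0 < t \<Longrightarrow> t < T \<Longrightarrow> (F has_real_derivative F' t) (at t)"
    and ineq: "\<And>t. 0 < t \<Longrightarrow> t < T \<Longrightarrow> F t \<le> m \<Longrightarrow> F' t \<le> A * F t + B"
    and "F 0 = 0" "A > 0" "B \<ge> 0" and m: "B / A * exp (A * T) < m"
    and t: "t \<in> {0..T}"
  shows "F t \<le> B / A * exp (A * T)"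
proof -
  have step: "F \<sigma> \<le> B / A * exp (A * T)" if \<sigma>: "\<sigma> \<in> {0..T}" "\<And>t. 0 < t \<Longrightarrow> t < \<sigma> \<Longrightarrow> F t \<le> m" for \<sigma>
  proof -
    \<comment> \<open>Integrating factor: the inequality makes \<open>H\<close> nonincreasing, and
      \<open>H 0 = B / A\<close>.\<close>
    define H where "H t = exp (- A * t) * (F t + B / A)" for t
    have "H 0 \<ge> H \<sigma>"
    proof (rule DERIV_nonpos_imp_decreasing_open[where f = H and a = 0 and b = \<sigma>])
      show "continuous_on {0..\<sigma>} H"
        unfolding H_def using \<sigma>(1) by (intro continuous_intros continuous_on_subset[OF cont]) auto
      fix t assume t: "0 < t" "t < \<sigma>"
      have d: "(F has_real_derivative F' t) (at t)" using t \<sigma>(1) by (intro der) auto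
      have "(H has_real_derivative exp (- A * t) * (F' t - A * F t - B)) (at t)"
        unfolding H_def using \<open>A > 0\<close>
        by (auto intro!: derivative_eq_intros d simp: algebra_simps)
      moreover have "F' t \<le> A * F t + B" using t \<sigma> by (intro ineq) auto
      then have "exp (- A * t) * (F' t - A * F t - B) \<le> 0"
        by (intro mult_nonneg_nonpos) auto
      ultimately show "\<exists>y. (H has_real_derivative y) (at t) \<and> y \<le> 0" by blast
    qed (use \<sigma> in auto)
    then have "exp (- (A * \<sigma>)) * (F \<sigma> + B / A) \<le> B / A" using \<open>F 0 = 0\<close> by (simp add: H_def)
    then have "exp (A * \<sigma>) * (exp (- (A * \<sigma>)) * (F \<sigma> + B / A)) \<le> exp (A * \<sigma>) * (B / A)"
      by (intro mult_left_mono) auto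
    then have "F \<sigma> + B / A \<le> exp (A * \<sigma>) * (B / A)"
      by (simp add: mult.assoc[symmetric] exp_add[symmetric])
    also have "\<dots> \<le> exp (A * T) * (B / A)"
      using \<sigma>(1) \<open>A > 0\<close> \<open>B \<ge> 0\<close> by (intro mult_right_mono) auto
    finally have "F \<sigma> + B / A \<le> B / A * exp (A * T)" by (simp add: mult.commute)
    moreover have "0 \<le> B / A" using \<open>A > 0\<close> \<open>B \<ge> 0\<close> by simp
    ultimately show ?thesis by linarith
  qed
  have below: "F t < m" if t: "t \<in> {0..T}" for t
  proof (rule ccontr)
    assume "\<not> F t < m"
    \<comment> \<open>Closed by continuity of \<open>F\<close>, so there is a first time
      \<open>\<sigma>\<close>; before it \<open>F \<le> m\<close> holds and \<open>step\<close>
      applies.\<close>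
    define S where "S = {0..T} \<inter> F -` {m..}"
    have "closed S" unfolding S_def by (rule continuous_closed_preimage[OF cont]) auto
    then have "compact ({0..T} \<inter> S)" by (rule compact_Int_closed[OF compact_Icc])
    moreover have "{0..T} \<inter> S = S" by (auto simp: S_def)
    ultimately have "compact S" by simp
    moreover have "S \<noteq> {}" using t \<open>\<not> F t < m\<close> by (auto simp: S_def)
    ultimately obtain \<sigma> where \<sigma>: "\<sigma> \<in> S" "\<And>x. x \<in> S \<Longrightarrow> \<sigma> \<le> x"
      using compact_attains_inf by meson
    have "F x \<le> m" if "0 < x" "x < \<sigma>" for x
      using \<sigma>(2)[of x] \<sigma>(1) that by (force simp: S_def)
    then have "F \<sigma> \<le> B / A * exp (A * T)" using \<sigma>(1) by (intro step) (auto simp: S_def)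
    then show False using \<sigma>(1) m by (auto simp: S_def)
  qed
  show ?thesis using t below by (intro step) (auto intro: less_imp_le)
qed

lemma has_real_derivative_cmod_power2:
  fixes z :: "real \<Rightarrow> complex"
  assumes "(z has_vector_derivative z') (at t within S)"
  shows "((\<lambda>t. (cmod (z t))\<^sup>2) has_real_derivative 2 * (z t \<bullet> z')) (at t within S)"
proof -
  have "((\<lambda>t. z t \<bullet> z t) has_vector_derivative z t \<bullet> z' + z' \<bullet> z t) (at t within S)"
    by (rule bounded_bilinear.has_vector_derivative[OF bounded_bilinear_inner assms assms])
  then show ?thesis
    by (simp add: has_real_derivative_iff_has_vector_derivative power2_norm_eq_inner inner_commute)
qed

text \<open>The energy is the plain sum of squares. The natural energy, with \<open>p\<close>
  weighted by \<open>lam\<close>, would give no control of \<open>p\<close> where \<open>lam\<close>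
  vanishes; the bound \<open>\<Lambda>\<close> takes care of the mixed terms that no longer cancel.
  The estimate of \<open>h\<close> is conditional on the energy being at most \<open>m\<close>, as
  the continuity argument allows.\<close>

lemma oscillator_energy_bound:
  fixes p q h :: "int \<Rightarrow> real \<Rightarrow> complex" and lam :: "int \<Rightarrow> real"
  assumes "finite K" "0 < T"
    and p: "\<And>k t. k \<in> K \<Longrightarrow> t \<in> {0..T} \<Longrightarrow> (p k has_vector_derivative q k t) (at t within {0..T})"
    and q: "\<And>k t. k \<in> K \<Longrightarrow> t \<in> {0..T} \<Longrightarrow>
      (q k has_vector_derivative - of_real (lam k) * (p k t + h k t)) (at t within {0..T})"
    and init: "\<And>k. k \<in> K \<Longrightarrow> p k 0 = 0" "\<And>k. k \<in> K \<Longrightarrow> q k 0 = 0"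
    and lam: "\<And>k. k \<in> K \<Longrightarrow> 0 \<le> lam k" "\<And>k. k \<in> K \<Longrightarrow> lam k \<le> \<Lambda>" and "0 \<le> \<Lambda>"
    and h: "\<And>t. t \<in> {0..T} \<Longrightarrow> (\<Sum>k\<in>K. (cmod (p k t))\<^sup>2 + (cmod (q k t))\<^sup>2) \<le> m \<Longrightarrow>
      (\<Sum>k\<in>K. (cmod (h k t))\<^sup>2) \<le> G * ((\<Sum>k\<in>K. (cmod (p k t))\<^sup>2 + (cmod (q k t))\<^sup>2) + \<eta>)"
    and "0 \<le> G" "0 \<le> \<eta>"
    and A: "A = 1 + 2 * \<Lambda> + \<Lambda> * G"
    and m: "\<Lambda> * G * \<eta> / A * exp (A * T) < m"
    and t: "t \<in> {0..T}"
  shows "(\<Sum>k\<in>K. (cmod (p k t))\<^sup>2 + (cmod (q k t))\<^sup>2) \<le> \<Lambda> * G * \<eta> / A * exp (A * T)"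
proof -
  define F where "F t = (\<Sum>k\<in>K. (cmod (p k t))\<^sup>2 + (cmod (q k t))\<^sup>2)" for t
  define F' where "F' t = (\<Sum>k\<in>K. 2 * (p k t \<bullet> q k t) + 2 * (q k t \<bullet> (- of_real (lam k) * (p k t + h k t))))" for t
  have der: "(F has_real_derivative F' t) (at t within {0..T})" if "t \<in> {0..T}" for t
    unfolding F_def F'_def by (intro DERIV_sum DERIV_add has_real_derivative_cmod_power2 p q that)
  have "A > 0" using \<open>0 \<le> \<Lambda>\<close> \<open>0 \<le> G\<close> unfolding A by (intro add_pos_nonneg) auto
  have "F t \<le> \<Lambda> * G * \<eta> / A * exp (A * T)"
  proof (rule gronwall_bootstrap[where F = F and F' = F' and m = m and A = A and B = "\<Lambda> * G * \<eta>" and T = T])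
    show "continuous_on {0..T} F"
      unfolding continuous_on_eq_continuous_within using der DERIV_continuous by blast
    show "(F has_real_derivative F' t) (at t)" if "0 < t" "t < T" for t
      using der[of t] that by (simp add: at_within_Icc_at)
    show "F 0 = 0" using init by (simp add: F_def)
    show "A > 0" by fact
    show "0 \<le> \<Lambda> * G * \<eta>" using \<open>0 \<le> \<Lambda>\<close> \<open>0 \<le> G\<close> \<open>0 \<le> \<eta>\<close> by simp
    show "F' t \<le> A * F t + \<Lambda> * G * \<eta>" if "0 < t" "t < T" "F t \<le> m" for t
    proof -
      have summand: "2 * (p k t \<bullet> q k t) + 2 * (q k t \<bullet> (- of_real (lam k) * (p k t + h k t)))
          \<le> (1 + 2 * \<Lambda>) * ((cmod (p k t))\<^sup>2 + (cmod (q k t))\<^sup>2) + \<Lambda> * (cmod (h k t))\<^sup>2" if k: "k \<in> K" for k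
      proof -
        have ab: "\<bar>2 * (a \<bullet> b)\<bar> \<le> (cmod a)\<^sup>2 + (cmod b)\<^sup>2" for a b :: complex
        proof -
          have "\<bar>a \<bullet> b\<bar> \<le> cmod a * cmod b" by (rule Cauchy_Schwarz_ineq2)
          then show ?thesis using sum_squares_bound[of "cmod a" "cmod b"] by (simp add: abs_mult)
        qed
        have eq: "q k t \<bullet> (- of_real (lam k) * (p k t + h k t)) = - (lam k * (q k t \<bullet> p k t + q k t \<bullet> h k t))"
          by (simp add: scaleR_conv_of_real[symmetric] inner_add_right)
        \<comment> \<open>Every inner product is split by
          \<open>2 * a * b \<le> a\<^sup>2 + b\<^sup>2\<close>. Together with the term
          \<open>p \<bullet> q\<close> this accounts for \<open>1 + 2 * \<Lambda>\<close> in
          \<open>A\<close>, and the estimate of \<open>h\<close> for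
          \<open>\<Lambda> * G\<close>.\<close>
        have "- (2 * (q k t \<bullet> p k t) + 2 * (q k t \<bullet> h k t)) \<le> 2 * (cmod (q k t))\<^sup>2 + (cmod (p k t))\<^sup>2 + (cmod (h k t))\<^sup>2"
          using ab[of "q k t" "p k t"] ab[of "q k t" "h k t"] by linarith
        from mult_left_mono[OF this lam(1)[OF k]]
        have "- (lam k * (2 * (q k t \<bullet> p k t) + 2 * (q k t \<bullet> h k t))) \<le> lam k * (2 * (cmod (q k t))\<^sup>2 + (cmod (p k t))\<^sup>2 + (cmod (h k t))\<^sup>2)"
          by (simp only: mult_minus_right)
        also have "\<dots> \<le> \<Lambda> * (2 * (cmod (q k t))\<^sup>2 + (cmod (p k t))\<^sup>2 + (cmod (h k t))\<^sup>2)"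
          by (intro mult_right_mono lam k) auto
        also have "\<dots> \<le> 2 * \<Lambda> * ((cmod (p k t))\<^sup>2 + (cmod (q k t))\<^sup>2) + \<Lambda> * (cmod (h k t))\<^sup>2"
          using mult_nonneg_nonneg[OF \<open>0 \<le> \<Lambda>\<close> zero_le_power2[of "cmod (p k t)"]] by (simp add: algebra_simps)
        finally have "2 * (q k t \<bullet> (- of_real (lam k) * (p k t + h k t)))
            \<le> 2 * \<Lambda> * ((cmod (p k t))\<^sup>2 + (cmod (q k t))\<^sup>2) + \<Lambda> * (cmod (h k t))\<^sup>2"
          unfolding eq by (simp add: algebra_simps)
        then show ?thesis using ab[of "p k t" "q k t"] by (simp add: algebra_simps)
      qed
      have "F' t \<le> (\<Sum>k\<in>K. (1 + 2 * \<Lambda>) * ((cmod (p k t))\<^sup>2 + (cmod (q k t))\<^sup>2) + \<Lambda> * (cmod (h k t))\<^sup>2)"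
        unfolding F'_def by (rule sum_mono) (rule summand)
      also have "\<dots> = (1 + 2 * \<Lambda>) * F t + \<Lambda> * (\<Sum>k\<in>K. (cmod (h k t))\<^sup>2)"
        by (simp only: sum.distrib sum_distrib_left[symmetric] F_def)
      also have "\<dots> \<le> (1 + 2 * \<Lambda>) * F t + \<Lambda> * (G * (F t + \<eta>))"
        using h[of t] that \<open>0 \<le> \<Lambda>\<close> by (intro add_left_mono mult_left_mono) (auto simp: F_def)
      also have "\<dots> = A * F t + \<Lambda> * G * \<eta>" by (simp add: A algebra_simps)
      finally show ?thesis .
    qed
  qed (use m t in auto)
  then show ?thesis by (simp add: F_def)
qed

section \<open>Locally Lipschitz nonlinearities\<close>

text \<open>Bessel for \<open>g(a) - g(b)\<close>, the pointwise Lipschitz bound, and Parseval for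
  \<open>a - b\<close>. The bound \<open>S\<close> is over all finite sets of frequencies although
  the conclusion concerns \<open>K\<close>: the nonlinearity mixes frequencies, so the part of
  \<open>a - b\<close> outside \<open>K\<close> contributes.\<close>

lemma lipschitz_nonlinearity_coeff:
  fixes g :: "real \<Rightarrow> real"
  assumes L: "L > 0" and [measurable]: "g \<in> borel_measurable borel" "a \<in> borel_measurable borel" "b \<in> borel_measurable borel"
    and lip: "\<And>x y. \<bar>x\<bar> \<le> R \<Longrightarrow> \<bar>y\<bar> \<le> R \<Longrightarrow> \<bar>g x - g y\<bar> \<le> M * \<bar>x - y\<bar>" and "0 \<le> M"
    and a: "AE x in period_measure L. cmod (a x) \<le> R" and b: "AE x in period_measure L. cmod (b x) \<le> R"
    and sm: "(\<lambda>k. cmod (fourier_coeff L a k - fourier_coeff L b k)) summable_on UNIV"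
    and S: "\<And>J. finite J \<Longrightarrow> (\<Sum>k\<in>J. (cmod (fourier_coeff L a k - fourier_coeff L b k))\<^sup>2) \<le> S"
    and "finite K"
  shows "(\<Sum>k\<in>K. (cmod (fourier_coeff L (\<lambda>x. of_real (g (Re (a x)))) k - fourier_coeff L (\<lambda>x. of_real (g (Re (b x)))) k))\<^sup>2) \<le> M\<^sup>2 * S"
proof -
  have ia: "integrable (period_measure L) a" and ib: "integrable (period_measure L) b"
    using a b by (auto intro: integrable_period_bounded)
  have ga: "AE x in period_measure L. cmod (of_real (g (Re (a x)))) \<le> \<bar>g 0\<bar> + M * R"
    if "AE x in period_measure L. cmod (a x) \<le> R" for a
    using that
  proof eventually_elim
    case (elim x)
    have 1: "\<bar>Re (a x)\<bar> \<le> R" using abs_Re_le_cmod[of "a x"] elim by linarith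
    then have "\<bar>g (Re (a x)) - g 0\<bar> \<le> M * \<bar>Re (a x)\<bar>" using lip[of "Re (a x)" 0] by simp
    also have "\<dots> \<le> M * R" using 1 \<open>0 \<le> M\<close> by (intro mult_left_mono)
    finally show ?case by simp
  qed
  have iga: "integrable (period_measure L) (\<lambda>x. complex_of_real (g (Re (a x))))"
    by (rule integrable_period_bounded[OF _ ga[OF a]]) simp
  have igb: "integrable (period_measure L) (\<lambda>x. complex_of_real (g (Re (b x))))"
    by (rule integrable_period_bounded[OF _ ga[OF b]]) simp
  have bd: "AE x in period_measure L. (cmod (of_real (g (Re (a x))) - of_real (g (Re (b x)))))\<^sup>2 \<le> M\<^sup>2 * (cmod (a x - b x))\<^sup>2"
    using a b
  proof eventually_elim
    case (elim x)
    have "cmod (of_real (g (Re (a x))) - of_real (g (Re (b x)))) = \<bar>g (Re (a x)) - g (Re (b x))\<bar>"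
      unfolding of_real_diff[symmetric] norm_of_real ..
    also have "\<dots> \<le> M * \<bar>Re (a x) - Re (b x)\<bar>"
      using abs_Re_le_cmod[of "a x"] abs_Re_le_cmod[of "b x"] elim by (intro lip) auto
    also have "\<dots> \<le> M * cmod (a x - b x)"
      using abs_Re_le_cmod[of "a x - b x"] \<open>0 \<le> M\<close> by (intro mult_left_mono) auto
    finally show ?case unfolding power_mult_distrib[symmetric] by (rule power_mono) simp
  qed
  have iab2: "integrable (period_measure L) (\<lambda>x. (cmod (a x - b x))\<^sup>2)"
  proof (rule integrable_period_bounded[where B = "(R + R)\<^sup>2"])
    show "AE x in period_measure L. norm ((cmod (a x - b x))\<^sup>2) \<le> (R + R)\<^sup>2"
      using a b
    proof eventually_elim
      case (elim x)
      then have "cmod (a x - b x) \<le> R + R" using norm_triangle_ineq4[of "a x" "b x"] by linarith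
      then show ?case using power_mono[of "cmod (a x - b x)" "R + R" 2] by simp
    qed
  qed simp
  define f where "f x = complex_of_real (g (Re (a x))) - complex_of_real (g (Re (b x)))" for x
  have f2: "integrable (period_measure L) (\<lambda>x. (cmod (f x))\<^sup>2)"
  proof (rule Bochner_Integration.integrable_bound)
    show "integrable (period_measure L) (\<lambda>x. M\<^sup>2 * (cmod (a x - b x))\<^sup>2)" using iab2 by simp
    show "(\<lambda>x. (cmod (f x))\<^sup>2) \<in> borel_measurable (period_measure L)"
      by (rule measurable_period) (simp add: f_def)
    show "AE x in period_measure L. norm ((cmod (f x))\<^sup>2) \<le> norm (M\<^sup>2 * (cmod (a x - b x))\<^sup>2)"
      using bd by eventually_elim (simp add: f_def)
  qed
  have "2 * L * (\<Sum>k\<in>K. (cmod (fourier_coeff L f k))\<^sup>2) \<le> (\<integral>x. (cmod (f x))\<^sup>2 \<partial>period_measure L)"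
    by (rule bessel_inequality[OF L \<open>finite K\<close> _ f2]) (simp add: f_def[abs_def])
  also have "\<dots> \<le> (\<integral>x. M\<^sup>2 * (cmod (a x - b x))\<^sup>2 \<partial>period_measure L)"
    using f2 iab2 bd by (intro integral_mono_AE) (auto simp: f_def)
  also have "\<dots> = M\<^sup>2 * (\<integral>x. (cmod (a x - b x))\<^sup>2 \<partial>period_measure L)" by simp
  also have "\<dots> \<le> M\<^sup>2 * (2 * L * S)"
  proof (intro mult_left_mono parseval_le[OF L])
    show "integrable (period_measure L) (\<lambda>x. a x - b x)" using ia ib by simp
  qed (use sm S in \<open>auto simp: fourier_coeff_diff[OF ia ib]\<close>)
  finally have "2 * L * (\<Sum>k\<in>K. (cmod (fourier_coeff L f k))\<^sup>2) \<le> 2 * L * (M\<^sup>2 * S)" by (simp add: mult_ac)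
  then have "(\<Sum>k\<in>K. (cmod (fourier_coeff L f k))\<^sup>2) \<le> M\<^sup>2 * S" using L by simp
  moreover have "fourier_coeff L f k = fourier_coeff L (\<lambda>x. of_real (g (Re (a x)))) k - fourier_coeff L (\<lambda>x. of_real (g (Re (b x)))) k" for k
    unfolding f_def[abs_def] by (rule fourier_coeff_diff[OF iga igb])
  ultimately show ?thesis by simp
qed

lemma C2_real_imp_locally_lipschitz:
  assumes "C2_real g"
  obtains M where "0 \<le> M" "\<And>x y. \<bar>x\<bar> \<le> R \<Longrightarrow> \<bar>y\<bar> \<le> R \<Longrightarrow> \<bar>g x - g y\<bar> \<le> M * \<bar>x - y\<bar>"
proof -
  obtain g1 g2 where "\<forall>x. (g has_vector_derivative g1 x) (at x) \<and> (g1 has_vector_derivative g2 x) (at x)"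
    using assms unfolding C2_real_def has_second_derivative_def by blast
  then have g: "(g has_vector_derivative g1 x) (at x)" "(g1 has_vector_derivative g2 x) (at x)" for x
    by simp_all
  have "continuous_on {-R..R} g1"
    using g(2) by (intro continuous_at_imp_continuous_on ballI has_vector_derivative_continuous)
  then have "compact (g1 ` {-R..R})" by (intro compact_continuous_image) auto
  then have "bounded (g1 ` {-R..R})" by (rule compact_imp_bounded)
  then obtain B where "\<forall>y\<in>g1 ` {-R..R}. norm y \<le> B"
    unfolding bounded_iff by blast
  then have B: "norm (g1 x) \<le> B" if "x \<in> {-R..R}" for x using that by blast
  show thesis
  \<comment> \<open>For \<open>R < 0\<close> the interval is empty and \<open>B\<close> may be
    negative, hence the absolute value.\<close>
  proof (rule that[of "\<bar>B\<bar>"])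
    fix x y assume xy: "\<bar>x\<bar> \<le> R" "\<bar>y\<bar> \<le> R"
    have "norm (g x - g y) \<le> \<bar>B\<bar> * norm (x - y)"
    proof (rule field_differentiable_bound[where S = "{-R..R}" and f = g and f' = g1])
      show "(g has_field_derivative g1 z) (at z within {-R..R})" for z
        using g(1)[of z] unfolding has_real_derivative_iff_has_vector_derivative by (rule has_vector_derivative_at_within)
      show "norm (g1 z) \<le> \<bar>B\<bar>" if "z \<in> {-R..R}" for z using B[OF that] by linarith
    qed (use xy in auto)
    then show "\<bar>g x - g y\<bar> \<le> \<bar>B\<bar> * \<bar>x - y\<bar>" by simp
  qed simp
qed

lemma C2_real_imp_measurable:
  assumes "C2_real g"
  shows "g \<in> borel_measurable borel"
proof -
  obtain g1 g2 where "\<forall>x. (g has_vector_derivative g1 x) (at x) \<and> (g1 has_vector_derivative g2 x) (at x)"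
    using assms unfolding C2_real_def has_second_derivative_def by blast
  then have "(g has_vector_derivative g1 x) (at x)" for x by simp
  then show ?thesis
    by (intro borel_measurable_continuous_onI continuous_at_imp_continuous_on ballI has_vector_derivative_continuous)
qed

section \<open>Curves in the space of trigonometric polynomials\<close>

text \<open>A geometric sum whose ratio is an \<open>N\<close>-th root of unity;
  \<open>\<bar>m\<bar> < N\<close> keeps the ratio different from 1 unless
  \<open>m = 0\<close>.\<close>

lemma sum_mode_nodes:
  assumes "L > 0" "N > 0" "\<bar>m\<bar> < int N"
  shows "(\<Sum>j<N. mode L m (2 * L * real j / real N)) = (if m = 0 then of_nat N else 0)"
proof (cases "m = 0")
  case False
  define \<theta> where "\<theta> = 2 * pi * of_int m / real N"
  have pow: "mode L m (2 * L * real j / real N) = cis \<theta> ^ j" for j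
    using assms(1) unfolding mode_cis Complex.DeMoivre by (simp add: \<theta>_def mult_ac)
  have "cis \<theta> ^ N = 1"
    using assms(2) cis_multiple_2pi[of "of_int m"] unfolding Complex.DeMoivre by (simp add: \<theta>_def)
  moreover have "cis \<theta> \<noteq> 1"
  proof
    assume "cis \<theta> = 1"
    then have "cos \<theta> = 1" by (simp add: complex_eq_iff)
    then obtain n :: int where "\<theta> = of_int n * 2 * pi" using cos_one_2pi_int by blast
    then have "real_of_int m = real_of_int n * real N"
      using assms(2) by (simp add: \<theta>_def field_simps)
    then have "m = n * int N" by (metis of_int_eq_iff of_int_mult of_int_of_nat_eq)
    then show False using assms(3) False by (auto simp: abs_mult)
  qed
  ultimately show ?thesis using False by (simp add: pow geometric_sum)
qed simp

text \<open>The discrete Fourier transform at \<open>N\<close> equidistant nodes of a period. Being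
  a finite combination of point values, it commutes with pointwise derivatives in time. It agrees
  with \<open>fourier_coeff\<close> on the band, where frequencies differ by less than
  \<open>N\<close> and no aliasing occurs.\<close>

definition node_coeff :: "real \<Rightarrow> nat \<Rightarrow> (real \<Rightarrow> complex) \<Rightarrow> int \<Rightarrow> complex" where
  "node_coeff L N f k =
    (1 / of_nat N) * (\<Sum>j<N. f (2 * L * real j / real N) * mode L (- k) (2 * L * real j / real N))"

lemma freq_range_diff: "k \<in> freq_range N \<Longrightarrow> l \<in> freq_range N \<Longrightarrow> \<bar>l - k\<bar> < int N"
  by (auto simp: freq_range_def)

lemma finite_freq_range [simp]: "finite (freq_range N)"
  by (simp add: freq_range_def)

lemma node_coeff_trig_sum:
  assumes "L > 0" "N > 0" "k \<in> freq_range N"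
  shows "node_coeff L N (\<lambda>x. \<Sum>l\<in>freq_range N. c l * mode L l x) k = c k"
proof -
  let ?x = "\<lambda>j. 2 * L * real j / real N"
  have "(\<Sum>j<N. (\<Sum>l\<in>freq_range N. c l * mode L l (?x j)) * mode L (- k) (?x j))
      = (\<Sum>j<N. \<Sum>l\<in>freq_range N. c l * mode L (l - k) (?x j))"
    using mode_add[of L _ "- k"] by (simp add: sum_distrib_right mult.assoc)
  also have "\<dots> = (\<Sum>l\<in>freq_range N. c l * (\<Sum>j<N. mode L (l - k) (?x j)))"
    by (subst sum.swap) (simp add: sum_distrib_left)
  also have "\<dots> = (\<Sum>l\<in>freq_range N. if l = k then of_nat N * c l else 0)"
    using sum_mode_nodes[OF assms(1,2) freq_range_diff[OF assms(3)]] by (intro sum.cong) auto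
  also have "\<dots> = of_nat N * c k" using assms(3) by simp
  finally show ?thesis using assms(2) by (simp add: node_coeff_def)
qed

lemma S_space_expansion:
  assumes "L > 0" "f \<in> S_space L N"
  shows "f = (\<lambda>x. \<Sum>k\<in>freq_range N. fourier_coeff L f k * mode L k x)"
    and "k \<notin> freq_range N \<Longrightarrow> fourier_coeff L f k = 0"
    and "N > 0 \<Longrightarrow> k \<in> freq_range N \<Longrightarrow> fourier_coeff L f k = node_coeff L N f k"
proof -
  obtain c where f: "f = (\<lambda>x. \<Sum>k\<in>freq_range N. c k * mode L k x)"
    using assms(2) by (auto simp: S_space_def)
  have c: "fourier_coeff L f k = (if k \<in> freq_range N then c k else 0)" for k
    unfolding f by (rule fourier_coeff_trig_sum[OF assms(1)]) simp
  show "f = (\<lambda>x. \<Sum>k\<in>freq_range N. fourier_coeff L f k * mode L k x)"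
    unfolding c by (subst f) simp
  show "fourier_coeff L f k = 0" if "k \<notin> freq_range N" using that c by simp
  show "fourier_coeff L f k = node_coeff L N f k" if "N > 0" "k \<in> freq_range N"
    using that node_coeff_trig_sum[OF assms(1) that, of c] c f by simp
qed

lemma S_space_periodic: "L > 0 \<Longrightarrow> f \<in> S_space L N \<Longrightarrow> f (x + 2 * L) = f x"
  by (auto simp: S_space_def mode_periodic)

lemma S_space_measurable: "f \<in> S_space L N \<Longrightarrow> f \<in> borel_measurable borel"
  by (auto simp: S_space_def)

lemma S_space_integrable: "f \<in> S_space L N \<Longrightarrow> integrable (period_measure L) f"
  by (auto simp: S_space_def integrable_trig_sum)

lemma P_proj_in_S_space: "P_proj L N f \<in> S_space L N"
  unfolding S_space_def P_proj_def[abs_def] by blast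

lemma fourier_coeff_P_proj:
  assumes "L > 0"
  shows "fourier_coeff L (P_proj L N f) k = (if k \<in> freq_range N then fourier_coeff L f k else 0)"
  unfolding P_proj_def[abs_def] by (rule fourier_coeff_trig_sum[OF assms]) simp

text \<open>A pointwise derivative in time of a curve in the finite-dimensional space \<open>S_space L N\<close> is a derivative
  of its coefficients, because these are combinations of the values at the equidistant nodes.\<close>

lemma S_space_curve_derivative:
  assumes "L > 0" "N > 0" "T > 0" "\<And>t. t \<in> {0..T} \<Longrightarrow> f t \<in> S_space L N"
    and der: "\<And>t x. t \<in> {0..T} \<Longrightarrow> ((\<lambda>\<tau>. f \<tau> x) has_vector_derivative f' t x) (at t within {0..T})"
    and t: "t \<in> {0..T}"
  shows "f' t \<in> S_space L N"
    and "k \<in> freq_range N \<Longrightarrow>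
      ((\<lambda>\<tau>. fourier_coeff L (f \<tau>) k) has_vector_derivative fourier_coeff L (f' t) k) (at t within {0..T})"
proof -
  have nd: "((\<lambda>\<tau>. node_coeff L N (f \<tau>) k) has_vector_derivative node_coeff L N (f' t) k) (at t within {0..T})" for k
    unfolding node_coeff_def
    by (intro has_vector_derivative_mult_right has_vector_derivative_sum has_vector_derivative_mult_left der t)
  have fd: "((\<lambda>\<tau>. fourier_coeff L (f \<tau>) k) has_vector_derivative node_coeff L N (f' t) k) (at t within {0..T})"
    if "k \<in> freq_range N" for k
    by (rule has_vector_derivative_transform[OF t _ nd])
      (use S_space_expansion(3)[OF assms(1) assms(4) assms(2) that] in simp)
  \<comment> \<open>Differentiating the finite expansion of \<open>f\<close> and comparing with the
    given derivative, which is unique as \<open>[0,T]\<close> is nondegenerate, shows that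
    \<open>f' t\<close> stays in the same band.\<close>
  have "f' t x = (\<Sum>k\<in>freq_range N. node_coeff L N (f' t) k * mode L k x)" for x
  proof -
    have "((\<lambda>\<tau>. \<Sum>k\<in>freq_range N. fourier_coeff L (f \<tau>) k * mode L k x) has_vector_derivative
        (\<Sum>k\<in>freq_range N. node_coeff L N (f' t) k * mode L k x)) (at t within {0..T})"
      by (intro has_vector_derivative_sum has_vector_derivative_mult_left fd)
    then have "((\<lambda>\<tau>. f \<tau> x) has_vector_derivative (\<Sum>k\<in>freq_range N. node_coeff L N (f' t) k * mode L k x)) (at t within {0..T})"
      by (rule has_vector_derivative_transform[OF t, rotated]) (subst S_space_expansion(1)[OF assms(1) assms(4)], simp_all)
    then show ?thesis
      using der[OF t, of x] vector_derivative_unique_within_closed_interval[of 0 T t] t assms(3)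
      by (auto simp: cbox_interval)
  qed
  then show S: "f' t \<in> S_space L N" unfolding S_space_def by blast
  show "((\<lambda>\<tau>. fourier_coeff L (f \<tau>) k) has_vector_derivative fourier_coeff L (f' t) k) (at t within {0..T})"
    if "k \<in> freq_range N"
    using fd[OF that] S_space_expansion(3)[OF assms(1) S assms(2) that] by simp
qed

section \<open>The scheme as a second-order system for the coefficients\<close>

text \<open>Squared angular frequency of the \<open>k\<close>-th mode in the linear equation. The
  transform is complex-valued in type, hence \<open>Re\<close>; its values are assumed real wherever
  the equations are brought to this form.\<close>

definition dispersion :: "real \<Rightarrow> (real \<Rightarrow> real) \<Rightarrow> int \<Rightarrow> real" where
  "dispersion L \<beta> k = (of_int k * pi / L)\<^sup>2 * Re (fourier_transform \<beta> (of_int k * pi / L))"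

lemma has_second_derivative_add:
  assumes "has_second_derivative f f2" "has_second_derivative g g2"
  shows "has_second_derivative (\<lambda>x. f x + g x) (\<lambda>x. f2 x + g2 x)"
proof -
  obtain f1 g1 where
    "\<forall>x. (f has_vector_derivative f1 x) (at x) \<and> (f1 has_vector_derivative f2 x) (at x)"
    "\<forall>x. (g has_vector_derivative g1 x) (at x) \<and> (g1 has_vector_derivative g2 x) (at x)"
    using assms unfolding has_second_derivative_def by blast
  then show ?thesis
    unfolding has_second_derivative_def
    by (intro exI[of _ "\<lambda>x. f1 x + g1 x"]) (auto intro: has_vector_derivative_add)
qed

text \<open>The inverse of \<open>\<H>\<close> is multiplied out, so that a vanishing value of the
  transform gives a zero second derivative of the coefficient instead of a quotient. The velocity
  \<open>vt\<close> is explicit because both the energy and the error norm involve it.\<close>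

definition scheme_curve ::
  "real \<Rightarrow> (real \<Rightarrow> real) \<Rightarrow> (real \<Rightarrow> real) \<Rightarrow> (real \<Rightarrow> real) \<Rightarrow> (real \<Rightarrow> real) \<Rightarrow>
   real \<Rightarrow> nat \<Rightarrow> (real \<Rightarrow> real \<Rightarrow> complex) \<Rightarrow> (real \<Rightarrow> real \<Rightarrow> complex) \<Rightarrow> bool" where
  "scheme_curve L \<beta> g \<phi> \<psi> T N v vt \<longleftrightarrow>
    v 0 = P_proj L N (\<lambda>x. of_real (\<phi> x)) \<and> vt 0 = P_proj L N (\<lambda>x. of_real (\<psi> x)) \<and>
    (\<forall>t\<in>{0..T}. v t \<in> S_space L N \<and> vt t \<in> S_space L N \<and> (\<forall>k\<in>freq_range N.
      ((\<lambda>\<tau>. fourier_coeff L (v \<tau>) k) has_vector_derivative fourier_coeff L (vt t) k) (at t within {0..T}) \<and>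
      ((\<lambda>\<tau>. fourier_coeff L (vt \<tau>) k) has_vector_derivative
        - of_real (dispersion L \<beta> k) * (fourier_coeff L (v t) k + fourier_coeff L (\<lambda>x. of_real (g (Re (v t x)))) k))
        (at t within {0..T})))"

lemma scheme_solution_imp_curve:
  assumes "L > 0" "N > 0" "T > 0" and scheme: "scheme_solution L \<beta> g \<phi> \<psi> T N v"
    and real: "\<And>k. fourier_transform \<beta> k \<in> \<real>"
  obtains vt where "scheme_curve L \<beta> g \<phi> \<psi> T N v vt"
proof -
  obtain vt vtt where S: "\<forall>t\<in>{0..T}. v t \<in> S_space L N \<and>
        (\<forall>x. ((\<lambda>\<tau>. v \<tau> x) has_vector_derivative vt t x) (at t within {0..T})) \<and>
        (\<forall>x. ((\<lambda>\<tau>. vt \<tau> x) has_vector_derivative vtt t x) (at t within {0..T})) \<and>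
        (\<exists>vxx gxx. has_second_derivative (v t) vxx \<and>
           has_second_derivative (P_proj L N (\<lambda>x. complex_of_real (g (Re (v t x))))) gxx \<and>
           is_H_inverse L \<beta> (vtt t) (\<lambda>x. vxx x + gxx x))"
    "v 0 = P_proj L N (\<lambda>x. of_real (\<phi> x))" "vt 0 = P_proj L N (\<lambda>x. of_real (\<psi> x))"
    using scheme unfolding scheme_solution_def by blast
  have v: "v t \<in> S_space L N" if "t \<in> {0..T}" for t using S(1) that by blast
  have dv: "((\<lambda>\<tau>. v \<tau> x) has_vector_derivative vt t x) (at t within {0..T})" if "t \<in> {0..T}" for t x
    using S(1) that by blast
  have dvt: "((\<lambda>\<tau>. vt \<tau> x) has_vector_derivative vtt t x) (at t within {0..T})" if "t \<in> {0..T}" for t x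
    using S(1) that by blast
  have vt: "vt t \<in> S_space L N" if "t \<in> {0..T}" for t
    by (rule S_space_curve_derivative(1)[OF assms(1-3) v dv that])
  have eq: "fourier_coeff L (vtt t) k
      = - of_real (dispersion L \<beta> k) * (fourier_coeff L (v t) k + fourier_coeff L (\<lambda>x. of_real (g (Re (v t x)))) k)"
    if t: "t \<in> {0..T}" and k: "k \<in> freq_range N" for t k
  proof -
    let ?G = "\<lambda>x. complex_of_real (g (Re (v t x)))"
    define P where "P = P_proj L N ?G"
    obtain vxx gxx where d: "has_second_derivative (v t) vxx" "has_second_derivative P gxx"
      and H: "is_H_inverse L \<beta> (vtt t) (\<lambda>x. vxx x + gxx x)"
      using S(1) t unfolding P_def by blast
    define w where "w x = vxx x + gxx x" for x
    have P: "P \<in> S_space L N" unfolding P_def by (rule P_proj_in_S_space)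
    have w: "has_second_derivative (\<lambda>x. v t x + P x) w"
      unfolding w_def[abs_def] by (rule has_second_derivative_add[OF d])
    have Hw: "w \<in> Hp L 0" using H by (simp add: is_H_inverse_def w_def[abs_def])
    have "fourier_coeff L w k = - of_real ((of_int k * pi / L)\<^sup>2) * fourier_coeff L (\<lambda>x. v t x + P x) k"
      by (rule fourier_coeff_second_derivative[OF assms(1) w _ HpD(5)[OF Hw]])
        (simp only: S_space_periodic[OF assms(1) v[OF t]] S_space_periodic[OF assms(1) P])
    also have "fourier_coeff L (\<lambda>x. v t x + P x) k = fourier_coeff L (v t) k + fourier_coeff L ?G k"
      using fourier_coeff_add[OF S_space_integrable[OF v[OF t]] S_space_integrable[OF P]] k
      by (simp add: P_def fourier_coeff_P_proj[OF assms(1)])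
    finally have wk: "fourier_coeff L w k
      = - of_real ((of_int k * pi / L)\<^sup>2) * (fourier_coeff L (v t) k + fourier_coeff L ?G k)" .
    define b where "b = fourier_transform \<beta> (of_int k * pi / L)"
    have b: "b = of_real (Re b)" using real unfolding b_def by (simp add: of_real_Re)
    have Hk: "if b = 0 then fourier_coeff L (vtt t) k = 0 else fourier_coeff L w k = fourier_coeff L (vtt t) k / b"
      using H unfolding is_H_inverse_def Let_def b_def w_def[abs_def] by blast
    \<comment> \<open>If \<open>b = 0\<close>, the first branch of \<open>is_H_inverse\<close> makes
      the left side 0 too; otherwise the quotient is multiplied by \<open>b\<close>.\<close>
    have "fourier_coeff L (vtt t) k = b * fourier_coeff L w k"
      using Hk by (auto split: if_splits)
    also have "\<dots> = of_real (Re b) * fourier_coeff L w k" using b by simp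
    finally show ?thesis unfolding wk dispersion_def b_def[symmetric] by (simp add: mult_ac)
  qed
  have "scheme_curve L \<beta> g \<phi> \<psi> T N v vt"
    unfolding scheme_curve_def
  proof (intro conjI ballI)
    fix t k assume tk: "t \<in> {0..T}" "k \<in> freq_range N"
    show "((\<lambda>\<tau>. fourier_coeff L (v \<tau>) k) has_vector_derivative fourier_coeff L (vt t) k) (at t within {0..T})"
      by (rule S_space_curve_derivative(2)[OF assms(1-3) v dv tk])
    show "((\<lambda>\<tau>. fourier_coeff L (vt \<tau>) k) has_vector_derivative
        - of_real (dispersion L \<beta> k) * (fourier_coeff L (v t) k + fourier_coeff L (\<lambda>x. of_real (g (Re (v t x)))) k))
        (at t within {0..T})"
      unfolding eq[OF tk, symmetric] by (rule S_space_curve_derivative(2)[OF assms(1-3) vt dvt tk])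
  qed (use S(2,3) v vt in auto)
  then show thesis by (rule that)
qed

lemma S_space_cmod_le:
  assumes "L > 0" "f \<in> S_space L N"
  shows "cmod (f x) \<le> (\<Sum>k\<in>freq_range N. cmod (fourier_coeff L f k))"
proof -
  have "cmod (f x) = cmod (\<Sum>k\<in>freq_range N. fourier_coeff L f k * mode L k x)"
    using fun_cong[OF S_space_expansion(1)[OF assms], of x] by (rule arg_cong)
  also have "\<dots> \<le> (\<Sum>k\<in>freq_range N. cmod (fourier_coeff L f k))"
    by (rule order_trans[OF norm_sum]) (simp add: norm_mult)
  finally show ?thesis .
qed

lemma S_space_subset_Hp:
  assumes "L > 0" "f \<in> S_space L N"
  shows "f \<in> Hp L s"
proof -
  have "(\<lambda>x. (cmod (f x))\<^sup>2) \<in> borel_measurable borel" using S_space_measurable[OF assms(2)] by measurable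
  moreover have "(cmod (f x))\<^sup>2 \<le> (\<Sum>k\<in>freq_range N. cmod (fourier_coeff L f k))\<^sup>2" for x
  proof (rule power_mono)
    show "cmod (f x) \<le> (\<Sum>k\<in>freq_range N. cmod (fourier_coeff L f k))"
      by (rule S_space_cmod_le[OF assms])
  qed simp
  ultimately have "integrable (period_measure L) (\<lambda>x. (cmod (f x))\<^sup>2)"
    by (intro integrable_period_bounded[where B = "(\<Sum>k\<in>freq_range N. cmod (fourier_coeff L f k))\<^sup>2"]) auto
  moreover have "(\<lambda>k. Hp_weight s k * (cmod (fourier_coeff L f k))\<^sup>2) summable_on UNIV"
  proof -
    have "(\<lambda>k. Hp_weight s k * (cmod (fourier_coeff L f k))\<^sup>2) summable_on freq_range N" by simp
    then show ?thesis
      by (rule summable_on_cong_neutral[THEN iffD1, rotated -1]) (use S_space_expansion(2)[OF assms] in auto)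
  qed
  ultimately show ?thesis
    using assms S_space_periodic[OF assms] S_space_measurable[OF assms(2)] by (simp add: Hp_def set_integrable_period)
qed

lemma Hp_norm_S_space:
  assumes "\<And>k. k \<notin> K \<Longrightarrow> fourier_coeff L f k = 0" "finite K"
  shows "Hp_norm L s f = sqrt (\<Sum>k\<in>K. Hp_weight s k * (cmod (fourier_coeff L f k))\<^sup>2)"
proof -
  have "(\<Sum>\<^sub>\<infinity>k. Hp_weight s k * (cmod (fourier_coeff L f k))\<^sup>2)
      = (\<Sum>\<^sub>\<infinity>k\<in>K. Hp_weight s k * (cmod (fourier_coeff L f k))\<^sup>2)"
    by (rule infsum_cong_neutral) (use assms in auto)
  then show ?thesis using assms(2) by (simp add: Hp_norm_def)
qed

text \<open>Within the band the Sobolev norm is a finite weighted sum, so convergence of each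
  coefficient is convergence in norm, for every \<open>s\<close>.\<close>

lemma S_space_has_Hp_derivative:
  assumes "L > 0" and f: "\<And>t. t \<in> {0..T} \<Longrightarrow> f t \<in> S_space L N" and t: "t \<in> {0..T}" and D: "D \<in> S_space L N"
    and der: "\<And>k. k \<in> freq_range N \<Longrightarrow>
      ((\<lambda>\<tau>. fourier_coeff L (f \<tau>) k) has_vector_derivative fourier_coeff L D k) (at t within {0..T})"
  shows "has_Hp_derivative L s T f D t"
  unfolding has_Hp_derivative_def
proof
  show "D \<in> Hp L s" by (rule S_space_subset_Hp[OF assms(1) D])
  let ?q = "\<lambda>k \<tau>. (1 / (\<tau> - t)) *\<^sub>R (fourier_coeff L (f \<tau>) k - fourier_coeff L (f t) k) - fourier_coeff L D k"
  have "((\<lambda>\<tau>. sqrt (\<Sum>k\<in>freq_range N. Hp_weight s k * (cmod (?q k \<tau>))\<^sup>2)) \<longlongrightarrow>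
      sqrt (\<Sum>k\<in>freq_range N. Hp_weight s k * (cmod 0)\<^sup>2)) (at t within {0..T})"
    using der unfolding has_vector_derivative_quotient
    by (intro tendsto_real_sqrt tendsto_sum tendsto_mult tendsto_const tendsto_power tendsto_norm) auto
  moreover have "Hp_norm L s (\<lambda>x. (1 / (\<tau> - t)) *\<^sub>R (f \<tau> x - f t x) - D x)
      = sqrt (\<Sum>k\<in>freq_range N. Hp_weight s k * (cmod (?q k \<tau>))\<^sup>2)" if \<tau>: "\<tau> \<in> {0..T}" for \<tau>
  proof -
    note i = S_space_integrable[OF f[OF \<tau>]] S_space_integrable[OF f[OF t]] S_space_integrable[OF D]
    have "fourier_coeff L (\<lambda>x. (1 / (\<tau> - t)) *\<^sub>R (f \<tau> x - f t x) - D x) k = ?q k \<tau>" for k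
      by (rule fourier_coeff_quotient_diff[OF i])
    then show ?thesis
      using S_space_expansion(2)[OF assms(1) f[OF \<tau>]] S_space_expansion(2)[OF assms(1) f[OF t]]
        S_space_expansion(2)[OF assms(1) D]
      by (subst Hp_norm_S_space[where K = "freq_range N"]) auto
  qed
  then have "\<forall>\<^sub>F \<tau> in at t within {0..T}. sqrt (\<Sum>k\<in>freq_range N. Hp_weight s k * (cmod (?q k \<tau>))\<^sup>2)
      = Hp_norm L s (\<lambda>x. (1 / (\<tau> - t)) *\<^sub>R (f \<tau> x - f t x) - D x)"
    by (simp add: eventually_at_filter)
  ultimately show "((\<lambda>\<tau>. Hp_norm L s (\<lambda>x. (1 / (\<tau> - t)) *\<^sub>R (f \<tau> x - f t x) - D x)) \<longlongrightarrow> 0) (at t within {0..T})"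
    by (simp add: tendsto_cong)
qed

section \<open>Time evolution of the Fourier coefficients\<close>

lemma has_Hp_derivative_mono:
  assumes "has_Hp_derivative L s T u D t" "s' \<le> s" "\<And>\<tau>. \<tau> \<in> {0..T} \<Longrightarrow> u \<tau> \<in> Hp L s" "t \<in> {0..T}"
  shows "has_Hp_derivative L s' T u D t"
  unfolding has_Hp_derivative_def
proof
  have D: "D \<in> Hp L s"
    and lim: "((\<lambda>\<tau>. Hp_norm L s (\<lambda>x. (1 / (\<tau> - t)) *\<^sub>R (u \<tau> x - u t x) - D x)) \<longlongrightarrow> 0) (at t within {0..T})"
    using assms(1) by (auto simp: has_Hp_derivative_def)
  show "D \<in> Hp L s'" by (rule Hp_mono(1)[OF D assms(2)])
  show "((\<lambda>\<tau>. Hp_norm L s' (\<lambda>x. (1 / (\<tau> - t)) *\<^sub>R (u \<tau> x - u t x) - D x)) \<longlongrightarrow> 0) (at t within {0..T})"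
  proof (rule Lim_null_comparison[OF _ lim], unfold eventually_at_filter, intro always_eventually allI impI)
    fix \<tau> assume "\<tau> \<in> {0..T}"
    then have "(\<lambda>x. (1 / (\<tau> - t)) *\<^sub>R (u \<tau> x - u t x) - D x) \<in> Hp L s"
      by (intro Hp_diff Hp_scaleR assms(3,4) D)
    from Hp_mono(2)[OF this assms(2)]
    show "norm (Hp_norm L s' (\<lambda>x. (1 / (\<tau> - t)) *\<^sub>R (u \<tau> x - u t x) - D x))
        \<le> Hp_norm L s (\<lambda>x. (1 / (\<tau> - t)) *\<^sub>R (u \<tau> x - u t x) - D x)"
      by simp
  qed
qed

lemma has_Hp_derivative_diff:
  assumes u: "has_Hp_derivative L s T u D t" and v: "has_Hp_derivative L s T v E t"
    and "\<And>\<tau>. \<tau> \<in> {0..T} \<Longrightarrow> u \<tau> \<in> Hp L s" "\<And>\<tau>. \<tau> \<in> {0..T} \<Longrightarrow> v \<tau> \<in> Hp L s" "t \<in> {0..T}"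
  shows "has_Hp_derivative L s T (\<lambda>\<tau> x. u \<tau> x - v \<tau> x) (\<lambda>x. D x - E x) t"
  unfolding has_Hp_derivative_def
proof
  let ?a = "\<lambda>\<tau> x. (1 / (\<tau> - t)) *\<^sub>R (u \<tau> x - u t x) - D x"
  let ?b = "\<lambda>\<tau> x. (1 / (\<tau> - t)) *\<^sub>R (v \<tau> x - v t x) - E x"
  let ?c = "\<lambda>\<tau> x. (1 / (\<tau> - t)) *\<^sub>R (u \<tau> x - v \<tau> x - (u t x - v t x)) - (D x - E x)"
  have D: "D \<in> Hp L s" and a: "((\<lambda>\<tau>. Hp_norm L s (?a \<tau>)) \<longlongrightarrow> 0) (at t within {0..T})"
    using u by (auto simp: has_Hp_derivative_def)
  have E: "E \<in> Hp L s" and b: "((\<lambda>\<tau>. Hp_norm L s (?b \<tau>)) \<longlongrightarrow> 0) (at t within {0..T})"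
    using v by (auto simp: has_Hp_derivative_def)
  show "(\<lambda>x. D x - E x) \<in> Hp L s" by (rule Hp_diff[OF D E])
  have "((\<lambda>\<tau>. sqrt (2 * (Hp_norm L s (?a \<tau>))\<^sup>2 + 2 * (Hp_norm L s (?b \<tau>))\<^sup>2)) \<longlongrightarrow> sqrt (2 * 0\<^sup>2 + 2 * 0\<^sup>2)) (at t within {0..T})"
    by (intro tendsto_intros a b)
  then have lim: "((\<lambda>\<tau>. sqrt (2 * (Hp_norm L s (?a \<tau>))\<^sup>2 + 2 * (Hp_norm L s (?b \<tau>))\<^sup>2)) \<longlongrightarrow> 0) (at t within {0..T})"
    by simp
  show "((\<lambda>\<tau>. Hp_norm L s (?c \<tau>)) \<longlongrightarrow> 0) (at t within {0..T})"
  proof (rule Lim_null_comparison[OF _ lim], unfold eventually_at_filter, intro always_eventually allI impI)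
    fix \<tau> assume \<tau>: "\<tau> \<in> {0..T}"
    have "?a \<tau> \<in> Hp L s" "?b \<tau> \<in> Hp L s"
      using \<tau> by (intro Hp_diff Hp_scaleR assms(3,4,5) D E; assumption)+
    from Hp_norm_diff_power2_le[OF this]
    have "(Hp_norm L s (\<lambda>x. ?a \<tau> x - ?b \<tau> x))\<^sup>2 \<le> 2 * (Hp_norm L s (?a \<tau>))\<^sup>2 + 2 * (Hp_norm L s (?b \<tau>))\<^sup>2" .
    moreover have "(\<lambda>x. ?a \<tau> x - ?b \<tau> x) = ?c \<tau>"
      by (simp add: scaleR_right_diff_distrib algebra_simps)
    ultimately show "norm (Hp_norm L s (?c \<tau>)) \<le> sqrt (2 * (Hp_norm L s (?a \<tau>))\<^sup>2 + 2 * (Hp_norm L s (?b \<tau>))\<^sup>2)"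
      by (simp add: real_le_rsqrt)
  qed
qed

text \<open>\<open>Hp_deriv\<close> picks an arbitrary representative, separately for each exponent.
  Coefficients do not see the choice, which lets the derivative chosen for the error at order
  \<open>\<sigma>\<close> be replaced by the difference of the derivatives of \<open>u\<close> and
  of the discrete solution.\<close>

lemma has_Hp_derivative_coeff_unique:
  assumes "0 \<le> s" "0 < T" "\<And>\<tau>. \<tau> \<in> {0..T} \<Longrightarrow> u \<tau> \<in> Hp L s" "t \<in> {0..T}"
    and "has_Hp_derivative L s T u D t" "has_Hp_derivative L s T u E t"
  shows "fourier_coeff L D k = fourier_coeff L E k"
  using vector_derivative_unique_within_closed_interval[of 0 T t "\<lambda>\<tau>. fourier_coeff L (u \<tau>) k"]
    fourier_coeff_has_vector_derivative[OF assms(1,3,4,5), of k]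
    fourier_coeff_has_vector_derivative[OF assms(1,3,4,6), of k] assms(2,4)
  by (simp add: cbox_interval)

lemma integrable_bounded_comp:
  fixes g :: "real \<Rightarrow> real"
  assumes "C2_real g" "a \<in> borel_measurable borel" "AE x in period_measure L. cmod (a x) \<le> R"
  shows "integrable (period_measure L) (\<lambda>x. g (Re (a x)))"
proof -
  obtain M where M: "0 \<le> M" "\<And>x y. \<bar>x\<bar> \<le> R \<Longrightarrow> \<bar>y\<bar> \<le> R \<Longrightarrow> \<bar>g x - g y\<bar> \<le> M * \<bar>x - y\<bar>"
    using C2_real_imp_locally_lipschitz[OF assms(1)] by blast
  have [measurable]: "g \<in> borel_measurable borel" by (rule C2_real_imp_measurable[OF assms(1)])
  show ?thesis
  proof (rule integrable_period_bounded[where B = "\<bar>g 0\<bar> + M * R"])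
    show "(\<lambda>x. g (Re (a x))) \<in> borel_measurable borel" using assms(2) by measurable
    show "AE x in period_measure L. norm (g (Re (a x))) \<le> \<bar>g 0\<bar> + M * R"
      using assms(3)
    proof eventually_elim
      case (elim x)
      have 1: "\<bar>Re (a x)\<bar> \<le> R" using abs_Re_le_cmod[of "a x"] elim by linarith
      then have "\<bar>g (Re (a x)) - g 0\<bar> \<le> M * \<bar>Re (a x)\<bar>" using M(2)[of "Re (a x)" 0] by simp
      also have "\<dots> \<le> M * R" using 1 M(1) by (intro mult_left_mono)
      finally show ?case by simp
    qed
  qed
qed

lemma Hp_bounded:
  assumes "L > 0" "v \<in> Hp L s" "1 \<le> s"
  shows "AE x in period_measure L. cmod (v x) \<le> inverse_square_sum + (Hp_norm L s v)\<^sup>2"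
  using abs_summable_fourier(3)[OF assms(1) HpD(5)[OF assms(2)] Hp_abs_summable(1)[OF assms(2,3)]]
    Hp_abs_summable(2)[OF assms(2,3)]
  by (auto elim: eventually_mono)

lemma AE_lborel_imp_AE_period: "AE x in lborel. P x \<Longrightarrow> AE x in period_measure L. P x"
  by (simp add: AE_restrict_space_iff eventually_mono)

text \<open>Transfers the initial value problem to coefficients. The second time derivative is given
  in \<open>Hp L 0\<close>, which suffices to differentiate each coefficient; the space derivatives
  lie on the convolution, whose coefficients are those of \<open>u + g(u)\<close> times the
  transform of \<open>\<beta>\<close>.\<close>

lemma ivp_solution_coeff:
  assumes L: "L > 0" and T: "T > 0" and s: "1 \<le> s" and \<beta>: "integrable lborel \<beta>"
    and real: "\<And>k. fourier_transform \<beta> k \<in> \<real>" and g: "C2_real g"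
    and \<phi>: "(\<lambda>x. complex_of_real (\<phi> x)) \<in> Hp L s" and \<psi>: "(\<lambda>x. complex_of_real (\<psi> x)) \<in> Hp L s"
    and ivp: "ivp_solution L \<beta> g \<phi> \<psi> s T u"
  defines "U \<equiv> \<lambda>t x. complex_of_real (u t x)"
  defines "Ut \<equiv> Hp_deriv L s T U"
  shows "U \<in> X_space L s T"
    and "fourier_coeff L (U 0) k = fourier_coeff L (\<lambda>x. of_real (\<phi> x)) k"
    and "fourier_coeff L (Ut 0) k = fourier_coeff L (\<lambda>x. of_real (\<psi> x)) k"
    and "t \<in> {0..T} \<Longrightarrow>
      ((\<lambda>\<tau>. fourier_coeff L (U \<tau>) k) has_vector_derivative fourier_coeff L (Ut t) k) (at t within {0..T})"
    and "t \<in> {0..T} \<Longrightarrow>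
      ((\<lambda>\<tau>. fourier_coeff L (Ut \<tau>) k) has_vector_derivative
        - of_real (dispersion L \<beta> k) * (fourier_coeff L (U t) k + fourier_coeff L (\<lambda>x. of_real (g (Re (U t x)))) k))
        (at t within {0..T})"
proof -
  have X: "U \<in> X_space L s T" and i1: "AE x in lborel. u 0 x = \<phi> x"
    and i2: "AE x in lborel. Ut 0 x = complex_of_real (\<psi> x)"
    and eq: "\<forall>t\<in>{0..T}. \<exists>w. has_second_derivative (convolution \<beta> (\<lambda>x. u t x + g (u t x))) w \<and>
         has_Hp_derivative L 0 T Ut (\<lambda>x. complex_of_real (w x)) t"
    using ivp by (simp_all add: ivp_solution_def Let_def U_def Ut_def)
  note XD = X_spaceD[OF X, folded Ut_def]
  show "U \<in> X_space L s T" by (rule X)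
  have T0: "0 \<in> {0..T}" using T by simp
  show "fourier_coeff L (U 0) k = fourier_coeff L (\<lambda>x. of_real (\<phi> x)) k"
  proof (rule fourier_coeff_cong_AE)
    show "AE x in period_measure L. U 0 x = of_real (\<phi> x)"
      by (rule AE_lborel_imp_AE_period) (use i1 in \<open>simp add: U_def\<close>)
  qed (intro measurable_period HpD(2)[OF XD(1)[OF T0]] HpD(2)[OF \<phi>])+
  show "fourier_coeff L (Ut 0) k = fourier_coeff L (\<lambda>x. of_real (\<psi> x)) k"
    by (rule fourier_coeff_cong_AE[OF AE_lborel_imp_AE_period[OF i2]])
      (intro measurable_period HpD(2)[OF XD(3)[OF T0]] HpD(2)[OF \<psi>])+
  show "((\<lambda>\<tau>. fourier_coeff L (U \<tau>) k) has_vector_derivative fourier_coeff L (Ut t) k) (at t within {0..T})"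
    if t: "t \<in> {0..T}"
    using s by (intro fourier_coeff_has_vector_derivative[OF _ XD(1) t XD(2)[OF t]]) auto
  show "((\<lambda>\<tau>. fourier_coeff L (Ut \<tau>) k) has_vector_derivative
        - of_real (dispersion L \<beta> k) * (fourier_coeff L (U t) k + fourier_coeff L (\<lambda>x. of_real (g (Re (U t x)))) k))
        (at t within {0..T})" if t: "t \<in> {0..T}"
  proof -
    define f where "f x = u t x + g (u t x)" for x
    define b where "b = fourier_transform \<beta> (of_int k * pi / L)"
    obtain w where w: "has_second_derivative (convolution \<beta> f) w"
      and wH: "has_Hp_derivative L 0 T Ut (\<lambda>x. complex_of_real (w x)) t"
      using eq t unfolding f_def[abs_def] by blast
    have wHp: "(\<lambda>x. complex_of_real (w x)) \<in> Hp L 0" using wH by (simp add: has_Hp_derivative_def)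
    have Ut0: "Ut \<tau> \<in> Hp L 0" if "\<tau> \<in> {0..T}" for \<tau>
      using Hp_mono(1)[OF XD(3)[OF that], of 0] s by simp
    have der: "((\<lambda>\<tau>. fourier_coeff L (Ut \<tau>) k) has_vector_derivative fourier_coeff L (\<lambda>x. of_real (w x)) k) (at t within {0..T})"
      by (rule fourier_coeff_has_vector_derivative[OF _ Ut0 t wH]) auto
    note Ut' = HpD[OF XD(1)[OF t]]
    have uper: "u t (x + 2 * L) = u t x" for x using Ut'(1)[of x] by (simp add: U_def)
    have umeas[measurable]: "u t \<in> borel_measurable borel"
    proof -
      have "(\<lambda>x. Re (U t x)) \<in> borel_measurable borel" using Ut'(2) by measurable
      then show ?thesis by (simp add: U_def)
    qed
    have gm[measurable]: "g \<in> borel_measurable borel" by (rule C2_real_imp_measurable[OF g])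
    have iu: "integrable (period_measure L) (u t)"
      using integrable_Re[OF Ut'(5)] by (simp add: U_def)
    \<comment> \<open>\<open>u t\<close> is bounded almost everywhere because
      \<open>s \<ge> 1\<close>, and \<open>g\<close> is bounded on bounded sets.\<close>
    have ig: "integrable (period_measure L) (\<lambda>x. g (u t x))"
      using integrable_bounded_comp[OF g Ut'(2) Hp_bounded[OF L XD(1)[OF t] s]] by (simp add: U_def)
    have if': "integrable (period_measure L) f" unfolding f_def[abs_def] using iu ig by simp
    have fper: "f (x + 2 * L) = f x" for x by (simp add: f_def uper)
    have fm: "f \<in> borel_measurable borel" unfolding f_def[abs_def] by measurable
    have w': "has_second_derivative (\<lambda>x. complex_of_real (convolution \<beta> f x)) (\<lambda>x. complex_of_real (w x))"
    proof -
      obtain h where "\<forall>x. (convolution \<beta> f has_vector_derivative h x) (at x) \<and> (h has_vector_derivative w x) (at x)"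
        using w unfolding has_second_derivative_def by blast
      then show ?thesis
        unfolding has_second_derivative_def
        by (intro exI[of _ "\<lambda>x. complex_of_real (h x)"]) (auto intro: bounded_linear.has_vector_derivative[OF bounded_linear_of_real])
    qed
    have "fourier_coeff L (\<lambda>x. of_real (w x)) k
        = - of_real ((of_int k * pi / L)\<^sup>2) * fourier_coeff L (\<lambda>x. of_real (convolution \<beta> f x)) k"
      by (rule fourier_coeff_second_derivative[OF L w' _ HpD(5)[OF wHp]])
        (simp add: convolution_periodic[of f, OF fper])
    also have "fourier_coeff L (\<lambda>x. of_real (convolution \<beta> f x)) k = b * fourier_coeff L (\<lambda>x. of_real (f x)) k"
      unfolding b_def by (rule fourier_coeff_convolution[OF L \<beta> fper fm if'])
    also have "fourier_coeff L (\<lambda>x. of_real (f x)) k = fourier_coeff L (U t) k + fourier_coeff L (\<lambda>x. of_real (g (Re (U t x)))) k"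
      unfolding f_def of_real_add U_def Re_complex_of_real
      by (rule fourier_coeff_add) (use iu ig in simp_all)
    also have "b = of_real (Re b)" using real unfolding b_def by (simp add: of_real_Re)
    finally have "fourier_coeff L (\<lambda>x. of_real (w x)) k
      = - of_real (dispersion L \<beta> k) * (fourier_coeff L (U t) k + fourier_coeff L (\<lambda>x. of_real (g (Re (U t x)))) k)"
      unfolding dispersion_def b_def[symmetric] by (simp add: mult_ac)
    with der show ?thesis by simp
  qed
qed

section \<open>Weights inside and outside the band, size of the dispersion\<close>

text \<open>In the band \<open>\<bar>k\<bar> \<le> N / 2\<close>, and \<open>N \<ge> 2\<close>
  absorbs the 1 of the weight: \<open>1 + k\<^sup>2 \<le> N\<^sup>2\<close>. This is the source of
  the inverse inequality.\<close>

lemma freq_range_weight: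
  assumes "even N" "N > 0" "0 \<le> s" "k \<in> freq_range N"
  shows "Hp_weight s k \<le> real N powr (2 * s)"
proof -
  have "\<bar>2 * k\<bar> \<le> int N" using assms(1,4) by (auto simp: freq_range_def)
  then have "\<bar>2 * real_of_int k\<bar> \<le> real N" by linarith
  then have "\<bar>2 * real_of_int k\<bar>\<^sup>2 \<le> (real N)\<^sup>2" by (intro power_mono) auto
  then have "(2 * real_of_int k)\<^sup>2 \<le> (real N)\<^sup>2" by (simp only: power2_abs)
  moreover have "2 \<le> real N" using assms(1,2) by (auto elim!: evenE)
  then have "2\<^sup>2 \<le> (real N)\<^sup>2" by (intro power_mono) auto
  ultimately have "1 + (real_of_int k)\<^sup>2 \<le> (real N)\<^sup>2" by (simp add: power_mult_distrib)
  then have "Hp_weight s k \<le> ((real N)\<^sup>2) powr s" by (intro powr_mono2 assms(3)) auto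
  also have "(real N)\<^sup>2 = real N powr 2" using assms(2) by simp
  finally show ?thesis by (simp only: powr_powr)
qed

text \<open>For even \<open>N\<close> every missing frequency satisfies
  \<open>\<bar>k\<bar> \<ge> N / 2\<close>, with equality at \<open>k = N / 2\<close>; the exponent
  \<open>\<sigma> - s\<close> is nonpositive, so that power of \<open>1 + k\<^sup>2\<close> is at
  most the same power of \<open>(N / 2)\<^sup>2\<close>.\<close>

lemma freq_range_compl_weight:
  assumes "even N" "N > 0" "\<sigma> \<le> s" "k \<notin> freq_range N"
  shows "Hp_weight \<sigma> k \<le> (real N / 2) powr (2 * \<sigma> - 2 * s) * Hp_weight s k"
proof -
  have "int N \<le> \<bar>2 * k\<bar>" using assms(1,4) by (auto simp: freq_range_def)
  then have "real N / 2 \<le> \<bar>real_of_int k\<bar>" by linarith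
  then have "(real N / 2)\<^sup>2 \<le> \<bar>real_of_int k\<bar>\<^sup>2" by (intro power_mono) auto
  then have "(real N / 2)\<^sup>2 \<le> 1 + (real_of_int k)\<^sup>2" by simp
  then have "(1 + (real_of_int k)\<^sup>2) powr (\<sigma> - s) \<le> ((real N / 2)\<^sup>2) powr (\<sigma> - s)"
    using assms(2,3) by (intro powr_mono2') auto
  also have "(real N / 2)\<^sup>2 = (real N / 2) powr 2" using assms(2) by simp
  finally have "(1 + (real_of_int k)\<^sup>2) powr (\<sigma> - s) \<le> (real N / 2) powr (2 * (\<sigma> - s))"
    by (simp only: powr_powr)
  then have "(1 + (real_of_int k)\<^sup>2) powr (\<sigma> - s) * Hp_weight s k \<le> (real N / 2) powr (2 * (\<sigma> - s)) * Hp_weight s k"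
    by (intro mult_right_mono) auto
  then show ?thesis by (simp add: powr_add[symmetric] right_diff_distrib)
qed

text \<open>The factor \<open>\<xi>\<^sup>2\<close> of two space derivatives is absorbed by one
  power of \<open>1 + \<xi>\<^sup>2\<close>, which the decay of the transform provides because
  \<open>r / 2 \<ge> 1\<close>.\<close>

lemma dispersion_bounds:
  assumes "C0 > 0" "r \<ge> 2"
    and "\<And>k. 0 \<le> Re (fourier_transform \<beta> k) \<and> Re (fourier_transform \<beta> k) \<le> C0 * (1 + k\<^sup>2) powr (- r / 2)"
  shows "0 \<le> dispersion L \<beta> k" "dispersion L \<beta> k \<le> C0"
proof -
  define \<xi> where "\<xi> = of_int k * pi / L"
  show "0 \<le> dispersion L \<beta> k" unfolding dispersion_def using assms(3) by (intro mult_nonneg_nonneg) auto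
  have "dispersion L \<beta> k \<le> \<xi>\<^sup>2 * (C0 * (1 + \<xi>\<^sup>2) powr (- r / 2))"
    unfolding dispersion_def \<xi>_def[symmetric] using assms(3) by (intro mult_left_mono) auto
  also have "\<dots> \<le> (1 + \<xi>\<^sup>2) * (C0 * (1 + \<xi>\<^sup>2) powr (- 1))"
    using assms(1,2) by (intro mult_mono mult_left_mono powr_mono) auto
  also have "\<dots> = C0"
  proof -
    have "1 + \<xi>\<^sup>2 > 0" by (simp add: add_pos_nonneg)
    then show ?thesis by (simp add: powr_minus field_simps)
  qed
  finally show "dispersion L \<beta> k \<le> C0" .
qed

section \<open>Error of the Galerkin scheme\<close>

lemma scheme_curve_initial:
  assumes "L > 0" "scheme_curve L \<beta> g \<phi> \<psi> T N v vt" "k \<in> freq_range N"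
  shows "fourier_coeff L (v 0) k = fourier_coeff L (\<lambda>x. of_real (\<phi> x)) k"
    and "fourier_coeff L (vt 0) k = fourier_coeff L (\<lambda>x. of_real (\<psi> x)) k"
  using assms(2,3) by (simp_all add: scheme_curve_def fourier_coeff_P_proj[OF assms(1)])

lemma S_space_abs_summable:
  assumes "L > 0" "f \<in> S_space L N"
  shows "(\<lambda>k. cmod (fourier_coeff L f k)) summable_on UNIV"
proof -
  have "(\<lambda>k. cmod (fourier_coeff L f k)) summable_on freq_range N" by simp
  then show ?thesis
    by (rule summable_on_cong_neutral[THEN iffD1, rotated -1]) (use S_space_expansion(2)[OF assms] in auto)
qed

text \<open>Finitely many continuous coefficients on a compact interval. The bound may depend on
  \<open>N\<close>, which is harmless for uniqueness at a fixed \<open>N\<close>.\<close>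

lemma scheme_curve_bounded:
  assumes "L > 0" "scheme_curve L \<beta> g \<phi> \<psi> T N v vt"
  obtains R where "\<And>t x. t \<in> {0..T} \<Longrightarrow> cmod (v t x) \<le> R"
proof -
  have der: "((\<lambda>\<tau>. fourier_coeff L (v \<tau>) k) has_vector_derivative fourier_coeff L (vt t) k) (at t within {0..T})"
    if "t \<in> {0..T}" "k \<in> freq_range N" for t k
    using assms(2) that by (simp add: scheme_curve_def)
  have "continuous_on {0..T} (\<lambda>t. \<Sum>k\<in>freq_range N. cmod (fourier_coeff L (v t) k))"
    unfolding continuous_on_eq_continuous_within
    by (intro ballI continuous_sum continuous_norm has_vector_derivative_continuous[OF der])
  then have "compact ((\<lambda>t. \<Sum>k\<in>freq_range N. cmod (fourier_coeff L (v t) k)) ` {0..T})"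
    by (intro compact_continuous_image) auto
  then have "bdd_above ((\<lambda>t. \<Sum>k\<in>freq_range N. cmod (fourier_coeff L (v t) k)) ` {0..T})"
    by (intro bounded_imp_bdd_above compact_imp_bounded)
  then obtain R where R: "\<forall>y\<in>(\<lambda>t. \<Sum>k\<in>freq_range N. cmod (fourier_coeff L (v t) k)) ` {0..T}. y \<le> R"
    unfolding bdd_above_def by blast
  show thesis
  proof (rule that[of R])
    fix t x assume t: "t \<in> {0..T}"
    then have "v t \<in> S_space L N" using assms(2) by (simp add: scheme_curve_def)
    from S_space_cmod_le[OF assms(1) this, of x]
    have "cmod (v t x) \<le> (\<Sum>k\<in>freq_range N. cmod (fourier_coeff L (v t) k))" .
    also have "\<dots> \<le> R" using R t by blast
    finally show "cmod (v t x) \<le> R" .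
  qed
qed

text \<open>Both curves are bounded on the whole interval, so one Lipschitz constant serves at all
  times. The difference has zero initial data and no inhomogeneity, so the energy estimate with
  \<open>\<eta> = 0\<close> bounds it by 0.\<close>

lemma scheme_curve_unique:
  assumes L: "L > 0" and T: "T > 0" and C0: "0 \<le> C0" and g: "C2_real g"
    and disp: "\<And>k. 0 \<le> dispersion L \<beta> k" "\<And>k. dispersion L \<beta> k \<le> C0"
    and v: "scheme_curve L \<beta> g \<phi> \<psi> T N v vt" and w: "scheme_curve L \<beta> g \<phi> \<psi> T N w wt"
    and t: "t \<in> {0..T}" and k: "k \<in> freq_range N"
  shows "fourier_coeff L (v t) k = fourier_coeff L (w t) k"
    and "fourier_coeff L (vt t) k = fourier_coeff L (wt t) k"
proof -
  obtain R1 where R1: "\<And>t x. t \<in> {0..T} \<Longrightarrow> cmod (v t x) \<le> R1" using scheme_curve_bounded[OF L v] by blast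
  obtain R2 where R2: "\<And>t x. t \<in> {0..T} \<Longrightarrow> cmod (w t x) \<le> R2" using scheme_curve_bounded[OF L w] by blast
  define R where "R = max R1 R2"
  obtain M where M: "0 \<le> M" "\<And>x y. \<bar>x\<bar> \<le> R \<Longrightarrow> \<bar>y\<bar> \<le> R \<Longrightarrow> \<bar>g x - g y\<bar> \<le> M * \<bar>x - y\<bar>"
    using C2_real_imp_locally_lipschitz[OF g] by blast
  have vS: "v t \<in> S_space L N" and wS: "w t \<in> S_space L N" if "t \<in> {0..T}" for t
    using v w that by (simp_all add: scheme_curve_def)
  define p where "p k t = fourier_coeff L (v t) k - fourier_coeff L (w t) k" for k t
  define q where "q k t = fourier_coeff L (vt t) k - fourier_coeff L (wt t) k" for k t
  define h where "h k t = fourier_coeff L (\<lambda>x. of_real (g (Re (v t x)))) k - fourier_coeff L (\<lambda>x. of_real (g (Re (w t x)))) k" for k t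
  define A where "A = 1 + 2 * C0 + C0 * M\<^sup>2"
  have "(\<Sum>k\<in>freq_range N. (cmod (p k t))\<^sup>2 + (cmod (q k t))\<^sup>2) \<le> C0 * M\<^sup>2 * 0 / A * exp (A * T)"
  \<comment> \<open>The resulting bound is 0, so any positive \<open>m\<close> would do.\<close>
  proof (rule oscillator_energy_bound[where h = h and lam = "dispersion L \<beta>" and m = 1])
    fix k t assume kt: "k \<in> freq_range N" "t \<in> {0..T}"
    show "(p k has_vector_derivative q k t) (at t within {0..T})"
      unfolding p_def[abs_def] q_def using v w kt
      by (intro has_vector_derivative_diff) (simp_all add: scheme_curve_def)
    have "((\<lambda>t. fourier_coeff L (vt t) k - fourier_coeff L (wt t) k) has_vector_derivative
        - of_real (dispersion L \<beta> k) * (fourier_coeff L (v t) k + fourier_coeff L (\<lambda>x. of_real (g (Re (v t x)))) k) -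
        - of_real (dispersion L \<beta> k) * (fourier_coeff L (w t) k + fourier_coeff L (\<lambda>x. of_real (g (Re (w t x)))) k))
        (at t within {0..T})"
      using v w kt by (intro has_vector_derivative_diff) (simp_all add: scheme_curve_def)
    then show "(q k has_vector_derivative - of_real (dispersion L \<beta> k) * (p k t + h k t)) (at t within {0..T})"
      unfolding p_def q_def[abs_def] h_def by (simp add: algebra_simps)
  next
    fix k assume "k \<in> freq_range N"
    then show "p k 0 = 0" "q k 0 = 0"
      using scheme_curve_initial[OF L v] scheme_curve_initial[OF L w] by (simp_all add: p_def q_def)
  next
    fix t assume t: "t \<in> {0..T}"
    have p0: "p k t = 0" if "k \<notin> freq_range N" for k
      using S_space_expansion(2)[OF L vS[OF t] that] S_space_expansion(2)[OF L wS[OF t] that] by (simp add: p_def)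
    have "(\<Sum>k\<in>freq_range N. (cmod (h k t))\<^sup>2) \<le> M\<^sup>2 * ((\<Sum>k\<in>freq_range N. (cmod (p k t))\<^sup>2 + (cmod (q k t))\<^sup>2) + 0)"
      unfolding h_def
    proof (rule lipschitz_nonlinearity_coeff[OF L C2_real_imp_measurable[OF g] S_space_measurable[OF vS[OF t]]
        S_space_measurable[OF wS[OF t]] M(2,1)])
      show "AE x in period_measure L. cmod (v t x) \<le> R" "AE x in period_measure L. cmod (w t x) \<le> R"
        using R1[OF t] R2[OF t] by (auto simp: R_def le_max_iff_disj)
      show "(\<lambda>k. cmod (fourier_coeff L (v t) k - fourier_coeff L (w t) k)) summable_on UNIV"
        by (rule summable_on_comparison_test[OF summable_on_add[OF S_space_abs_summable[OF L vS[OF t]]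
            S_space_abs_summable[OF L wS[OF t]]]]) (auto simp: norm_triangle_ineq4)
      fix J :: "int set" assume J: "finite J"
      have "(\<Sum>k\<in>J. (cmod (p k t))\<^sup>2) = (\<Sum>k\<in>J \<inter> freq_range N. (cmod (p k t))\<^sup>2)"
        by (rule sum.mono_neutral_right[OF J]) (use p0 in auto)
      also have "\<dots> \<le> (\<Sum>k\<in>freq_range N. (cmod (p k t))\<^sup>2)" by (intro sum_mono2) auto
      also have "\<dots> \<le> (\<Sum>k\<in>freq_range N. (cmod (p k t))\<^sup>2 + (cmod (q k t))\<^sup>2)" by (intro sum_mono) auto
      finally show "(\<Sum>k\<in>J. (cmod (fourier_coeff L (v t) k - fourier_coeff L (w t) k))\<^sup>2)
          \<le> (\<Sum>k\<in>freq_range N. (cmod (p k t))\<^sup>2 + (cmod (q k t))\<^sup>2) + 0" by (simp add: p_def)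
    qed auto
    then show "(\<Sum>k\<in>freq_range N. (cmod (h k t))\<^sup>2) \<le> M\<^sup>2 * ((\<Sum>k\<in>freq_range N. (cmod (p k t))\<^sup>2 + (cmod (q k t))\<^sup>2) + 0)" .
  qed (use T C0 disp t in \<open>auto simp: A_def\<close>)
  then have "(\<Sum>k\<in>freq_range N. (cmod (p k t))\<^sup>2 + (cmod (q k t))\<^sup>2) \<le> 0" by simp
  then have "(\<Sum>k\<in>freq_range N. (cmod (p k t))\<^sup>2 + (cmod (q k t))\<^sup>2) = 0"
    by (intro antisym sum_nonneg) auto
  then have "\<forall>k\<in>freq_range N. (cmod (p k t))\<^sup>2 + (cmod (q k t))\<^sup>2 = 0"
    by (subst (asm) sum_nonneg_eq_0_iff) auto
  then have "(cmod (p k t))\<^sup>2 + (cmod (q k t))\<^sup>2 = 0" using k by blast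
  then show "fourier_coeff L (v t) k = fourier_coeff L (w t) k" "fourier_coeff L (vt t) k = fourier_coeff L (wt t) k"
    by (simp_all add: p_def q_def sum_power2_eq_zero_iff)
qed

text \<open>If \<open>b\<close> and \<open>b'\<close> lie in \<open>S_space L N\<close>, this is
  \<open>1 / (2 * L)\<close> times the sum of the squared L2 norms of \<open>P\<^sub>N a - b\<close>
  and \<open>P\<^sub>N a' - b'\<close>.\<close>

definition coeff_energy ::
  "real \<Rightarrow> nat \<Rightarrow> (real \<Rightarrow> complex) \<Rightarrow> (real \<Rightarrow> complex) \<Rightarrow> (real \<Rightarrow> complex) \<Rightarrow> (real \<Rightarrow> complex) \<Rightarrow> real" where
  "coeff_energy L N a b a' b' = (\<Sum>k\<in>freq_range N.
    (cmod (fourier_coeff L a k - fourier_coeff L b k))\<^sup>2 + (cmod (fourier_coeff L a' k - fourier_coeff L b' k))\<^sup>2)"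

lemma Hp_tail_sum:
  assumes "even N" "N > 0" "v \<in> Hp L s" "0 \<le> s" "finite J" "J \<inter> freq_range N = {}"
  shows "(\<Sum>k\<in>J. (cmod (fourier_coeff L v k))\<^sup>2) \<le> (real N / 2) powr (- 2 * s) * (Hp_norm L s v)\<^sup>2"
proof -
  have "(\<Sum>k\<in>J. (cmod (fourier_coeff L v k))\<^sup>2)
      \<le> (\<Sum>k\<in>J. (real N / 2) powr (- 2 * s) * (Hp_weight s k * (cmod (fourier_coeff L v k))\<^sup>2))"
  proof (rule sum_mono)
    fix k assume "k \<in> J"
    then have "Hp_weight 0 k \<le> (real N / 2) powr (2 * 0 - 2 * s) * Hp_weight s k"
      using assms by (intro freq_range_compl_weight) auto
    moreover have "Hp_weight 0 k = 1" using add_pos_nonneg[of 1 "(real_of_int k)\<^sup>2"] by simp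
    ultimately have "1 \<le> (real N / 2) powr (- 2 * s) * Hp_weight s k" by simp
    from mult_right_mono[OF this, of "(cmod (fourier_coeff L v k))\<^sup>2"]
    show "(cmod (fourier_coeff L v k))\<^sup>2 \<le> (real N / 2) powr (- 2 * s) * (Hp_weight s k * (cmod (fourier_coeff L v k))\<^sup>2)"
      by (simp add: mult.assoc)
  qed
  also have "\<dots> = (real N / 2) powr (- 2 * s) * (\<Sum>k\<in>J. Hp_weight s k * (cmod (fourier_coeff L v k))\<^sup>2)"
    by (simp add: sum_distrib_left)
  also have "\<dots> \<le> (real N / 2) powr (- 2 * s) * (Hp_norm L s v)\<^sup>2"
    unfolding Hp_norm_power2
    by (intro mult_left_mono finite_sum_le_infsum HpD(4)[OF assms(3)] assms(5)) auto
  finally show ?thesis .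
qed

lemma card_freq_range: "even N \<Longrightarrow> card (freq_range N) = N"
  by (auto simp: freq_range_def elim!: evenE)

text \<open>The a priori bound \<open>\<bar>v t\<bar> \<le> M + 1\<close> on the discrete solution, which makes the nonlinearity Lipschitz, is
  propagated in time: it holds as long as the energy is at most \<open>1 / N\<close>, and the resulting estimate is
  below \<open>1 / N\<close>.\<close>

lemma galerkin_energy_bound:
  assumes L: "L > 0" and T: "T > 0" and s: "1 \<le> s" and C0: "0 \<le> C0" and g: "C2_real g" and N: "even N" "N > 0"
    and disp: "\<And>k. 0 \<le> dispersion L \<beta> k" "\<And>k. dispersion L \<beta> k \<le> C0"
    and U: "U \<in> X_space L s T"
    and init: "\<And>k. fourier_coeff L (U 0) k = fourier_coeff L (\<lambda>x. of_real (\<phi> x)) k"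
      "\<And>k. fourier_coeff L (Ut 0) k = fourier_coeff L (\<lambda>x. of_real (\<psi> x)) k"
    and der1: "\<And>t k. t \<in> {0..T} \<Longrightarrow>
      ((\<lambda>\<tau>. fourier_coeff L (U \<tau>) k) has_vector_derivative fourier_coeff L (Ut t) k) (at t within {0..T})"
    and der2: "\<And>t k. t \<in> {0..T} \<Longrightarrow>
      ((\<lambda>\<tau>. fourier_coeff L (Ut \<tau>) k) has_vector_derivative
        - of_real (dispersion L \<beta> k) * (fourier_coeff L (U t) k + fourier_coeff L (\<lambda>x. of_real (g (Re (U t x)))) k))
        (at t within {0..T})"
    and v: "scheme_curve L \<beta> g \<phi> \<psi> T N v vt"
    and X: "X = X_norm L s T U"
    and M: "0 \<le> M" "\<And>x y. \<bar>x\<bar> \<le> inverse_square_sum + X\<^sup>2 + 1 \<Longrightarrow> \<bar>y\<bar> \<le> inverse_square_sum + X\<^sup>2 + 1 \<Longrightarrow>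
      \<bar>g x - g y\<bar> \<le> M * \<bar>x - y\<bar>"
    and A: "A = 1 + 2 * C0 + C0 * M\<^sup>2"
    and small: "C0 * M\<^sup>2 * ((real N / 2) powr (- 2 * s) * X\<^sup>2) / A * exp (A * T) < 1 / real N"
    and t: "t \<in> {0..T}"
  shows "coeff_energy L N (U t) (v t) (Ut t) (vt t)
    \<le> C0 * M\<^sup>2 * ((real N / 2) powr (- 2 * s) * X\<^sup>2) / A * exp (A * T)"
proof -
  have vS: "v t \<in> S_space L N" if "t \<in> {0..T}" for t
    using v that by (simp add: scheme_curve_def)
  have UHp: "U t \<in> Hp L s" if "t \<in> {0..T}" for t by (rule X_spaceD(1)[OF U that])
  have UX: "(Hp_norm L s (U t))\<^sup>2 \<le> X\<^sup>2" if "t \<in> {0..T}" for t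
    using X_norm_bound[OF U that] zero_le_power2[of "Hp_norm L s (Hp_deriv L s T U t)"] unfolding X by linarith
  define p where "p k t = fourier_coeff L (U t) k - fourier_coeff L (v t) k" for k t
  define q where "q k t = fourier_coeff L (Ut t) k - fourier_coeff L (vt t) k" for k t
  define h where "h k t = fourier_coeff L (\<lambda>x. of_real (g (Re (U t x)))) k - fourier_coeff L (\<lambda>x. of_real (g (Re (v t x)))) k" for k t
  have "(\<Sum>k\<in>freq_range N. (cmod (p k t))\<^sup>2 + (cmod (q k t))\<^sup>2)
      \<le> C0 * M\<^sup>2 * ((real N / 2) powr (- 2 * s) * X\<^sup>2) / A * exp (A * T)"
  proof (rule oscillator_energy_bound[where h = h and lam = "dispersion L \<beta>" and m = "1 / real N"])
    fix k t assume kt: "k \<in> freq_range N" "t \<in> {0..T}"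
    show "(p k has_vector_derivative q k t) (at t within {0..T})"
      unfolding p_def[abs_def] q_def using v kt
      by (intro has_vector_derivative_diff der1) (simp_all add: scheme_curve_def)
    have "((\<lambda>t. fourier_coeff L (Ut t) k - fourier_coeff L (vt t) k) has_vector_derivative
        - of_real (dispersion L \<beta> k) * (fourier_coeff L (U t) k + fourier_coeff L (\<lambda>x. of_real (g (Re (U t x)))) k) -
        - of_real (dispersion L \<beta> k) * (fourier_coeff L (v t) k + fourier_coeff L (\<lambda>x. of_real (g (Re (v t x)))) k))
        (at t within {0..T})"
      using v kt by (intro has_vector_derivative_diff der2) (simp_all add: scheme_curve_def)
    then show "(q k has_vector_derivative - of_real (dispersion L \<beta> k) * (p k t + h k t)) (at t within {0..T})"
      unfolding p_def q_def[abs_def] h_def by (simp add: algebra_simps)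
  next
    fix k assume "k \<in> freq_range N"
    then show "p k 0 = 0" "q k 0 = 0"
      using scheme_curve_initial[OF L v] init by (simp_all add: p_def q_def)
  next
    fix t assume t: "t \<in> {0..T}"
      and E: "(\<Sum>k\<in>freq_range N. (cmod (p k t))\<^sup>2 + (cmod (q k t))\<^sup>2) \<le> 1 / real N"
    have sumU: "(\<Sum>k\<in>freq_range N. cmod (fourier_coeff L (U t) k)) \<le> inverse_square_sum + X\<^sup>2"
    proof -
      have "(\<Sum>k\<in>freq_range N. cmod (fourier_coeff L (U t) k)) \<le> (\<Sum>\<^sub>\<infinity>k. cmod (fourier_coeff L (U t) k))"
        by (rule finite_sum_le_infsum[OF Hp_abs_summable(1)[OF UHp[OF t] s]]) auto
      also have "\<dots> \<le> inverse_square_sum + X\<^sup>2"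
        using Hp_abs_summable(2)[OF UHp[OF t] s] UX[OF t] by linarith
      finally show ?thesis .
    qed
    have vb: "cmod (v t x) \<le> inverse_square_sum + X\<^sup>2 + 1" for x
    proof -
      have "(\<Sum>k\<in>freq_range N. (cmod (p k t))\<^sup>2) \<le> (\<Sum>k\<in>freq_range N. (cmod (p k t))\<^sup>2 + (cmod (q k t))\<^sup>2)"
        by (intro sum_mono) auto
      with E have E': "(\<Sum>k\<in>freq_range N. (cmod (p k t))\<^sup>2) \<le> 1 / real N" by linarith
      \<comment> \<open>Cauchy-Schwarz over the \<open>N\<close> frequencies of the band: an energy
        of at most \<open>1 / N\<close> gives a sum of absolute values of at most 1. This is the
        origin of the threshold \<open>1 / N\<close> and of the \<open>+ 1\<close> in the range of
        the Lipschitz bound.\<close>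
      have "(\<Sum>k\<in>freq_range N. cmod (p k t))\<^sup>2 \<le> (\<Sum>k\<in>freq_range N. (cmod (p k t))\<^sup>2) * real (card (freq_range N))"
        by (rule sum_squared_le_sum_of_squares)
      also have "\<dots> \<le> 1 / real N * real (card (freq_range N))"
        by (intro mult_right_mono E') auto
      also have "\<dots> = 1\<^sup>2" using N by (simp add: card_freq_range)
      finally have p1: "(\<Sum>k\<in>freq_range N. cmod (p k t)) \<le> 1" by (rule power2_le_imp_le) simp
      have "cmod (v t x) \<le> (\<Sum>k\<in>freq_range N. cmod (fourier_coeff L (v t) k))"
        by (rule S_space_cmod_le[OF L vS[OF t]])
      also have "\<dots> \<le> (\<Sum>k\<in>freq_range N. cmod (fourier_coeff L (U t) k) + cmod (p k t))"
      proof (rule sum_mono)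
        fix k
        show "cmod (fourier_coeff L (v t) k) \<le> cmod (fourier_coeff L (U t) k) + cmod (p k t)"
          using norm_triangle_ineq4[of "fourier_coeff L (U t) k" "p k t"] by (simp add: p_def)
      qed
      also have "\<dots> \<le> inverse_square_sum + X\<^sup>2 + 1" using sumU p1 by (simp add: sum.distrib)
      finally show ?thesis .
    qed
    \<comment> \<open>The inhomogeneity \<open>\<eta>\<close> is the bound on the tail of
      \<open>U\<close>, the part of \<open>U - v\<close> that the energy does not see.\<close>
    have "(\<Sum>k\<in>freq_range N. (cmod (h k t))\<^sup>2)
      \<le> M\<^sup>2 * ((\<Sum>k\<in>freq_range N. (cmod (p k t))\<^sup>2 + (cmod (q k t))\<^sup>2) + (real N / 2) powr (- 2 * s) * X\<^sup>2)"
      unfolding h_def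
    proof (rule lipschitz_nonlinearity_coeff[OF L C2_real_imp_measurable[OF g] HpD(2)[OF UHp[OF t]]
        S_space_measurable[OF vS[OF t]] M(2,1)])
      show "AE x in period_measure L. cmod (U t x) \<le> inverse_square_sum + X\<^sup>2 + 1"
        using Hp_bounded[OF L UHp[OF t] s] UX[OF t] by (auto elim!: eventually_mono)
      show "AE x in period_measure L. cmod (v t x) \<le> inverse_square_sum + X\<^sup>2 + 1"
        by (rule AE_I2) (rule vb)
      show "(\<lambda>k. cmod (fourier_coeff L (U t) k - fourier_coeff L (v t) k)) summable_on UNIV"
        by (rule summable_on_comparison_test[OF summable_on_add[OF Hp_abs_summable(1)[OF UHp[OF t] s]
            S_space_abs_summable[OF L vS[OF t]]]]) (auto simp: norm_triangle_ineq4)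
      fix J :: "int set" assume J: "finite J"
      have "(\<Sum>k\<in>J. (cmod (p k t))\<^sup>2) = (\<Sum>k\<in>J \<inter> freq_range N. (cmod (p k t))\<^sup>2) + (\<Sum>k\<in>J - freq_range N. (cmod (p k t))\<^sup>2)"
        using sum.Int_Diff[OF J] by blast
      moreover have "(\<Sum>k\<in>J \<inter> freq_range N. (cmod (p k t))\<^sup>2) \<le> (\<Sum>k\<in>freq_range N. (cmod (p k t))\<^sup>2)" by (intro sum_mono2) auto
      moreover have "\<dots> \<le> (\<Sum>k\<in>freq_range N. (cmod (p k t))\<^sup>2 + (cmod (q k t))\<^sup>2)" by (intro sum_mono) auto
      moreover have "(\<Sum>k\<in>J - freq_range N. (cmod (p k t))\<^sup>2) \<le> (real N / 2) powr (- 2 * s) * X\<^sup>2"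
      proof -
        \<comment> \<open>Outside the band \<open>v t\<close> has no coefficients, so
          \<open>p\<close> is the coefficient of \<open>U t\<close> there.\<close>
        have "(\<Sum>k\<in>J - freq_range N. (cmod (p k t))\<^sup>2) = (\<Sum>k\<in>J - freq_range N. (cmod (fourier_coeff L (U t) k))\<^sup>2)"
          using S_space_expansion(2)[OF L vS[OF t]] by (intro sum.cong) (auto simp: p_def)
        also have "\<dots> \<le> (real N / 2) powr (- 2 * s) * (Hp_norm L s (U t))\<^sup>2"
          using s J by (intro Hp_tail_sum N UHp t) auto
        also have "\<dots> \<le> (real N / 2) powr (- 2 * s) * X\<^sup>2" by (intro mult_left_mono UX t) auto
        finally show ?thesis .
      qed
      ultimately show "(\<Sum>k\<in>J. (cmod (fourier_coeff L (U t) k - fourier_coeff L (v t) k))\<^sup>2)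
          \<le> (\<Sum>k\<in>freq_range N. (cmod (p k t))\<^sup>2 + (cmod (q k t))\<^sup>2) + (real N / 2) powr (- 2 * s) * X\<^sup>2"
        unfolding p_def[symmetric] by linarith
    qed auto
    then show "(\<Sum>k\<in>freq_range N. (cmod (h k t))\<^sup>2)
      \<le> M\<^sup>2 * ((\<Sum>k\<in>freq_range N. (cmod (p k t))\<^sup>2 + (cmod (q k t))\<^sup>2) + (real N / 2) powr (- 2 * s) * X\<^sup>2)" .
  qed (use T C0 disp t small A in auto)
  then show ?thesis by (simp add: coeff_energy_def p_def q_def)
qed

section \<open>From the coefficient energy to Sobolev norms of the error\<close>

text \<open>Splits at the edge of the band: inside, the weight costs
  \<open>N powr (2 * \<sigma>)\<close>; outside, \<open>b\<close> has no coefficients and the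
  regularity of \<open>a\<close> gains \<open>(N / 2) powr (2 * \<sigma> - 2 * s)\<close>. The error
  \<open>e\<close> is described by its coefficients alone, so that the representative chosen by
  \<open>Hp_deriv\<close> can be inserted.\<close>

lemma Hp_norm_diff_S_space_bound:
  assumes L: "L > 0" and N: "even N" "N > 0" and "0 \<le> \<sigma>" "\<sigma> \<le> s" and a: "a \<in> Hp L s" and b: "b \<in> S_space L N"
    and e: "\<And>k. fourier_coeff L e k = fourier_coeff L a k - fourier_coeff L b k"
  shows "(Hp_norm L \<sigma> e)\<^sup>2 \<le> real N powr (2 * \<sigma>) * (\<Sum>k\<in>freq_range N. (cmod (fourier_coeff L a k - fourier_coeff L b k))\<^sup>2)
    + (real N / 2) powr (2 * \<sigma> - 2 * s) * (Hp_norm L s a)\<^sup>2"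
proof -
  let ?d = "\<lambda>k. (cmod (fourier_coeff L a k - fourier_coeff L b k))\<^sup>2"
  let ?w = "\<lambda>k. (if k \<in> freq_range N then real N powr (2 * \<sigma>) * ?d k else 0)
      + (real N / 2) powr (2 * \<sigma> - 2 * s) * (Hp_weight s k * (cmod (fourier_coeff L a k))\<^sup>2)"
  have s1: "(\<lambda>k. if k \<in> freq_range N then real N powr (2 * \<sigma>) * ?d k else 0) summable_on UNIV"
  proof -
    have "(\<lambda>k. real N powr (2 * \<sigma>) * ?d k) summable_on freq_range N" by simp
    then show ?thesis by (rule summable_on_cong_neutral[THEN iffD1, rotated -1]) auto
  qed
  have s2: "(\<lambda>k. (real N / 2) powr (2 * \<sigma> - 2 * s) * (Hp_weight s k * (cmod (fourier_coeff L a k))\<^sup>2)) summable_on UNIV"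
    by (intro summable_on_cmult_right HpD(4)[OF a])
  have le: "Hp_weight \<sigma> k * (cmod (fourier_coeff L e k))\<^sup>2 \<le> ?w k" for k
  proof (cases "k \<in> freq_range N")
    case True
    have "Hp_weight \<sigma> k * ?d k \<le> real N powr (2 * \<sigma>) * ?d k"
      by (intro mult_right_mono freq_range_weight N assms True) auto
    then show ?thesis using True by (simp add: e add_increasing2)
  next
    case False
    have "Hp_weight \<sigma> k * (cmod (fourier_coeff L a k))\<^sup>2
        \<le> ((real N / 2) powr (2 * \<sigma> - 2 * s) * Hp_weight s k) * (cmod (fourier_coeff L a k))\<^sup>2"
      by (intro mult_right_mono freq_range_compl_weight N assms False) auto
    then show ?thesis using False S_space_expansion(2)[OF L b False] by (simp add: e mult.assoc)
  qed
  have s0: "(\<lambda>k. Hp_weight \<sigma> k * (cmod (fourier_coeff L e k))\<^sup>2) summable_on UNIV"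
    by (rule summable_on_comparison_test[OF summable_on_add[OF s1 s2] le]) simp
  have "(Hp_norm L \<sigma> e)\<^sup>2 \<le> (\<Sum>\<^sub>\<infinity>k. ?w k)"
    unfolding Hp_norm_power2 by (rule infsum_mono[OF s0 summable_on_add[OF s1 s2] le])
  also have "\<dots> = (\<Sum>\<^sub>\<infinity>k. if k \<in> freq_range N then real N powr (2 * \<sigma>) * ?d k else 0)
      + (\<Sum>\<^sub>\<infinity>k. (real N / 2) powr (2 * \<sigma> - 2 * s) * (Hp_weight s k * (cmod (fourier_coeff L a k))\<^sup>2))"
    by (rule infsum_add[OF s1 s2])
  also have "(\<Sum>\<^sub>\<infinity>k. if k \<in> freq_range N then real N powr (2 * \<sigma>) * ?d k else 0)
      = (\<Sum>\<^sub>\<infinity>k\<in>freq_range N. real N powr (2 * \<sigma>) * ?d k)"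
    by (rule infsum_cong_neutral) auto
  also have "\<dots> = real N powr (2 * \<sigma>) * (\<Sum>k\<in>freq_range N. ?d k)" by (simp add: sum_distrib_left)
  also have "(\<Sum>\<^sub>\<infinity>k. (real N / 2) powr (2 * \<sigma> - 2 * s) * (Hp_weight s k * (cmod (fourier_coeff L a k))\<^sup>2))
      = (real N / 2) powr (2 * \<sigma> - 2 * s) * (Hp_norm L s a)\<^sup>2"
    unfolding Hp_norm_power2 by (rule infsum_cmult_right')
  finally show ?thesis .
qed

text \<open>The energy bound \<open>Q\<close> is left open because it is supplied in two ways: by
  the Galerkin estimate and, where that estimate is out of reach, by compactness of
  \<open>[0,T]\<close> for a single \<open>N\<close>.\<close>

lemma X_norm_error_bound:
  assumes L: "L > 0" and T: "T > 0" and N: "even N" "N > 0" and \<sigma>: "0 \<le> \<sigma>" "\<sigma> \<le> s" and U: "U \<in> X_space L s T"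
    and v: "scheme_curve L \<beta> g \<phi> \<psi> T N v vt"
    and Q: "\<And>t. t \<in> {0..T} \<Longrightarrow> coeff_energy L N (U t) (v t) (Hp_deriv L s T U t) (vt t) \<le> Q"
  shows "X_norm L \<sigma> T (\<lambda>t x. U t x - v t x)
    \<le> sqrt (real N powr (2 * \<sigma>) * Q + (real N / 2) powr (2 * \<sigma> - 2 * s) * (X_norm L s T U)\<^sup>2)"
proof (rule X_norm_le)
  have vS: "v t \<in> S_space L N" and vtS: "vt t \<in> S_space L N" if "t \<in> {0..T}" for t
    using v that by (simp_all add: scheme_curve_def)
  note XD = X_spaceD[OF U]
  have bound: "(Hp_norm L \<sigma> (\<lambda>x. U t x - v t x))\<^sup>2
      + (Hp_norm L \<sigma> (Hp_deriv L \<sigma> T (\<lambda>t x. U t x - v t x) t))\<^sup>2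
      \<le> real N powr (2 * \<sigma>) * Q + (real N / 2) powr (2 * \<sigma> - 2 * s) * (X_norm L s T U)\<^sup>2" if t: "t \<in> {0..T}" for t
  proof -
    let ?Ut = "Hp_deriv L s T U t" and ?e = "\<lambda>t x. U t x - v t x"
    define D where "D = Hp_deriv L \<sigma> T ?e t"
    have Us: "U \<tau> \<in> Hp L \<sigma>" if "\<tau> \<in> {0..T}" for \<tau> by (rule Hp_mono(1)[OF XD(1)[OF that] \<sigma>(2)])
    have vs: "v \<tau> \<in> Hp L \<sigma>" if "\<tau> \<in> {0..T}" for \<tau> by (rule S_space_subset_Hp[OF L vS[OF that]])
    have eHp: "?e \<tau> \<in> Hp L \<sigma>" if "\<tau> \<in> {0..T}" for \<tau> by (rule Hp_diff[OF Us[OF that] vs[OF that]])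
    have dv: "has_Hp_derivative L \<sigma> T v (vt t) t"
      by (rule S_space_has_Hp_derivative[OF L vS t vtS[OF t]]) (use v t in \<open>auto simp: scheme_curve_def\<close>)
    have de: "has_Hp_derivative L \<sigma> T ?e (\<lambda>x. ?Ut x - vt t x) t"
      by (rule has_Hp_derivative_diff[OF has_Hp_derivative_mono[OF XD(2)[OF t] \<sigma>(2) XD(1) t] dv Us vs t])
    then have dD: "has_Hp_derivative L \<sigma> T ?e D t"
      unfolding D_def by (rule Hp_deriv_works)
    have "fourier_coeff L D k = fourier_coeff L (\<lambda>x. ?Ut x - vt t x) k" for k
      by (rule has_Hp_derivative_coeff_unique[OF \<sigma>(1) T eHp t dD de])
    then have Dk: "fourier_coeff L D k = fourier_coeff L ?Ut k - fourier_coeff L (vt t) k" for k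
      by (simp add: fourier_coeff_diff[OF HpD(5)[OF XD(3)[OF t]] S_space_integrable[OF vtS[OF t]]])
    have ek: "fourier_coeff L (?e t) k = fourier_coeff L (U t) k - fourier_coeff L (v t) k" for k
      by (rule fourier_coeff_diff[OF HpD(5)[OF XD(1)[OF t]] S_space_integrable[OF vS[OF t]]])
    have "(Hp_norm L \<sigma> (?e t))\<^sup>2 + (Hp_norm L \<sigma> D)\<^sup>2
      \<le> (real N powr (2 * \<sigma>) * (\<Sum>k\<in>freq_range N. (cmod (fourier_coeff L (U t) k - fourier_coeff L (v t) k))\<^sup>2)
          + (real N / 2) powr (2 * \<sigma> - 2 * s) * (Hp_norm L s (U t))\<^sup>2)
        + (real N powr (2 * \<sigma>) * (\<Sum>k\<in>freq_range N. (cmod (fourier_coeff L ?Ut k - fourier_coeff L (vt t) k))\<^sup>2)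
          + (real N / 2) powr (2 * \<sigma> - 2 * s) * (Hp_norm L s ?Ut)\<^sup>2)"
      by (intro add_mono Hp_norm_diff_S_space_bound[OF L N \<sigma> XD(1)[OF t] vS[OF t] ek]
          Hp_norm_diff_S_space_bound[OF L N \<sigma> XD(3)[OF t] vtS[OF t] Dk])
    also have "\<dots> = real N powr (2 * \<sigma>) * coeff_energy L N (U t) (v t) ?Ut (vt t)
        + (real N / 2) powr (2 * \<sigma> - 2 * s) * ((Hp_norm L s (U t))\<^sup>2 + (Hp_norm L s ?Ut)\<^sup>2)"
      by (simp add: coeff_energy_def sum.distrib algebra_simps)
    also have "\<dots> \<le> real N powr (2 * \<sigma>) * Q + (real N / 2) powr (2 * \<sigma> - 2 * s) * (X_norm L s T U)\<^sup>2"
      by (intro add_mono mult_left_mono Q t X_norm_bound[OF U]) auto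
    finally show ?thesis unfolding D_def .
  qed
  \<comment> \<open>\<open>Q\<close> carries no sign; the sum of squares at time 0 shows that the
    radicand is nonnegative.\<close>
  have nn: "0 \<le> real N powr (2 * \<sigma>) * Q + (real N / 2) powr (2 * \<sigma> - 2 * s) * (X_norm L s T U)\<^sup>2"
    using order_trans[OF _ bound[of 0]] T by (simp add: add_nonneg_nonneg)
  then show "0 \<le> sqrt (real N powr (2 * \<sigma>) * Q + (real N / 2) powr (2 * \<sigma> - 2 * s) * (X_norm L s T U)\<^sup>2)" by simp
  show "0 \<le> T" using T by simp
  fix t assume "t \<in> {0..T}"
  from bound[OF this] nn
  show "(Hp_norm L \<sigma> (\<lambda>x. U t x - v t x))\<^sup>2 + (Hp_norm L \<sigma> (Hp_deriv L \<sigma> T (\<lambda>t x. U t x - v t x) t))\<^sup>2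
      \<le> (sqrt (real N powr (2 * \<sigma>) * Q + (real N / 2) powr (2 * \<sigma> - 2 * s) * (X_norm L s T U)\<^sup>2))\<^sup>2"
    by simp
qed

text \<open>Both terms scale like \<open>n powr (2 * \<sigma> - 2 * s)\<close>; the powers of 2 come
  from the half width \<open>n / 2\<close> of the band.\<close>

lemma scaled_error_identity:
  fixes n :: real
  assumes "0 \<le> n"
  shows "n powr (2 * \<sigma>) * (E * ((n / 2) powr (- 2 * s) * X\<^sup>2)) + (n / 2) powr (2 * \<sigma> - 2 * s) * X\<^sup>2
    = (E * 2 powr (2 * s) + 2 powr (2 * s - 2 * \<sigma>)) * (n powr (\<sigma> - s))\<^sup>2 * X\<^sup>2"
proof -
  have half: "(n / 2) powr a = n powr a * 2 powr (- a)" for a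
    using assms by (simp add: powr_divide powr_minus_divide)
  have 1: "(n / 2) powr (- 2 * s) = n powr (- 2 * s) * 2 powr (2 * s)"
    using half[of "- 2 * s"] by simp
  have 2: "(n / 2) powr (2 * \<sigma> - 2 * s) = n powr (2 * \<sigma> - 2 * s) * 2 powr (2 * s - 2 * \<sigma>)"
    using half[of "2 * \<sigma> - 2 * s"] by simp
  have "2 * \<sigma> - 2 * s = 2 * \<sigma> + - 2 * s" "2 * \<sigma> - 2 * s = (\<sigma> - s) + (\<sigma> - s)" by simp_all
  then have 3: "n powr (2 * \<sigma> - 2 * s) = n powr (2 * \<sigma>) * n powr (- 2 * s)"
    and 4: "(n powr (\<sigma> - s))\<^sup>2 = n powr (2 * \<sigma> - 2 * s)"
    unfolding power2_eq_square by (metis powr_add)+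
  have "n powr (2 * \<sigma>) * (E * ((n / 2) powr (- 2 * s) * X\<^sup>2))
      = n powr (2 * \<sigma> - 2 * s) * (E * 2 powr (2 * s)) * X\<^sup>2"
    unfolding 1 3 by (simp only: ac_simps)
  then show ?thesis unfolding 2 4 by (simp only: distrib_right distrib_left ac_simps)
qed

theorem theorem3p4:
  fixes L C0 r s :: real
    and \<beta> g \<phi> \<psi> :: "real \<Rightarrow> real"
    and u :: "real \<Rightarrow> real \<Rightarrow> real"
  assumes "L > 0"
    and "integrable lborel \<beta>"
    and "C0 > 0" and "r \<ge> 2"
    and "\<And>k. fourier_transform \<beta> k \<in> \<real> \<and> 0 \<le> Re (fourier_transform \<beta> k) \<and>
           Re (fourier_transform \<beta> k) \<le> C0 * (1 + k\<^sup>2) powr (- r / 2)"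
    and "s \<ge> r / 2"
    and "C2_real g"
    and "(\<lambda>x. complex_of_real (\<phi> x)) \<in> Hp L s"
    and "(\<lambda>x. complex_of_real (\<psi> x)) \<in> Hp L s"
    and "\<And>T. T > 0 \<Longrightarrow> ivp_solution L \<beta> g \<phi> \<psi> s T u"
  shows "\<forall>T>0. \<exists>C::real. \<forall>N uN. even N \<and> N > 0 \<and> scheme_solution L \<beta> g \<phi> \<psi> T N uN \<longrightarrow>
           X_norm L (r / 2) T (\<lambda>t x. complex_of_real (u t x) - uN t x)
             \<le> C * real N powr (r / 2 - s) * X_norm L s T (\<lambda>t x. complex_of_real (u t x))"
proof (intro allI impI)
  fix T :: real assume T: "T > 0"
  define U where "U = (\<lambda>t x. complex_of_real (u t x))"
  define Ut where "Ut = Hp_deriv L s T U"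
  define X where "X = X_norm L s T U"
  define \<sigma> where "\<sigma> = r / 2"
  have s: "1 \<le> s" and \<sigma>: "0 \<le> \<sigma>" "\<sigma> \<le> s" using assms(4,6) by (auto simp: \<sigma>_def)
  have real: "fourier_transform \<beta> k \<in> \<real>" for k using assms(5) by blast
  have disp: "0 \<le> dispersion L \<beta> k" "dispersion L \<beta> k \<le> C0" for k
    using dispersion_bounds[OF assms(3,4), of \<beta> L k] assms(5) by auto
  note ivp = ivp_solution_coeff[OF assms(1) T s assms(2) real assms(7-9) assms(10)[OF T]]
  have UX: "U \<in> X_space L s T" unfolding U_def by (rule ivp(1))
  have init: "fourier_coeff L (U 0) k = fourier_coeff L (\<lambda>x. of_real (\<phi> x)) k"
    "fourier_coeff L (Ut 0) k = fourier_coeff L (\<lambda>x. of_real (\<psi> x)) k" for k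
    unfolding Ut_def U_def by (rule ivp(2,3))+
  have der1: "((\<lambda>\<tau>. fourier_coeff L (U \<tau>) k) has_vector_derivative fourier_coeff L (Ut t) k) (at t within {0..T})"
    if "t \<in> {0..T}" for t k
    unfolding Ut_def U_def by (rule ivp(4)[OF that])
  have der2: "((\<lambda>\<tau>. fourier_coeff L (Ut \<tau>) k) has_vector_derivative
      - of_real (dispersion L \<beta> k) * (fourier_coeff L (U t) k + fourier_coeff L (\<lambda>x. of_real (g (Re (U t x)))) k))
      (at t within {0..T})" if "t \<in> {0..T}" for t k
    unfolding Ut_def U_def by (rule ivp(5)[OF that])
  have X0: "0 \<le> X" unfolding X_def using X_norm_nonneg[OF UX] T by simp
  obtain M where M: "0 \<le> M" "\<And>x y. \<bar>x\<bar> \<le> inverse_square_sum + X\<^sup>2 + 1 \<Longrightarrow> \<bar>y\<bar> \<le> inverse_square_sum + X\<^sup>2 + 1 \<Longrightarrow>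
      \<bar>g x - g y\<bar> \<le> M * \<bar>x - y\<bar>"
    using C2_real_imp_locally_lipschitz[OF assms(7)] by blast
  define A where "A = 1 + 2 * C0 + C0 * M\<^sup>2"
  have A: "A > 0" using assms(3) unfolding A_def by (intro add_pos_nonneg) auto
  \<comment> \<open>Amplification factor: the energy is at most \<open>E\<close> times the tail
    bound. It depends on \<open>T\<close> and, through \<open>M\<close>, on the norm of
    \<open>u\<close>, but not on \<open>N\<close>.\<close>
  define E where "E = C0 * M\<^sup>2 / A * exp (A * T)"
  have E: "0 \<le> E" using assms(3) A by (simp add: E_def)
  \<comment> \<open>Square root of the constant that \<open>scaled_error_identity\<close> factors
    out.\<close>
  define C1 where "C1 = sqrt (E * 2 powr (2 * s) + 2 powr (2 * s - 2 * \<sigma>))"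
  have good: "X_norm L \<sigma> T (\<lambda>t x. U t x - v t x) \<le> C1 * real N powr (\<sigma> - s) * X"
    if N: "even N" "N > 0" and v: "scheme_solution L \<beta> g \<phi> \<psi> T N v"
      and small: "E * ((real N / 2) powr (- 2 * s) * X\<^sup>2) < 1 / real N" for N v
  proof -
    obtain vt where vt: "scheme_curve L \<beta> g \<phi> \<psi> T N v vt"
      using scheme_solution_imp_curve[OF assms(1) N(2) T v real] by blast
    have Eeq: "C0 * M\<^sup>2 * d / A * exp (A * T) = E * d" for d by (simp add: E_def)
    have small': "C0 * M\<^sup>2 * ((real N / 2) powr (- 2 * s) * X\<^sup>2) / A * exp (A * T) < 1 / real N"
      unfolding Eeq by (rule small)
    have "coeff_energy L N (U t) (v t) (Ut t) (vt t) \<le> E * ((real N / 2) powr (- 2 * s) * X\<^sup>2)" if t: "t \<in> {0..T}" for t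
      unfolding Eeq[symmetric]
      by (rule galerkin_energy_bound[OF assms(1) T s less_imp_le[OF assms(3)] assms(7) N disp UX init der1 der2 vt
          X_def M A_def small' t])
    then have "X_norm L \<sigma> T (\<lambda>t x. U t x - v t x)
      \<le> sqrt (real N powr (2 * \<sigma>) * (E * ((real N / 2) powr (- 2 * s) * X\<^sup>2)) + (real N / 2) powr (2 * \<sigma> - 2 * s) * X\<^sup>2)"
      unfolding X_def Ut_def by (rule X_norm_error_bound[OF assms(1) T N \<sigma> UX vt])
    also have "real N powr (2 * \<sigma>) * (E * ((real N / 2) powr (- 2 * s) * X\<^sup>2)) + (real N / 2) powr (2 * \<sigma> - 2 * s) * X\<^sup>2
      = (E * 2 powr (2 * s) + 2 powr (2 * s - 2 * \<sigma>)) * (real N powr (\<sigma> - s))\<^sup>2 * X\<^sup>2"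
      by (rule scaled_error_identity) simp
    also have "sqrt ((E * 2 powr (2 * s) + 2 powr (2 * s - 2 * \<sigma>)) * (real N powr (\<sigma> - s))\<^sup>2 * X\<^sup>2)
      = C1 * real N powr (\<sigma> - s) * X"
      using X0 by (simp add: C1_def real_sqrt_mult)
    finally show ?thesis .
  qed
  \<comment> \<open>As \<open>s \<ge> 1\<close> and \<open>N \<ge> 2\<close>, the left side of the
    smallness condition is at most \<open>4 * E * X\<^sup>2 / N\<^sup>2\<close>, which is below
    \<open>1 / N\<close> once \<open>N > 4 * E * X\<^sup>2\<close>.\<close>
  define N0 where "N0 = nat \<lceil>4 * E * X\<^sup>2\<rceil> + 1"
  have large: "E * ((real N / 2) powr (- 2 * s) * X\<^sup>2) < 1 / real N" if N: "even N" "N > 0" "N \<ge> N0" for N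
  proof -
    have "2 \<le> real N" using N by (auto elim!: evenE)
    then have "(real N / 2) powr (- 2 * s) \<le> (real N / 2) powr (- 2)"
      using s by (intro powr_mono) auto
    also have "(real N / 2) powr (- 2) = 4 / (real N)\<^sup>2"
      using N by (simp add: powr_minus_divide power_divide)
    finally have "E * ((real N / 2) powr (- 2 * s) * X\<^sup>2) \<le> E * (4 / (real N)\<^sup>2 * X\<^sup>2)"
      using E by (intro mult_left_mono mult_right_mono) auto
    also have "\<dots> = (4 * E * X\<^sup>2) / real N * (1 / real N)" by (simp add: power2_eq_square)
    also have "\<dots> < 1 * (1 / real N)"
    proof (rule mult_strict_right_mono)
      have "4 * E * X\<^sup>2 < real N" using N(3) unfolding N0_def by linarith
      then show "4 * E * X\<^sup>2 / real N < 1" using N by simp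
    qed (use N in simp)
    finally show ?thesis by simp
  qed
  have each: "\<exists>C\<ge>0. \<forall>v. even N \<and> N > 0 \<and> scheme_solution L \<beta> g \<phi> \<psi> T N v \<longrightarrow>
      X_norm L \<sigma> T (\<lambda>t x. U t x - v t x) \<le> C * real N powr (\<sigma> - s) * X" for N
  proof (cases "even N \<and> N > 0 \<and> X > 0 \<and> (\<exists>v. scheme_solution L \<beta> g \<phi> \<psi> T N v)")
    case False
    have "X_norm L \<sigma> T (\<lambda>t x. U t x - v t x) \<le> C1 * real N powr (\<sigma> - s) * X"
      if "even N \<and> N > 0 \<and> scheme_solution L \<beta> g \<phi> \<psi> T N v" for v
    proof -
      \<comment> \<open>Then the smallness condition reads \<open>0 < 1 / N\<close>, so the estimate
        holds at every \<open>N\<close> with \<open>C1\<close>; no positive constant could absorb an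
        error here.\<close>
      have "X = 0" using False that X0 by auto
      then show ?thesis using that by (intro good) auto
    qed
    moreover have "C1 \<ge> 0" using E by (simp add: C1_def)
    ultimately show ?thesis by blast
  next
    case True
    \<comment> \<open>One solution is fixed to define the constant; by uniqueness every other
      solution for this \<open>N\<close> has the same energy.\<close>
    then obtain w where N: "even N" "N > 0" and X: "X > 0" and "scheme_solution L \<beta> g \<phi> \<psi> T N w" by blast
    then obtain wt where w: "scheme_curve L \<beta> g \<phi> \<psi> T N w wt"
      using scheme_solution_imp_curve[OF assms(1) N(2) T _ real] by blast
    have "continuous_on {0..T} (\<lambda>t. coeff_energy L N (U t) (w t) (Ut t) (wt t))"
      unfolding coeff_energy_def continuous_on_eq_continuous_within
    proof (intro ballI continuous_sum continuous_add continuous_power continuous_norm continuous_diff)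
      fix t k assume tk: "t \<in> {0..T}" "k \<in> freq_range N"
      show "continuous (at t within {0..T}) (\<lambda>t. fourier_coeff L (U t) k)"
        "continuous (at t within {0..T}) (\<lambda>t. fourier_coeff L (Ut t) k)"
        using has_vector_derivative_continuous[OF der1[OF tk(1)]] has_vector_derivative_continuous[OF der2[OF tk(1)]] by blast+
      show "continuous (at t within {0..T}) (\<lambda>t. fourier_coeff L (w t) k)"
        "continuous (at t within {0..T}) (\<lambda>t. fourier_coeff L (wt t) k)"
        using w tk unfolding scheme_curve_def by (blast intro: has_vector_derivative_continuous)+
    qed
    then have "compact ((\<lambda>t. coeff_energy L N (U t) (w t) (Ut t) (wt t)) ` {0..T})"
      by (intro compact_continuous_image) auto
    then have "bdd_above ((\<lambda>t. coeff_energy L N (U t) (w t) (Ut t) (wt t)) ` {0..T})"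
      by (intro bounded_imp_bdd_above compact_imp_bounded)
    then obtain Q where "\<forall>y\<in>(\<lambda>t. coeff_energy L N (U t) (w t) (Ut t) (wt t)) ` {0..T}. y \<le> Q"
      unfolding bdd_above_def by blast
    then have Q: "coeff_energy L N (U t) (w t) (Ut t) (wt t) \<le> Q" if "t \<in> {0..T}" for t
      using that by blast
    define B where "B = sqrt (real N powr (2 * \<sigma>) * Q + (real N / 2) powr (2 * \<sigma> - 2 * s) * X\<^sup>2)"
    have B: "X_norm L \<sigma> T (\<lambda>t x. U t x - v t x) \<le> B" if v: "scheme_solution L \<beta> g \<phi> \<psi> T N v" for v
    proof -
      obtain vt where vt: "scheme_curve L \<beta> g \<phi> \<psi> T N v vt"
        using scheme_solution_imp_curve[OF assms(1) N(2) T v real] by blast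
      have "coeff_energy L N (U t) (v t) (Ut t) (vt t) \<le> Q" if t: "t \<in> {0..T}" for t
      proof -
        have "coeff_energy L N (U t) (v t) (Ut t) (vt t) = coeff_energy L N (U t) (w t) (Ut t) (wt t)"
          unfolding coeff_energy_def
          using scheme_curve_unique[OF assms(1) T _ assms(7) disp vt w t] assms(3) by (intro sum.cong) auto
        then show ?thesis using Q[OF t] by simp
      qed
      then show ?thesis
        unfolding B_def X_def Ut_def by (rule X_norm_error_bound[OF assms(1) T N \<sigma> UX vt])
    qed
    \<comment> \<open>Positive because \<open>X > 0\<close>, so the fixed error bound is a multiple
      of it.\<close>
    define c where "c = real N powr (\<sigma> - s) * X"
    have c: "c > 0" using N X by (simp add: c_def)
    have "X_norm L \<sigma> T (\<lambda>t x. U t x - v t x) \<le> \<bar>B\<bar> / c * real N powr (\<sigma> - s) * X"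
      if "scheme_solution L \<beta> g \<phi> \<psi> T N v" for v
    proof -
      have "\<bar>B\<bar> / c * real N powr (\<sigma> - s) * X = \<bar>B\<bar>"
        using c by (simp add: c_def[symmetric] mult.assoc)
      moreover have "X_norm L \<sigma> T (\<lambda>t x. U t x - v t x) \<le> \<bar>B\<bar>"
        using B[OF that] abs_ge_self by (rule order_trans)
      ultimately show ?thesis by (simp only:)
    qed
    then show ?thesis using c by (intro exI[of _ "\<bar>B\<bar> / c"]) auto
  qed
  then obtain C' where C': "\<And>N. 0 \<le> C' N" "\<And>N v. even N \<Longrightarrow> N > 0 \<Longrightarrow> scheme_solution L \<beta> g \<phi> \<psi> T N v \<Longrightarrow>
      X_norm L \<sigma> T (\<lambda>t x. U t x - v t x) \<le> C' N * real N powr (\<sigma> - s) * X"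
    by metis
  \<comment> \<open>All \<open>C' N\<close> are nonnegative, so the sum dominates each of them for
    \<open>N < N0\<close>, while \<open>C1\<close> serves \<open>N \<ge> N0\<close>.\<close>
  define C where "C = C1 + (\<Sum>N<N0. C' N)"
  have C1: "C1 \<ge> 0" using E by (simp add: C1_def)
  have "X_norm L \<sigma> T (\<lambda>t x. U t x - v t x) \<le> C * real N powr (\<sigma> - s) * X"
    if v: "even N" "N > 0" "scheme_solution L \<beta> g \<phi> \<psi> T N v" for N v
  proof (cases "N \<ge> N0")
    case True
    have "X_norm L \<sigma> T (\<lambda>t x. U t x - v t x) \<le> C1 * real N powr (\<sigma> - s) * X"
      by (rule good[OF v large[OF v(1,2) True]])
    also have "\<dots> \<le> C * real N powr (\<sigma> - s) * X"
      using X0 by (intro mult_right_mono) (auto simp: C_def intro!: sum_nonneg C'(1))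
    finally show ?thesis .
  next
    case False
    then have "C' N \<le> (\<Sum>N<N0. C' N)" using C'(1) by (intro member_le_sum) auto
    then have "C' N \<le> C" using C1 by (simp add: C_def)
    have "X_norm L \<sigma> T (\<lambda>t x. U t x - v t x) \<le> C' N * real N powr (\<sigma> - s) * X"
      by (rule C'(2)[OF v])
    also have "\<dots> \<le> C * real N powr (\<sigma> - s) * X"
      using X0 \<open>C' N \<le> C\<close> by (intro mult_right_mono) auto
    finally show ?thesis .
  qed
  then have "\<forall>N v. even N \<and> N > 0 \<and> scheme_solution L \<beta> g \<phi> \<psi> T N v \<longrightarrow>
      X_norm L \<sigma> T (\<lambda>t x. U t x - v t x) \<le> C * real N powr (\<sigma> - s) * X"
    by blast
  then show "\<exists>C::real. \<forall>N uN. even N \<and> N > 0 \<and> scheme_solution L \<beta> g \<phi> \<psi> T N uN \<longrightarrow>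
           X_norm L (r / 2) T (\<lambda>t x. complex_of_real (u t x) - uN t x)
             \<le> C * real N powr (r / 2 - s) * X_norm L s T (\<lambda>t x. complex_of_real (u t x))"
    unfolding X_def \<sigma>_def U_def by blast
qed

end
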